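(* Let $f,g:\mathbb{R}^n\to\mathbb{R}\cup\{+\infty\}$ be proper, closed, convex and piecewise linear-quadratic (PLQ), $\gamma>0$, $\alpha\in(0,1)$, $A,B\in\mathbb{R}^{m\times n}$, and $c\in\mathbb{R}^m$. In each case below assume that the optimization problem associated with the operator $F$ has an optimal solution. (i) Let $F\in\{F_P,F_{DR},F_{ADMM}\}$. Then there exist $R>0$ and $K_F>0$ such that $\operatorname{dist}(x,\mathcal{F}_F)\le R$ implies $\operatorname{dist}(x,\mathcal{F}_F)\le K_F\|F(x)-x\|$, and for any starting point $x_0$ the sequence $x_k=F(x_{k-1})$ converges linearly to some $x^*\in\mathcal{F}_F$, which corresponds to an optimal solution of the associated optimization problem. (ii) Let $F\in\{F_{GD},F_{GP},F_{PG}\}$. If additionally $f$ is differentiable and either $\mu$-strongly convex for some $\mu>0$ or $L$-smooth for some $L>0$, and $S\subseteq\mathbb{R}^n$ is a polyhedron, then for all sufficiently small step sizes $\lambda>0$ there exist $R>0$ and $K_F>0$ such that $\operatorname{dist}(x,\mathcal{F}_F)\le R$ implies $\operatorname{dist}(x,\mathcal{F}_F)\le K_F\|F(x)-x\|$, and for any starting point $x_0$ the sequence $x_k=F(x_{k-1})$ converges linearly to some $x^*\in\mathcal{F}_F$, which corresponds to an optimal solution of the associated optimization problem.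
   Context: $\|\cdot\|$ is the Euclidean norm, $\operatorname{dist}(x,S)=\inf_{y\in S}\|x-y\|$, $\mathcal{F}_F:=\{x:F(x)=x\}$, and $\Pi_S$ is the Euclidean projection onto $S$. A function $f:\mathbb{R}^n\to\mathbb{R}\cup\{+\infty\}$ is PLQ if there are finitely many polyhedra $P_1,\dots,P_k$ with $\operatorname{dom}(f)=\bigcup_iP_i$ and on each $P_i$, $f(x)=\frac12x^\top Q_ix+c_i^\top x+b_i$ for some symmetric $Q_i$, $c_i\in\mathbb{R}^n$, $b_i\in\mathbb{R}$. $f$ is $\mu$-strongly convex if $f-\frac\mu2\|\cdot\|^2$ is convex; $f$ is $L$-smooth if $\nabla f$ is $L$-Lipschitz. A differentiable $f$ is finite on all of $\mathbb{R}^n$. $x_k$ converges linearly to $x^*$ if $x_k\to x^*$ and there are $q\in[0,1)$, $k_0$ with $\|x_{k+1}-x^*\|\le q\|x_k-x^*\|$ for all $k\ge k_0$. For $h$ proper closed convex, $\operatorname{prox}_{\gamma h}(x)=\operatorname{argmin}_u\{\gamma h(u)+\frac12\|u-x\|^2\}$ and $\operatorname{ref}_{\gamma h}(x)=2\operatorname{prox}_{\gamma h}(x)-x$. Operators, associated problems, and the meaning of "$x^*$ corresponds to an optimal solution": - Proximal point: $F_P(x)=\operatorname{prox}_{\gamma f}(x)$; problem $\min_{x\in\mathbb{R}^n}f(x)$; $x^*$ is optimal. - Douglas-Rachford: $F_{DR}(x)=(1-\alpha)x+\alpha\operatorname{ref}_{\gamma g}(\operatorname{ref}_{\gamma f}(x))$;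 problem $\min_{x\in\mathbb{R}^n}f(x)+g(x)$; $\operatorname{prox}_{\gamma f}(x^* )$ is optimal. - ADMM: $F_{ADMM}(x)=\frac12x+\frac12\operatorname{ref}_{\gamma\tilde g}(\operatorname{ref}_{\gamma\tilde f}(x))$ on $\mathbb{R}^m$, where $\tilde f(w)=\min_{z\in\mathbb{R}^n}\{f(z):c-Az=w\}$ and $\tilde g(w)=\min_{z\in\mathbb{R}^n}\{g(z):Bz=w\}$ (value $+\infty$ if infeasible); problem $\min_{x,y\in\mathbb{R}^n}\{f(x)+g(y):Ax+By=c\}$; there are $\hat x\in\operatorname{argmin}_x\{f(x):c-Ax=\operatorname{prox}_{\gamma\tilde f}(x^* )\}$ and $\hat y\in\operatorname{argmin}_y\{g(y):By=\operatorname{prox}_{\gamma\tilde f}(x^* )\}$ such that $(\hat x,\hat y)$ is optimal. - Gradient descent: $F_{GD}(x)=x-\lambda\nabla f(x)$; problem $\min_{x\in\mathbb{R}^n}f(x)$; $x^*$ is optimal. - Gradient projection: $F_{GP}(x)=\Pi_S(x-\lambda\nabla f(x))$; problem $\min_{x\in S}f(x)$; $x^*$ is optimal. - Proximal gradient: $F_{PG}(x)=\operatorname{prox}_{\lambda g}(x-\lambda\nabla f(x))$; problem $\min_{x\in\mathbb{R}^n}f(x)+g(x)$; $x^*$ is optimal. *)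

theory Defs
  imports "HOL-Analysis.Analysis"
begin

text \<open>Functions with values in the reals together with \<open>+\<infinity>\<close> have type \<^typ>\<open>'a \<Rightarrow> ereal\<close>;
  the value \<open>-\<infinity>\<close> is excluded by properness.\<close>

definition proper_fun :: "('a \<Rightarrow> ereal) \<Rightarrow> bool" where
  "proper_fun f \<longleftrightarrow> (\<forall>x. f x \<noteq> -\<infinity>) \<and> (\<exists>x. f x \<noteq> \<infinity>)"

definition eff_dom :: "('a \<Rightarrow> ereal) \<Rightarrow> 'a set" where
  "eff_dom f = {x. f x < \<infinity>}"

definition epi :: "('a \<Rightarrow> ereal) \<Rightarrow> ('a \<times> real) set" where
  "epi f = {(x, r). f x \<le> ereal r}"

definition closed_fun :: "('a::topological_space \<Rightarrow> ereal) \<Rightarrow> bool" where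
  "closed_fun f \<longleftrightarrow> closed (epi f)"

definition convex_fun :: "('a::real_vector \<Rightarrow> ereal) \<Rightarrow> bool" where
  "convex_fun f \<longleftrightarrow> convex (epi f)"

definition PLQ :: "(real^'n \<Rightarrow> ereal) \<Rightarrow> bool" where
  "PLQ f \<longleftrightarrow>
     (\<exists>(k::nat) (P :: nat \<Rightarrow> (real^'n) set) (Q :: nat \<Rightarrow> real^'n^'n) (q :: nat \<Rightarrow> real^'n) (b :: nat \<Rightarrow> real).
        (\<forall>i\<in>{1..k}. polyhedron (P i) \<and> transpose (Q i) = Q i) \<and>
        eff_dom f = (\<Union>i\<in>{1..k}. P i) \<and>
        (\<forall>i\<in>{1..k}. \<forall>x\<in>P i. f x = ereal (1/2 * (x \<bullet> (Q i *v x)) + q i \<bullet> x + b i)))"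

definition differentiable_fun :: "('a::real_normed_vector \<Rightarrow> ereal) \<Rightarrow> bool" where
  "differentiable_fun f \<longleftrightarrow>
     (\<forall>x. \<bar>f x\<bar> \<noteq> \<infinity>) \<and> (\<lambda>x. real_of_ereal (f x)) differentiable_on UNIV"

definition grad :: "('a::real_inner \<Rightarrow> ereal) \<Rightarrow> 'a \<Rightarrow> 'a" where
  "grad f x = (THE D. gderiv (\<lambda>y. real_of_ereal (f y)) x D)"

definition strongly_convex :: "real \<Rightarrow> ('a::real_inner \<Rightarrow> ereal) \<Rightarrow> bool" where
  "strongly_convex \<mu> f \<longleftrightarrow> convex_fun (\<lambda>x. f x - ereal (\<mu>/2 * (norm x)\<^sup>2))"

definition L_smooth :: "real \<Rightarrow> ('a::real_inner \<Rightarrow> ereal) \<Rightarrow> bool" where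
  "L_smooth L f \<longleftrightarrow> L-lipschitz_on UNIV (grad f)"

text \<open>A minimizer must have a value below \<open>+\<infinity>\<close>: an infeasible problem has no optimal
  solution.\<close>

definition argmin_on :: "('a \<Rightarrow> ereal) \<Rightarrow> 'a set \<Rightarrow> 'a set" where
  "argmin_on \<phi> C = {u \<in> C. \<phi> u < \<infinity> \<and> (\<forall>v\<in>C. \<phi> u \<le> \<phi> v)}"

definition prox :: "real \<Rightarrow> ('a::real_normed_vector \<Rightarrow> ereal) \<Rightarrow> 'a \<Rightarrow> 'a" where
  "prox \<gamma> h x = (THE u. u \<in> argmin_on (\<lambda>u. ereal \<gamma> * h u + ereal (1/2 * (norm (u - x))\<^sup>2)) UNIV)"

definition refl_prox :: "real \<Rightarrow> ('a::real_normed_vector \<Rightarrow> ereal) \<Rightarrow> 'a \<Rightarrow> 'a" where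
  "refl_prox \<gamma> h x = 2 *\<^sub>R prox \<gamma> h x - x"

text \<open>The minimum in the two partial minimizations is written as an infimum in
  \<^typ>\<open>ereal\<close>, so that the infeasible case automatically gives \<open>+\<infinity>\<close>.\<close>

definition admm_f :: "(real^'n \<Rightarrow> ereal) \<Rightarrow> real^'n^'m \<Rightarrow> real^'m \<Rightarrow> real^'m \<Rightarrow> ereal" where
  "admm_f f A c w = (INF z\<in>{z. c - A *v z = w}. f z)"

definition admm_g :: "(real^'n \<Rightarrow> ereal) \<Rightarrow> real^'n^'m \<Rightarrow> real^'m \<Rightarrow> ereal" where
  "admm_g g B w = (INF z\<in>{z. B *v z = w}. g z)"

definition F_P :: "real \<Rightarrow> (real^'n \<Rightarrow> ereal) \<Rightarrow> real^'n \<Rightarrow> real^'n" where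
  "F_P \<gamma> f x = prox \<gamma> f x"

definition F_DR :: "real \<Rightarrow> real \<Rightarrow> (real^'n \<Rightarrow> ereal) \<Rightarrow> (real^'n \<Rightarrow> ereal) \<Rightarrow> real^'n \<Rightarrow> real^'n" where
  "F_DR \<alpha> \<gamma> f g x = (1 - \<alpha>) *\<^sub>R x + \<alpha> *\<^sub>R refl_prox \<gamma> g (refl_prox \<gamma> f x)"

definition F_ADMM :: "real \<Rightarrow> (real^'n \<Rightarrow> ereal) \<Rightarrow> (real^'n \<Rightarrow> ereal) \<Rightarrow>
    real^'n^'m \<Rightarrow> real^'n^'m \<Rightarrow> real^'m \<Rightarrow> real^'m \<Rightarrow> real^'m" where
  "F_ADMM \<gamma> f g A B c x =
     (1/2) *\<^sub>R x + (1/2) *\<^sub>R refl_prox \<gamma> (admm_g g B) (refl_prox \<gamma> (admm_f f A c) x)"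

definition F_GD :: "real \<Rightarrow> (real^'n \<Rightarrow> ereal) \<Rightarrow> real^'n \<Rightarrow> real^'n" where
  "F_GD s f x = x - s *\<^sub>R grad f x"

definition F_GP :: "real \<Rightarrow> (real^'n \<Rightarrow> ereal) \<Rightarrow> (real^'n) set \<Rightarrow> real^'n \<Rightarrow> real^'n" where
  "F_GP s f S x = closest_point S (x - s *\<^sub>R grad f x)"

definition F_PG :: "real \<Rightarrow> (real^'n \<Rightarrow> ereal) \<Rightarrow> (real^'n \<Rightarrow> ereal) \<Rightarrow> real^'n \<Rightarrow> real^'n" where
  "F_PG s f g x = prox s g (x - s *\<^sub>R grad f x)"

definition admm_solutions :: "(real^'n \<Rightarrow> ereal) \<Rightarrow> (real^'n \<Rightarrow> ereal) \<Rightarrow>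
    real^'n^'m \<Rightarrow> real^'n^'m \<Rightarrow> real^'m \<Rightarrow> ((real^'n) \<times> (real^'n)) set" where
  "admm_solutions f g A B c =
     argmin_on (\<lambda>(x, y). f x + g y) {(x, y). A *v x + B *v y = c}"

definition fixed_points :: "('a \<Rightarrow> 'a) \<Rightarrow> 'a set" where
  "fixed_points F = {x. F x = x}"

definition converges_linearly :: "(nat \<Rightarrow> 'a::real_normed_vector) \<Rightarrow> 'a \<Rightarrow> bool" where
  "converges_linearly X l \<longleftrightarrow>
     X \<longlonglongrightarrow> l \<and>
     (\<exists>q\<in>{0..<1}. \<exists>k0. \<forall>k\<ge>k0. norm (X (Suc k) - l) \<le> q * norm (X k - l))"

text \<open>\<^term>\<open>infdist x {} = 0\<close> by convention, but the convergence clause below already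
  forces the set of fixed points to be nonempty, so the convention is never used.\<close>

definition error_bound :: "('a::real_normed_vector \<Rightarrow> 'a) \<Rightarrow> bool" where
  "error_bound F \<longleftrightarrow>
     (\<exists>R>0. \<exists>K>0. \<forall>x. infdist x (fixed_points F) \<le> R \<longrightarrow>
        infdist x (fixed_points F) \<le> K * norm (F x - x))"

definition linear_convergence :: "('a::real_normed_vector \<Rightarrow> 'a) \<Rightarrow> ('a \<Rightarrow> bool) \<Rightarrow> bool" where
  "linear_convergence F corresponds \<longleftrightarrow>
     (\<forall>x0. \<exists>xs \<in> fixed_points F. converges_linearly (\<lambda>k. (F ^^ k) x0) xs \<and> corresponds xs)"

end

theory Submission
  imports Defs
begin

text \<open>Two facts about an operator \<open>F\<close> together give linear convergence of its iterates. The first is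
  a Fejer inequality \<open>\<parallel>F x - y\<parallel>\<^sup>2 \<le> \<parallel>x - y\<parallel>\<^sup>2 - a \<parallel>F x - x\<parallel>\<^sup>2\<close> for all fixed points \<open>y\<close>, with
  \<open>a > 0\<close>. The second is the error bound. The inequality makes the iterates converge to a fixed
  point \<open>x\<^sup>*\<close>, and it keeps them in the ball around the projection of the current iterate onto
  the fixed points, so that \<open>\<parallel>x\<^sub>k - x\<^sup>*\<parallel>\<close> is at most twice the distance of \<open>x\<^sub>k\<close> to the fixed
  points. Once this distance is small, the error bound makes it at most a multiple of the step
  length, and then the Fejer inequality contracts the distance to \<open>x\<^sup>*\<close> itself (\<open>fejer_converges_linearly\<close>).

  The error bound comes from polyhedral geometry. A continuous function that agrees at each
  point with one of finitely many affine maps is affine on each cell of a finite polyhedral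
  subdivision (\<open>continuous_affine_selection_cells\<close>). On a cell where \<open>F x - x\<close> has a zero,
  Hoffman's estimate bounds the distance to the zeros linearly by \<open>\<parallel>F x - x\<parallel>\<close> (\<open>hoffman\<close>); on a
  cell without a zero, the theorem of Frank and Wolfe keeps \<open>\<parallel>F x - x\<parallel>\<close> away from \<open>0\<close>
  (\<open>frank_wolfe\<close>). The advantage of selections over polyhedral graphs is that compositions and
  linear combinations of selections are again selections, and no projection of a polyhedron has
  to be computed.

  It remains to see that the operators are such selections. A proximal point of a convex
  piecewise linear-quadratic function lies in one of finitely many pieces and has one of finitely
  many sets of active constraints; given these, stationarity along the active face is a linear
  system that determines the proximal point as an affine function of its argument
  (\<open>prox_point_affine_selection\<close>). This works verbatim for the partial minimum of such a function
  over the fibres of an affine map \<open>u\<close>, which is what the alternating direction method uses, so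
  \<open>prox_point\<close> carries \<open>u\<close> as a parameter. The gradient of a differentiable such function is a
  selection as well, and it is Lipschitz with a constant read off from the pieces
  (\<open>gradient_properties\<close>).

  The six methods are instances of two schemes. Douglas-Rachford is the alternating direction
  scheme with identity maps (\<open>splitting_linear_convergence\<close>), and the remaining ones are
  the proximal gradient iteration and its special cases with a zero function or an indicator as one
  of the two summands (\<open>forward_backward_linear\<close>). For the first scheme a fixed point is built from a Lagrange
  multiplier, whose existence follows from an exact penalty supplied by Hoffman's estimate
  (\<open>plq_multiplier\<close>).\<close>

section \<open>Quadratic functions and linear systems on polyhedra\<close>

definition halfspaces :: "('a::real_inner \<times> real) set \<Rightarrow> 'a set" where
  "halfspaces H = {x. \<forall>(a, b)\<in>H. a \<bullet> x \<le> b}"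

lemma halfspacesD: "x \<in> halfspaces H \<Longrightarrow> (a, b) \<in> H \<Longrightarrow> a \<bullet> x \<le> b"
  by (auto simp: halfspaces_def)

lemma halfspacesI: "(\<And>a b. (a, b) \<in> H \<Longrightarrow> a \<bullet> x \<le> b) \<Longrightarrow> x \<in> halfspaces H"
  by (auto simp: halfspaces_def)

lemma polyhedron_imp_halfspaces:
  assumes "polyhedron P"
  obtains H where "finite H" "P = halfspaces H"
proof -
  obtain F where F: "finite F" "P = \<Inter> F" "\<forall>h\<in>F. \<exists>a b. a \<noteq> 0 \<and> h = {x. a \<bullet> x \<le> b}"
    using assms by (auto simp: polyhedron_def)
  then obtain a b where ab: "\<And>h. h \<in> F \<Longrightarrow> h = {x. a h \<bullet> x \<le> b h}"
    by metis
  have "P = halfspaces ((\<lambda>h. (a h, b h)) ` F)"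
    unfolding F(2) halfspaces_def using ab by blast
  with F(1) show ?thesis using that by blast
qed

lemma polyhedron_halfspaces:
  fixes H :: "('a::euclidean_space \<times> real) set"
  assumes "finite H"
  shows "polyhedron (halfspaces H)"
proof -
  have "halfspaces H = \<Inter> ((\<lambda>(a, b). {x. a \<bullet> x \<le> b}) ` H)"
    by (auto simp: halfspaces_def)
  moreover have "polyhedron \<dots>"
    using assms by (intro polyhedron_Inter) (auto simp: polyhedron_halfspace_le)
  ultimately show ?thesis by simp
qed

lemma halfspaces_ray:
  assumes "x \<in> halfspaces H" "\<And>a b. (a, b) \<in> H \<Longrightarrow> a \<bullet> d \<le> 0" "t \<ge> 0"
  shows "x + t *\<^sub>R d \<in> halfspaces H"
proof (rule halfspacesI)
  fix a b assume ab: "(a, b) \<in> H"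
  have "t * (a \<bullet> d) \<le> 0"
    using assms(2)[OF ab] assms(3) by (simp add: mult_nonneg_nonpos)
  with halfspacesD[OF assms(1) ab] show "a \<bullet> (x + t *\<^sub>R d) \<le> b"
    by (simp add: inner_add_right)
qed

lemma eventually_ball_pair:
  assumes "finite H" "\<And>a b. (a, b) \<in> H \<Longrightarrow> eventually (P a b) F"
  shows "\<forall>\<^sub>F t in F. \<forall>(a, b)\<in>H. P a b t"
  using assms by (intro eventually_ball_finite) (auto simp: case_prod_unfold)

text \<open>Inactive constraints have slack, so only the active ones restrict the direction of a short step.\<close>

lemma halfspaces_step:
  assumes "finite H" "x \<in> halfspaces H"
    and "\<And>a b. (a, b) \<in> H \<Longrightarrow> a \<bullet> x = b \<Longrightarrow> a \<bullet> d \<le> 0"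
  obtains e where "e > 0" "\<And>t. 0 \<le> t \<Longrightarrow> t \<le> e \<Longrightarrow> x + t *\<^sub>R d \<in> halfspaces H"
proof -
  have "\<forall>\<^sub>F t in at_right 0. \<forall>(a, b)\<in>H. a \<bullet> x < b \<longrightarrow> a \<bullet> (x + t *\<^sub>R d) < b"
  proof (rule eventually_ball_pair[OF assms(1)])
    fix a b assume "(a, b) \<in> H"
    show "\<forall>\<^sub>F t in at_right 0. a \<bullet> x < b \<longrightarrow> a \<bullet> (x + t *\<^sub>R d) < b"
    proof (cases "a \<bullet> x < b")
      case True
      have "((\<lambda>t. a \<bullet> (x + t *\<^sub>R d)) \<longlongrightarrow> a \<bullet> (x + 0 *\<^sub>R d)) (at_right 0)"
        by (intro tendsto_intros)
      with True show ?thesis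
        by (auto dest!: order_tendstoD(2)[where a = b] elim!: eventually_mono)
    qed simp
  qed
  then obtain e where e: "e > 0"
    "\<And>t. 0 < t \<Longrightarrow> t < e \<Longrightarrow> \<forall>(a, b)\<in>H. a \<bullet> x < b \<longrightarrow> a \<bullet> (x + t *\<^sub>R d) < b"
    by (auto simp: eventually_at_right_field)
  have "x + t *\<^sub>R d \<in> halfspaces H" if t: "0 \<le> t" "t \<le> e / 2" for t
  proof (cases "t = 0")
    case True
    then show ?thesis using assms(2) by simp
  next
    case False
    show ?thesis
    proof (rule halfspacesI)
      fix a b assume ab: "(a, b) \<in> H"
      show "a \<bullet> (x + t *\<^sub>R d) \<le> b"
      proof (cases "a \<bullet> x = b")
        case True
        have "t * (a \<bullet> d) \<le> 0"
          using assms(3)[OF ab True] t by (simp add: mult_nonneg_nonpos)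
        then show ?thesis using True by (simp add: inner_add_right)
      next
        case False
        then have "a \<bullet> x < b" using halfspacesD[OF assms(2) ab] by simp
        moreover have "t < e" using t e(1) by simp
        ultimately show ?thesis
          using e(2)[of t] ab t \<open>t \<noteq> 0\<close> by fastforce
      qed
    qed
  qed
  then show ?thesis using that[of "e / 2"] e(1) by simp
qed

lemma quadratic_along_line:
  assumes "linear Q" "\<And>x y. x \<bullet> Q y = Q x \<bullet> y"
  shows "1/2 * ((x + t *\<^sub>R d) \<bullet> Q (x + t *\<^sub>R d)) + l \<bullet> (x + t *\<^sub>R d) + b =
    (1/2 * (x \<bullet> Q x) + l \<bullet> x + b) + t * ((Q x + l) \<bullet> d) + t\<^sup>2 * (d \<bullet> Q d / 2)"
proof -
  have "d \<bullet> Q x = Q x \<bullet> d" "x \<bullet> Q d = Q x \<bullet> d" using assms(2)[of x d] by (auto simp: inner_commute)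
  then show ?thesis
    unfolding linear_add[OF assms(1)] linear_scale[OF assms(1)]
    by (simp add: inner_add_left inner_add_right power2_eq_square algebra_simps)
qed

text \<open>The theorem of Frank and Wolfe. Take points of minimal norm in a shrinking sequence of sublevel sets. If they stay
  bounded, a limit point is a minimizer. If not, their directions accumulate at a recession
  direction \<open>d\<close> of the polyhedron with nonpositive curvature, and boundedness below makes the slope
  along \<open>d\<close> nonnegative everywhere. Far out one can therefore step back along \<open>d\<close> without leaving
  the polyhedron or increasing the function, which contradicts minimality of the norm.\<close>

theorem frank_wolfe:
  fixes Q :: "'a::euclidean_space \<Rightarrow> 'a" and l :: 'a and b m :: real
  assumes P: "polyhedron P" "P \<noteq> {}"
    and Q: "linear Q" "\<And>x y. x \<bullet> Q y = Q x \<bullet> y"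
    and q: "\<And>x. q x = 1/2 * (x \<bullet> Q x) + l \<bullet> x + b"
    and bd: "\<And>x. x \<in> P \<Longrightarrow> m \<le> q x"
  shows "\<exists>x\<in>P. \<forall>y\<in>P. q x \<le> q y"
proof -
  obtain H where H: "finite H" "P = halfspaces H"
    using polyhedron_imp_halfspaces[OF P(1)] .
  have clP: "closed P" by (rule polyhedron_imp_closed[OF P(1)])
  have Qc: "continuous_on S Q" for S
    using Q(1) by (simp add: linear_continuous_on linear_conv_bounded_linear)
  have qc: "continuous_on S q" for S
    unfolding q by (intro continuous_intros Qc)
  define i where "i = Inf (q ` P)"
  have bdd: "bdd_below (q ` P)" using bd by (auto intro: bdd_belowI[of _ m])
  have i_le: "i \<le> q x" if "x \<in> P" for x
    unfolding i_def by (rule cInf_lower) (use that bdd in auto)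
  \<comment> \<open>Sublevel sets whose levels decrease to the infimum.\<close>
  define L where "L n = P \<inter> {x. q x \<le> i + 1 / real (Suc n)}" for n
  have L: "closed (L n)" for n
  proof -
    have "closed {x. q x \<le> i + 1 / real (Suc n)}"
      by (intro closed_Collect_le qc continuous_intros)
    then show ?thesis unfolding L_def using clP by blast
  qed
  have Lne: "L n \<noteq> {}" for n
  proof -
    have "\<exists>z\<in>q ` P. z < i + 1 / real (Suc n)"
      unfolding i_def by (rule cInf_lessD) (use P(2) in auto)
    then show ?thesis unfolding L_def by (auto intro: less_imp_le)
  qed
  have "\<exists>z. z \<in> L n \<and> (\<forall>y\<in>L n. norm z \<le> norm y)" for n
    using distance_attains_inf[OF L[of n] Lne[of n], of 0] by (metis dist_0_norm)
  then obtain z where z: "\<And>n. z n \<in> L n" "\<And>n y. y \<in> L n \<Longrightarrow> norm (z n) \<le> norm y"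
    by metis
  show ?thesis
  proof (cases "bounded (range z)")
    case True
    then obtain x r where r: "strict_mono (r::nat \<Rightarrow> nat)" "(z \<circ> r) \<longlonglongrightarrow> x"
      using bounded_imp_convergent_subsequence by blast
    have "x \<in> P"
      by (rule closed_sequentially[OF clP _ r(2)]) (use z in \<open>auto simp: L_def\<close>)
    have "(\<lambda>n. q ((z \<circ> r) n)) \<longlonglongrightarrow> q x"
      using isCont_tendsto_compose[OF _ r(2), of q] qc[of UNIV] by (simp add: continuous_on_eq_continuous_at)
    moreover have "(\<lambda>n. i + 1 / real (Suc (r n))) \<longlonglongrightarrow> i + 0"
      by (intro tendsto_add tendsto_const LIMSEQ_subseq_LIMSEQ[OF lim_1_over_n[THEN LIMSEQ_Suc] r(1), unfolded o_def])
    moreover have "q ((z \<circ> r) n) \<le> i + 1 / real (Suc (r n))" for n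
      using z(1)[of "r n"] by (simp add: L_def)
    ultimately have "q x \<le> i + 0"
      by (intro LIMSEQ_le) auto
    then show ?thesis using \<open>x \<in> P\<close> i_le by force
  next
    case False
    then have "\<exists>n. norm (z n) > real k" for k
      unfolding bounded_iff by (metis not_le rangeE)
    then obtain n where n: "\<And>k. norm (z (n k)) > real k" by metis
    define w where "w k = z (n (Suc k))" for k
    have wk: "norm (w k) > real (Suc k)" for k unfolding w_def by (rule n)
    have wP: "w k \<in> P" for k using z(1) by (auto simp: w_def L_def)
    have wq: "q (w k) \<le> i + 1" for k
    proof -
      have "q (w k) \<le> i + 1 / real (Suc (n (Suc k)))"
        using z(1) by (auto simp: w_def L_def)
      also have "\<dots> \<le> i + 1" by simp
      finally show ?thesis .
    qed
    have w0: "norm (w k) > 0" for k using wk[of k] by linarith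
    define u where "u k = w k /\<^sub>R norm (w k)" for k
    have "norm (u k) = 1" for k using w0[of k] by (simp add: u_def)
    then have "\<forall>k. u k \<in> sphere 0 1" by simp
    then obtain d r where d: "d \<in> sphere 0 1" and r: "strict_mono (r::nat \<Rightarrow> nat)" "(u \<circ> r) \<longlonglongrightarrow> d"
      using compact_sphere[of "0::'a" 1] unfolding compact_def by meson
    define v where "v k = w (r k)" for k
    have v: "v k \<in> P" "q (v k) \<le> i + 1" "norm (v k) > 0" for k
      using wP wq w0 by (auto simp: v_def)
    have ud: "(\<lambda>k. v k /\<^sub>R norm (v k)) \<longlonglongrightarrow> d"
      using r(2) by (simp add: u_def v_def o_def)
    have vn: "norm (v k) > real k" for k
    proof -
      have "real k \<le> real (r k)" using seq_suble[OF r(1)] by simp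
      also have "\<dots> < norm (v k)" using wk[of "r k"] by (simp add: v_def)
      finally show ?thesis .
    qed
    have vinf: "filterlim (\<lambda>k. norm (v k)) at_top sequentially"
      by (rule filterlim_at_top_mono[OF filterlim_real_sequentially])
         (use vn in \<open>auto intro!: always_eventually less_imp_le\<close>)
    have inv0: "(\<lambda>k. C / norm (v k)) \<longlonglongrightarrow> 0" for C
      by (rule real_tendsto_divide_at_top[OF tendsto_const vinf])
    have nd: "norm d = 1" using d by simp
    have ad: "(\<lambda>k. (a \<bullet> v k) / norm (v k)) \<longlonglongrightarrow> a \<bullet> d" for a
      using tendsto_inner[OF tendsto_const[of a] ud] by (simp add: divide_inverse mult.commute)
    have rec: "a \<bullet> d \<le> 0" if "(a, b') \<in> H" for a b'
    proof (rule LIMSEQ_le[OF ad inv0[of b']])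
      show "\<exists>N. \<forall>k\<ge>N. a \<bullet> v k / norm (v k) \<le> b' / norm (v k)"
        using halfspacesD[OF v(1)[unfolded H(2)] that] v(3) by (auto intro!: divide_right_mono)
    qed
    \<comment> \<open>Boundedness of \<open>q\<close> along the sequence forces nonpositive curvature in the limit direction.\<close>
    have dQd: "d \<bullet> Q d \<le> 0"
    proof -
      define s where "s k = v k /\<^sub>R norm (v k)" for k
      have s: "s \<longlonglongrightarrow> d" using ud unfolding s_def .
      have "isCont Q d" using Qc[of UNIV] by (simp add: continuous_on_eq_continuous_at)
      then have "(\<lambda>k. Q (s k)) \<longlonglongrightarrow> Q d" by (rule isCont_tendsto_compose[OF _ s])
      then have lim: "(\<lambda>k. 1/2 * (s k \<bullet> Q (s k)) + (l \<bullet> s k) * (1 / norm (v k)) + b / norm (v k) * (1 / norm (v k)))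
          \<longlonglongrightarrow> 1/2 * (d \<bullet> Q d) + (l \<bullet> d) * 0 + 0 * 0"
        by (intro tendsto_intros s inv0)
      have lim2: "(\<lambda>k. (i + 1) / norm (v k) * (1 / norm (v k))) \<longlonglongrightarrow> 0 * 0"
        by (intro tendsto_intros inv0)
      have "1/2 * (s k \<bullet> Q (s k)) + (l \<bullet> s k) * (1 / norm (v k)) + b / norm (v k) * (1 / norm (v k))
          \<le> (i + 1) / norm (v k) * (1 / norm (v k))" for k
      proof -
        have vs: "v k = norm (v k) *\<^sub>R s k" using v(3)[of k] by (simp add: s_def)
        have "q (norm (v k) *\<^sub>R s k) \<le> i + 1" using v(2)[of k] vs by simp
        then have *: "1/2 * ((norm (v k))\<^sup>2 * (s k \<bullet> Q (s k))) + norm (v k) * (l \<bullet> s k) + b \<le> i + 1"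
          unfolding q linear_scale[OF Q(1)] by (simp add: power2_eq_square)
        have "(1/2 * ((norm (v k))\<^sup>2 * (s k \<bullet> Q (s k))) + norm (v k) * (l \<bullet> s k) + b) / (norm (v k))\<^sup>2
             \<le> (i + 1) / (norm (v k))\<^sup>2"
          using * by (rule divide_right_mono) simp
        then show ?thesis using v(3)[of k] by (simp add: power2_eq_square field_simps)
      qed
      then have "1/2 * (d \<bullet> Q d) + (l \<bullet> d) * 0 + 0 * 0 \<le> 0 * 0"
        by (intro LIMSEQ_le[OF lim lim2]) auto
      then show ?thesis by simp
    qed
    have exp: "q (p + t *\<^sub>R d) = q p + t * (Q p \<bullet> d + l \<bullet> d) + t\<^sup>2 / 2 * (d \<bullet> Q d)" for p t
      unfolding q quadratic_along_line[OF Q] by (simp add: inner_add_left)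
    \<comment> \<open>Otherwise \<open>q\<close> would tend to minus infinity along the ray from \<open>p\<close>.\<close>
    have slope: "Q p \<bullet> d + l \<bullet> d \<ge> 0" if "p \<in> P" for p
    proof (rule ccontr)
      assume neg: "\<not> Q p \<bullet> d + l \<bullet> d \<ge> 0"
      define g where "g = - (Q p \<bullet> d + l \<bullet> d)"
      have g: "g > 0" using neg by (simp add: g_def)
      define t where "t = (q p - m + 1) / g"
      have t: "t \<ge> 0" unfolding t_def using bd[OF that] g by simp
      have "p + t *\<^sub>R d \<in> P" using halfspaces_ray[of p H d t] that rec t H(2) by blast
      then have "m \<le> q (p + t *\<^sub>R d)" by (rule bd)
      also have "\<dots> \<le> q p - t * g"
        unfolding exp g_def using mult_nonneg_nonpos[OF _ dQd, of "t\<^sup>2 / 2"] by (simp add: algebra_simps)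
      also have "\<dots> = m - 1" using g by (simp add: t_def)
      finally show False by simp
    qed
    \<comment> \<open>Far out, a unit step back along \<open>d\<close> stays in \<open>P\<close>, does not increase \<open>q\<close>, and shortens the vector.\<close>
    have "\<forall>\<^sub>F k in sequentially. \<forall>(a, b')\<in>H. a \<bullet> (v k - d) \<le> b'"
    proof (rule eventually_ball_pair[OF H(1)])
      fix a b' assume ab: "(a, b') \<in> H"
      show "\<forall>\<^sub>F k in sequentially. a \<bullet> (v k - d) \<le> b'"
      proof (cases "a \<bullet> d = 0")
        case True
        then show ?thesis using halfspacesD[OF v(1)[unfolded H(2)] ab] by (simp add: inner_diff_right)
      next
        case False
        then have neg: "a \<bullet> d < 0" using rec[OF ab] by simp
        have "(\<lambda>k. a \<bullet> d / norm (v k) + b' / norm (v k)) \<longlonglongrightarrow> 0 + 0"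
          by (intro tendsto_add inv0)
        then have "(\<lambda>k. (a \<bullet> v k) / norm (v k) - (a \<bullet> d / norm (v k) + b' / norm (v k))) \<longlonglongrightarrow> a \<bullet> d - (0 + 0)"
          by (intro tendsto_diff ad)
        then have "\<forall>\<^sub>F k in sequentially. (a \<bullet> v k) / norm (v k) - (a \<bullet> d / norm (v k) + b' / norm (v k)) < 0"
          using neg by (auto dest: order_tendstoD(2)[where a = 0])
        then show ?thesis
        proof (rule eventually_mono)
          fix k assume "(a \<bullet> v k) / norm (v k) - (a \<bullet> d / norm (v k) + b' / norm (v k)) < 0"
          then show "a \<bullet> (v k - d) \<le> b'"
            using v(3)[of k] by (simp add: inner_diff_right field_simps)
        qed
      qed
    qed
    moreover have "\<forall>\<^sub>F k in sequentially. norm (v k - d) < norm (v k)"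
    proof -
      have "(\<lambda>k. (d \<bullet> v k) / norm (v k) - (1/2) / norm (v k)) \<longlonglongrightarrow> d \<bullet> d - 0"
        by (intro tendsto_diff ad inv0)
      moreover have "d \<bullet> d = 1" using nd by (simp add: dot_square_norm)
      ultimately have "\<forall>\<^sub>F k in sequentially. (d \<bullet> v k) / norm (v k) - (1/2) / norm (v k) > 0"
        by (auto dest: order_tendstoD(1)[where a = 0])
      then show ?thesis
      proof (rule eventually_mono)
        fix k assume "(d \<bullet> v k) / norm (v k) - (1/2) / norm (v k) > 0"
        then have "d \<bullet> v k > 1/2" using v(3)[of k] by (simp add: field_simps)
        then have "(norm (v k - d))\<^sup>2 < (norm (v k))\<^sup>2"
          using \<open>d \<bullet> d = 1\<close> by (simp add: power2_norm_eq_inner inner_diff_left inner_diff_right inner_commute)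
        then show "norm (v k - d) < norm (v k)" by (rule power_less_imp_less_base) simp
      qed
    qed
    ultimately have "\<forall>\<^sub>F k in sequentially. (\<forall>(a, b')\<in>H. a \<bullet> (v k - d) \<le> b') \<and> norm (v k - d) < norm (v k)"
      by (rule eventually_conj)
    then obtain k where k: "v k - d \<in> P" "norm (v k - d) < norm (v k)"
      unfolding H(2) halfspaces_def eventually_sequentially by auto
    have "q (v k + (- 1) *\<^sub>R d) \<le> q (v k)"
      unfolding exp using slope[OF v(1)[of k]] dQd by simp
    then have "q (v k - d) \<le> q (v k)" by simp
    then have "v k - d \<in> L (n (Suc (r k)))"
      using k(1) z(1)[of "n (Suc (r k))"] by (auto simp: L_def v_def w_def)
    from z(2)[OF this] k(2) show ?thesis by (simp add: v_def w_def)
  qed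
qed

text \<open>Hoffman's error bound by compactness. If no constant works, there are points \<open>x\<^sub>k\<close> of \<open>P\<close> whose
  residual \<open>\<parallel>M x\<^sub>k - c\<parallel>\<close> is small compared to their distance from the solution set; let \<open>y\<^sub>k\<close> be the
  closest solutions and \<open>d\<close> a limit of the unit vectors from \<open>y\<^sub>k\<close> to \<open>x\<^sub>k\<close>. Then \<open>M d = 0\<close>, and for
  some \<open>k\<close> the direction \<open>d\<close> is feasible at \<open>y\<^sub>k\<close> while forming an acute angle with \<open>x\<^sub>k - y\<^sub>k\<close>, so a
  solution closer than \<open>y\<^sub>k\<close> exists.\<close>

theorem hoffman:
  fixes M :: "'a::euclidean_space \<Rightarrow> 'b::euclidean_space" and c :: 'b
  assumes P: "polyhedron P" and M: "linear M" and ne: "x0 \<in> P" "M x0 = c"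
  obtains K where "K > 0"
    "\<And>x. x \<in> P \<Longrightarrow> \<exists>y\<in>P. M y = c \<and> norm (x - y) \<le> K * norm (M x - c)"
proof -
  obtain H where H: "finite H" "P = halfspaces H"
    using polyhedron_imp_halfspaces[OF P] .
  have Mc: "continuous_on X M" for X
    using M by (simp add: linear_continuous_on linear_conv_bounded_linear)
  define S where "S = P \<inter> {x. M x = c}"
  have S: "closed S" "convex S" "S \<noteq> {}"
  proof -
    show "closed S" unfolding S_def
      by (intro closed_Int polyhedron_imp_closed[OF P] closed_Collect_eq Mc continuous_intros)
    have "{x. M x = c} = M -` {c}" by auto
    then show "convex S" unfolding S_def
      using polyhedron_imp_convex[OF P] convex_linear_vimage[OF M convex_singleton] by (simp add: convex_Int)
    show "S \<noteq> {}" using ne by (auto simp: S_def)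
  qed
  have "\<exists>K>0. \<forall>x\<in>P. \<exists>y\<in>S. norm (x - y) \<le> K * norm (M x - c)"
  proof (rule ccontr)
    assume contr: "\<not> ?thesis"
    have "\<exists>x\<in>P. \<forall>y\<in>S. norm (x - y) > real (Suc k) * norm (M x - c)" for k
    proof (rule ccontr)
      assume "\<not> ?thesis"
      then have "\<forall>x\<in>P. \<exists>y\<in>S. norm (x - y) \<le> real (Suc k) * norm (M x - c)" by force
      moreover have "real (Suc k) > 0" by simp
      ultimately show False using contr by blast
    qed
    then obtain x where x: "\<And>k. x k \<in> P"
      "\<And>k y. y \<in> S \<Longrightarrow> norm (x k - y) > real (Suc k) * norm (M (x k) - c)"
      by metis
    define y where "y k = closest_point S (x k)" for k
    have yS: "y k \<in> S" for k unfolding y_def by (rule closest_point_in_set[OF S(1,3)])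
    have ydot: "(x k - y k) \<bullet> (s - y k) \<le> 0" if "s \<in> S" for k s
      unfolding y_def by (rule closest_point_dot[OF S(2,1) that])
    define n where "n k = norm (x k - y k)" for k
    have n: "n k > real (Suc k) * norm (M (x k) - c)" for k
      unfolding n_def by (rule x(2)[OF yS])
    have n0: "n k > 0" for k
    proof -
      have "0 \<le> real (Suc k) * norm (M (x k) - c)" by simp
      then show ?thesis using n[of k] by linarith
    qed
    define u where "u k = (x k - y k) /\<^sub>R n k" for k
    have "\<forall>k. u k \<in> sphere 0 1" using n0 by (auto simp: u_def n_def)
    then obtain d r where d: "d \<in> sphere 0 1" and r: "strict_mono (r::nat \<Rightarrow> nat)" "(u \<circ> r) \<longlonglongrightarrow> d"
      using compact_sphere[of "0::'a" 1] unfolding compact_def by meson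
    have Mu: "norm (M (u k)) \<le> 1 / real (Suc k)" for k
    proof -
      have "M (y k) = c" using yS by (simp add: S_def)
      then have "M (u k) = (M (x k) - c) /\<^sub>R n k"
        by (simp add: u_def linear_scale[OF M] linear_diff[OF M])
      then have "norm (M (u k)) = norm (M (x k) - c) / n k"
        using n0[of k] by (simp add: divide_inverse mult.commute)
      also have "\<dots> \<le> 1 / real (Suc k)"
        using n[of k] n0[of k] by (simp add: field_simps)
      finally show ?thesis .
    qed
    \<comment> \<open>The residual of \<open>u k\<close> is at most \<open>1 / (k + 1)\<close> and vanishes in the limit.\<close>
    have Md: "M d = 0"
    proof -
      have "isCont M d" using Mc[of UNIV] by (simp add: continuous_on_eq_continuous_at)
      then have 1: "(\<lambda>k. M ((u \<circ> r) k)) \<longlonglongrightarrow> M d" by (rule isCont_tendsto_compose[OF _ r(2)])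
      have "(\<lambda>k. M (u k)) \<longlonglongrightarrow> 0"
        by (rule Lim_null_comparison[OF _ lim_1_over_n[THEN LIMSEQ_Suc]]) (use Mu in auto)
      from LIMSEQ_subseq_LIMSEQ[OF this r(1)] have "(\<lambda>k. M ((u \<circ> r) k)) \<longlonglongrightarrow> 0" by (simp add: o_def)
      with 1 show ?thesis by (rule LIMSEQ_unique)
    qed
    have lim: "(\<lambda>k. a \<bullet> (u \<circ> r) k) \<longlonglongrightarrow> a \<bullet> d" for a
      by (intro tendsto_inner tendsto_const r(2))
    \<comment> \<open>A constraint that \<open>d\<close> violates is eventually violated by \<open>u\<close>, hence eventually inactive at \<open>y\<close>.\<close>
    have "\<forall>\<^sub>F k in sequentially. \<forall>(a, b)\<in>H. a \<bullet> y (r k) = b \<longrightarrow> a \<bullet> d \<le> 0"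
    proof (rule eventually_ball_pair[OF H(1)])
      fix a b assume ab: "(a, b) \<in> H"
      show "\<forall>\<^sub>F k in sequentially. a \<bullet> y (r k) = b \<longrightarrow> a \<bullet> d \<le> 0"
      proof (cases "a \<bullet> d \<le> 0")
        case False
        then have "\<forall>\<^sub>F k in sequentially. a \<bullet> (u \<circ> r) k > 0"
          using order_tendstoD(1)[OF lim, of 0 a] by simp
        then show ?thesis
        proof (rule eventually_mono)
          fix k assume "a \<bullet> (u \<circ> r) k > 0"
          then have "a \<bullet> (x (r k) - y (r k)) > 0"
            using n0[of "r k"] by (simp add: u_def zero_less_mult_iff)
          moreover have "a \<bullet> x (r k) \<le> b"
            using x(1) ab H(2) halfspacesD by blast
          ultimately show "a \<bullet> y (r k) = b \<longrightarrow> a \<bullet> d \<le> 0" by (simp add: inner_diff_right)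
        qed
      qed simp
    qed
    moreover have "\<forall>\<^sub>F k in sequentially. d \<bullet> (u \<circ> r) k > 0"
      by (rule order_tendstoD(1)[OF lim]) (use d in \<open>auto simp: dot_square_norm\<close>)
    ultimately have "\<forall>\<^sub>F k in sequentially. (\<forall>(a, b)\<in>H. a \<bullet> y (r k) = b \<longrightarrow> a \<bullet> d \<le> 0) \<and> d \<bullet> (u \<circ> r) k > 0"
      by (rule eventually_conj)
    then obtain k where k0: "\<forall>(a, b)\<in>H. a \<bullet> y (r k) = b \<longrightarrow> a \<bullet> d \<le> 0" "d \<bullet> (u \<circ> r) k > 0"
      using eventually_happens'[OF sequentially_bot] by blast
    then have k: "\<And>a b. (a, b) \<in> H \<Longrightarrow> a \<bullet> y (r k) = b \<Longrightarrow> a \<bullet> d \<le> 0" "d \<bullet> u (r k) > 0"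
      by auto
    have "y (r k) \<in> halfspaces H" using yS H(2) by (auto simp: S_def)
    then obtain e where e: "e > 0" "\<And>t. 0 \<le> t \<Longrightarrow> t \<le> e \<Longrightarrow> y (r k) + t *\<^sub>R d \<in> halfspaces H"
      using halfspaces_step[OF H(1) _, of "y (r k)" d] k(1) by metis
    have "y (r k) + e *\<^sub>R d \<in> P" using e H(2) by simp
    moreover have "M (y (r k) + e *\<^sub>R d) = c"
      using yS[of "r k"] Md by (simp add: linear_add[OF M] linear_scale[OF M] S_def)
    ultimately have "y (r k) + e *\<^sub>R d \<in> S" by (simp add: S_def)
    from ydot[OF this, of "r k"] have "(x (r k) - y (r k)) \<bullet> d \<le> 0"
      using e(1) by (simp add: mult_le_0_iff)
    moreover have "(x (r k) - y (r k)) \<bullet> d > 0"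
      using k(2) n0[of "r k"] by (simp add: u_def zero_less_mult_iff inner_commute)
    ultimately show False by simp
  qed
  then show ?thesis using that unfolding S_def by blast
qed

section \<open>Continuous selections of finitely many affine maps\<close>

definition affine_map :: "('a::real_vector \<Rightarrow> 'b::real_vector) \<Rightarrow> bool" where
  "affine_map T \<longleftrightarrow> (\<exists>L b. linear L \<and> T = (\<lambda>x. L x + b))"

text \<open>The regions on which the individual maps are used are left arbitrary, so that composing two
  selections only composes the maps. For a continuous function polyhedral regions are recovered
  afterwards, in \<open>continuous_affine_selection_cells\<close>.\<close>

definition affine_selection :: "('a::real_vector \<Rightarrow> 'b::real_vector) \<Rightarrow> bool" where
  "affine_selection F \<longleftrightarrow>
     (\<exists>\<T>. finite \<T> \<and> (\<forall>T\<in>\<T>. affine_map T) \<and> (\<forall>x. \<exists>T\<in>\<T>. F x = T x))"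

lemma affine_map_comp:
  assumes "affine_map S" "affine_map T"
  shows "affine_map (\<lambda>x. S (T x))"
proof -
  obtain L b M c where "linear L" "S = (\<lambda>x. L x + b)" "linear M" "T = (\<lambda>x. M x + c)"
    using assms by (auto simp: affine_map_def)
  then have "linear (\<lambda>x. L (M x))" "(\<lambda>x. S (T x)) = (\<lambda>x. L (M x) + (L c + b))"
    using linear_compose[of M L] by (auto simp: o_def linear_add)
  then show ?thesis unfolding affine_map_def by blast
qed

lemma affine_map_combination:
  assumes "affine_map S" "affine_map T"
  shows "affine_map (\<lambda>x. s *\<^sub>R S x + t *\<^sub>R T x)"
proof -
  obtain L b M c where "linear L" "S = (\<lambda>x. L x + b)" "linear M" "T = (\<lambda>x. M x + c)"
    using assms by (auto simp: affine_map_def)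
  then have "linear (\<lambda>x. s *\<^sub>R L x + t *\<^sub>R M x)"
    "(\<lambda>x. s *\<^sub>R S x + t *\<^sub>R T x) = (\<lambda>x. (s *\<^sub>R L x + t *\<^sub>R M x) + (s *\<^sub>R b + t *\<^sub>R c))"
    by (auto simp: linear_compose_add linear_compose_scale_right scaleR_add_right)
  then show ?thesis unfolding affine_map_def by blast
qed

lemma affine_selection_id: "affine_selection (\<lambda>x. x)"
  unfolding affine_selection_def affine_map_def
  by (rule exI[of _ "{\<lambda>x. x}"]) (auto intro!: exI[of _ "\<lambda>x. x"] exI[of _ 0] linear_id[unfolded id_def])

lemma affine_selection_comp:
  assumes "affine_selection F" "affine_selection G"
  shows "affine_selection (\<lambda>x. F (G x))"
proof -
  obtain \<S> \<T> where *: "finite \<S>" "\<forall>S\<in>\<S>. affine_map S" "\<forall>x. \<exists>S\<in>\<S>. F x = S x"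
    "finite \<T>" "\<forall>T\<in>\<T>. affine_map T" "\<forall>x. \<exists>T\<in>\<T>. G x = T x"
    using assms unfolding affine_selection_def by blast
  let ?\<U> = "(\<lambda>(S, T) x. S (T x)) ` (\<S> \<times> \<T>)"
  have "finite ?\<U>" "\<forall>U\<in>?\<U>. affine_map U"
    using * by (auto intro: affine_map_comp)
  moreover have "\<exists>U\<in>?\<U>. F (G x) = U x" for x
  proof -
    obtain S T where "S \<in> \<S>" "F (G x) = S (G x)" "T \<in> \<T>" "G x = T x"
      using *(3,6) by meson
    then show ?thesis by (intro bexI[of _ "\<lambda>x. S (T x)"]) auto
  qed
  ultimately show ?thesis unfolding affine_selection_def by blast
qed

lemma affine_selection_combination:
  assumes "affine_selection F" "affine_selection G"
  shows "affine_selection (\<lambda>x. s *\<^sub>R F x + t *\<^sub>R G x)"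
proof -
  obtain \<S> \<T> where *: "finite \<S>" "\<forall>S\<in>\<S>. affine_map S" "\<forall>x. \<exists>S\<in>\<S>. F x = S x"
    "finite \<T>" "\<forall>T\<in>\<T>. affine_map T" "\<forall>x. \<exists>T\<in>\<T>. G x = T x"
    using assms unfolding affine_selection_def by blast
  let ?\<U> = "(\<lambda>(S, T) x. s *\<^sub>R S x + t *\<^sub>R T x) ` (\<S> \<times> \<T>)"
  have "finite ?\<U>" "\<forall>U\<in>?\<U>. affine_map U"
    using * by (auto intro: affine_map_combination)
  moreover have "\<exists>U\<in>?\<U>. s *\<^sub>R F x + t *\<^sub>R G x = U x" for x
  proof -
    obtain S T where "S \<in> \<S>" "F x = S x" "T \<in> \<T>" "G x = T x"
      using *(3,6) by meson
    then show ?thesis by (intro bexI[of _ "\<lambda>x. s *\<^sub>R S x + t *\<^sub>R T x"]) auto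
  qed
  ultimately show ?thesis unfolding affine_selection_def by blast
qed

text \<open>Two different affine maps can agree only inside a hyperplane, or nowhere at all: the case \<open>a = 0\<close>,
  \<open>b \<noteq> 0\<close> describes the empty set.\<close>

lemma coincidence_in_hyperplane:
  fixes S T :: "'a::euclidean_space \<Rightarrow> 'b::euclidean_space"
  assumes "affine_map S" "affine_map T" "S \<noteq> T"
  shows "\<exists>a b. (a \<noteq> 0 \<or> b \<noteq> 0) \<and> (\<forall>x. S x = T x \<longrightarrow> a \<bullet> x = b)"
proof -
  obtain L b M c where ST: "linear L" "S = (\<lambda>x. L x + b)" "linear M" "T = (\<lambda>x. M x + c)"
    using assms by (auto simp: affine_map_def)
  obtain p where p: "S p \<noteq> T p" using assms(3) by auto
  define w where "w = S p - T p"
  have w: "w \<bullet> w \<noteq> 0" using p by (simp add: w_def)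
  have "linear (\<lambda>x. L x - M x)" using ST by (simp add: linear_compose_sub)
  from adjoint_works[OF this] have adj: "x \<bullet> adjoint (\<lambda>x. L x - M x) w = (L x - M x) \<bullet> w" for x .
  let ?a = "adjoint (\<lambda>x. L x - M x) w" and ?b = "(c - b) \<bullet> w"
  have *: "(S x - T x) \<bullet> w = ?a \<bullet> x - ?b" for x
    using adj[of x] by (simp add: ST inner_commute algebra_simps)
  have "?a \<noteq> 0 \<or> ?b \<noteq> 0"
    using *[of p] w by (auto simp: w_def)
  moreover have "S x = T x \<longrightarrow> ?a \<bullet> x = ?b" for x using *[of x] by auto
  ultimately show ?thesis by blast
qed

text \<open>Cut the space by the finitely many hyperplanes in which two of the maps can coincide. On an open
  cell the values of the maps are pairwise different, so by continuity and connectedness one map is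
  used throughout, and continuity extends this to the closed cell.\<close>

theorem continuous_affine_selection_cells:
  fixes F :: "'a::euclidean_space \<Rightarrow> 'b::euclidean_space"
  assumes cont: "continuous_on UNIV F" and sel: "affine_selection F"
  obtains \<C> where "finite \<C>" "\<Union>\<C> = UNIV" "\<And>C. C \<in> \<C> \<Longrightarrow> polyhedron C"
    "\<And>C. C \<in> \<C> \<Longrightarrow> \<exists>T. affine_map T \<and> (\<forall>x\<in>C. F x = T x)"
proof -
  obtain \<T> where T: "finite \<T>" "\<forall>T\<in>\<T>. affine_map T" "\<forall>x. \<exists>T\<in>\<T>. F x = T x"
    using sel unfolding affine_selection_def by blast
  have "\<forall>S\<in>\<T>. \<forall>T\<in>\<T>. \<exists>h. S \<noteq> T \<longrightarrow> (fst h \<noteq> 0 \<or> snd h \<noteq> 0) \<and> (\<forall>x. S x = T x \<longrightarrow> fst h \<bullet> x = snd h)"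
    using coincidence_in_hyperplane T(2) by (metis fst_conv snd_conv)
  then obtain h where h: "\<And>S T. S \<in> \<T> \<Longrightarrow> T \<in> \<T> \<Longrightarrow> S \<noteq> T \<Longrightarrow>
      (fst (h S T) \<noteq> 0 \<or> snd (h S T) \<noteq> 0) \<and> (\<forall>x. S x = T x \<longrightarrow> fst (h S T) \<bullet> x = snd (h S T))"
    by metis
  define H where "H = (\<lambda>(S, T). h S T) ` {(S, T). S \<in> \<T> \<and> T \<in> \<T> \<and> S \<noteq> T}"
  have finH: "finite H" unfolding H_def
    by (intro finite_imageI finite_subset[OF _ finite_cartesian_product[OF T(1) T(1)]]) auto
  have H0: "fst e \<noteq> 0 \<or> snd e \<noteq> 0" if "e \<in> H" for e
    using that h by (auto simp: H_def)
  have HT: "\<exists>e\<in>H. fst e \<bullet> x = snd e" if "S \<in> \<T>" "T \<in> \<T>" "S \<noteq> T" "S x = T x" for S T x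
  proof -
    have "h S T \<in> H" using that by (auto simp: H_def)
    then show ?thesis using h that by blast
  qed
  \<comment> \<open>The open and closed cells; \<open>\<sigma>\<close> collects the hyperplanes whose lower side is taken.\<close>
  define U where "U \<sigma> = {x. (\<forall>e\<in>\<sigma>. fst e \<bullet> x < snd e) \<and> (\<forall>e\<in>H - \<sigma>. fst e \<bullet> x > snd e)}" for \<sigma>
  define C where "C \<sigma> = halfspaces (\<sigma> \<union> (\<lambda>e. (- fst e, - snd e)) ` (H - \<sigma>))" for \<sigma>
  have C: "x \<in> C \<sigma> \<longleftrightarrow> (\<forall>e\<in>\<sigma>. fst e \<bullet> x \<le> snd e) \<and> (\<forall>e\<in>H - \<sigma>. fst e \<bullet> x \<ge> snd e)" for x \<sigma>
    by (force simp: C_def halfspaces_def case_prod_unfold)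
  have polyC: "polyhedron (C \<sigma>)" if "\<sigma> \<subseteq> H" for \<sigma>
    unfolding C_def using finite_subset[OF that finH] finH by (intro polyhedron_halfspaces) auto
  have UC: "closure (U \<sigma>) \<subseteq> C \<sigma>" if "\<sigma> \<subseteq> H" for \<sigma>
  proof (rule closure_minimal)
    show "U \<sigma> \<subseteq> C \<sigma>" unfolding U_def subset_iff C mem_Collect_eq by (meson less_imp_le)
    show "closed (C \<sigma>)" by (rule polyhedron_imp_closed[OF polyC[OF that]])
  qed
  define \<C> where "\<C> = C ` {\<sigma> \<in> Pow H. U \<sigma> \<noteq> {}}"
  \<comment> \<open>The open cells miss only finitely many hyperplanes, so their closures cover the space.\<close>
  have cover: "\<exists>\<sigma>\<in>Pow H. x \<in> closure (U \<sigma>)" for x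
  proof -
    have neg: "negligible (\<Union>e\<in>H. {x. fst e \<bullet> x = snd e})"
      using finH H0 by (intro negligible_Union) (auto intro: negligible_hyperplane)
    have "\<Union> (U ` Pow H) \<supseteq> - (\<Union>e\<in>H. {x. fst e \<bullet> x = snd e})"
    proof
      fix y assume y: "y \<in> - (\<Union>e\<in>H. {x. fst e \<bullet> x = snd e})"
      then have "y \<in> U {e\<in>H. fst e \<bullet> y < snd e}" by (auto simp: U_def)
      then show "y \<in> \<Union> (U ` Pow H)" by (rule UN_I[rotated]) auto
    qed
    moreover have "x \<in> closure (- (\<Union>e\<in>H. {x. fst e \<bullet> x = snd e}))"
      unfolding closure_approachable
    proof (intro allI impI)
      fix e :: real assume "e > 0"
      then have "\<not> ball x e \<subseteq> (\<Union>e\<in>H. {x. fst e \<bullet> x = snd e})"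
        using negligible_subset[OF neg] open_not_negligible[of "ball x e"] by auto
      then obtain y where "y \<in> ball x e" "y \<notin> (\<Union>e\<in>H. {x. fst e \<bullet> x = snd e})"
        unfolding subset_iff by blast
      then show "\<exists>y\<in>- (\<Union>e\<in>H. {x. fst e \<bullet> x = snd e}). dist y x < e"
        by (intro bexI[of _ y]) (simp_all add: dist_commute)
    qed
    ultimately have "x \<in> closure (\<Union> (U ` Pow H))" using closure_mono by blast
    also have "\<dots> \<subseteq> (\<Union>\<sigma>\<in>Pow H. closure (U \<sigma>))"
      by (intro closure_minimal closed_UN) (use finH closure_subset in auto)
    finally show ?thesis by (rule UN_E) (rule bexI)
  qed
  show ?thesis
  proof (rule that)
    show "finite \<C>" using finH by (auto simp: \<C>_def)
    show "\<Union>\<C> = UNIV"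
    proof -
      have "x \<in> \<Union>\<C>" for x
      proof -
        obtain \<sigma> where s: "\<sigma> \<subseteq> H" "x \<in> closure (U \<sigma>)" using cover[of x] by blast
        then have "U \<sigma> \<noteq> {}" by auto
        then show ?thesis using s UC[OF s(1)] by (auto simp: \<C>_def)
      qed
      then show ?thesis by blast
    qed
    show "polyhedron X" if "X \<in> \<C>" for X using that polyC by (auto simp: \<C>_def)
    show "\<exists>T. affine_map T \<and> (\<forall>x\<in>X. F x = T x)" if "X \<in> \<C>" for X
    proof -
      obtain \<sigma> p where s: "\<sigma> \<subseteq> H" "X = C \<sigma>" "p \<in> U \<sigma>" using \<open>X \<in> \<C>\<close> by (auto simp: \<C>_def)
      obtain T where TT: "T \<in> \<T>" "F p = T p" using T(3) by blast
      have clos: "closed {x. F x = S x}" if "S \<in> \<T>" for S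
      proof -
        obtain L b where "linear L" "S = (\<lambda>x. L x + b)" using T(2) \<open>S \<in> \<T>\<close> by (auto simp: affine_map_def)
        then have "continuous_on UNIV S"
          by (simp add: continuous_on_add linear_continuous_on linear_conv_bounded_linear)
        then show ?thesis by (intro closed_Collect_eq cont) auto
      qed
      have "U \<sigma> = (\<Inter>e\<in>\<sigma>. {x. fst e \<bullet> x < snd e}) \<inter> (\<Inter>e\<in>H - \<sigma>. {x. fst e \<bullet> x > snd e})"
        by (auto simp: U_def)
      then have "convex (U \<sigma>)"
        by (auto intro!: convex_Int convex_INT convex_halfspace_lt convex_halfspace_gt)
      then have "connected (U \<sigma>)" by (rule convex_connected)
      moreover have "{x. F x = T x} \<inter> (\<Union>S\<in>\<T> - {T}. {x. F x = S x}) \<inter> U \<sigma> = {}"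
      proof -
        have False if that': "F x = T x" "S \<in> \<T>" "S \<noteq> T" "F x = S x" "x \<in> U \<sigma>" for x S
        proof -
          obtain e where e: "e \<in> H" "fst e \<bullet> x = snd e"
            using HT[OF that'(2) TT(1) that'(3), of x] that'(1,4) by auto
          have "fst e \<bullet> x < snd e \<or> fst e \<bullet> x > snd e"
            using that'(5) e(1) unfolding U_def by blast
          then show False using e(2) by simp
        qed
        then show ?thesis by blast
      qed
      moreover have "U \<sigma> \<subseteq> {x. F x = T x} \<union> (\<Union>S\<in>\<T> - {T}. {x. F x = S x})"
        using T(3) by auto
      moreover have "closed (\<Union>S\<in>\<T> - {T}. {x. F x = S x})"
        using T(1) clos by (intro closed_UN) auto
      ultimately have "{x. F x = T x} \<inter> U \<sigma> = {} \<or> (\<Union>S\<in>\<T> - {T}. {x. F x = S x}) \<inter> U \<sigma> = {}"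
        using clos[OF TT(1)] by (intro connected_closedD) auto
      then have "(\<Union>S\<in>\<T> - {T}. {x. F x = S x}) \<inter> U \<sigma> = {}"
        using TT(2) s(3) by blast
      then have FU: "F x = T x" if "x \<in> U \<sigma>" for x
        using T(3) that by blast
      have "F x = T x" if x: "x \<in> C \<sigma>" for x
      proof -
        define y where "y n = x + (1 / real (Suc n)) *\<^sub>R (p - x)" for n
        have "y n \<in> U \<sigma>" for n
        proof -
          define t where "t = 1 / real (Suc n)"
          have t: "0 < t" "t \<le> 1" by (auto simp: t_def)
          have yt: "y n = x + t *\<^sub>R (p - x)" by (simp only: y_def t_def)
          have y: "a \<bullet> y n = (1 - t) * (a \<bullet> x) + t * (a \<bullet> p)" for a
            by (simp add: yt inner_add_right inner_diff_right algebra_simps)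
          have lt: "(1 - t) * u + t * v < w" if "u \<le> w" "v < w" for u v w
          proof -
            have "(1 - t) * u \<le> (1 - t) * w" "t * v < t * w"
              using that t by (auto intro: mult_left_mono)
            then show ?thesis by (simp add: algebra_simps)
          qed
          have gt: "(1 - t) * u + t * v > w" if "u \<ge> w" "v > w" for u v w
            using lt[of "-u" "-w" "-v"] that by simp
          show ?thesis
            using x s(3) unfolding U_def C mem_Collect_eq y by (blast intro: lt gt)
        qed
        then have "\<forall>n. y n \<in> {x. F x = T x}" using FU by blast
        moreover have "y \<longlonglongrightarrow> x + 0 *\<^sub>R (p - x)" unfolding y_def
          by (intro tendsto_intros lim_1_over_n[THEN LIMSEQ_Suc])
        ultimately have "x + 0 *\<^sub>R (p - x) \<in> {x. F x = T x}"
          using closed_sequentially[OF clos[OF TT(1)]] by blast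
        then show ?thesis by simp
      qed
      then show ?thesis using T(2) TT(1) s(2) by blast
    qed
  qed
qed

text \<open>Robinson's upper Lipschitz property of the zeros of a piecewise affine function: small values
  occur only in cells that contain a zero.\<close>

theorem affine_selection_zero_bound:
  fixes G :: "'a::euclidean_space \<Rightarrow> 'b::euclidean_space"
  assumes "continuous_on UNIV G" "affine_selection G"
  obtains e K where "e > 0" "K > 0"
    "\<And>x. norm (G x) < e \<Longrightarrow> infdist x {x. G x = 0} \<le> K * norm (G x)"
proof -
  obtain \<C> where C: "finite \<C>" "\<Union>\<C> = UNIV" "\<And>C. C \<in> \<C> \<Longrightarrow> polyhedron C"
    "\<And>C. C \<in> \<C> \<Longrightarrow> \<exists>T. affine_map T \<and> (\<forall>x\<in>C. G x = T x)"
    using continuous_affine_selection_cells[OF assms] by metis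
  have "\<exists>e>0. \<exists>K>0. \<forall>x\<in>X. norm (G x) < e \<longrightarrow> infdist x {x. G x = 0} \<le> K * norm (G x)" if X: "X \<in> \<C>" for X
  proof -
    obtain L b where L: "linear L" "\<And>x. x \<in> X \<Longrightarrow> G x = L x + b"
      using C(4)[OF X] by (auto simp: affine_map_def)
    show ?thesis
    proof (cases "\<exists>x\<in>X. L x = - b")
      case True
      then obtain x0 where x0: "x0 \<in> X" "L x0 = - b" by blast
      obtain K where K: "K > 0" "\<And>x. x \<in> X \<Longrightarrow> \<exists>y\<in>X. L y = - b \<and> norm (x - y) \<le> K * norm (L x - (- b))"
        using hoffman[OF C(3)[OF X] L(1) x0] by blast
      have "infdist x {x. G x = 0} \<le> K * norm (G x)" if x: "x \<in> X" for x
      proof -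
        obtain y where y: "y \<in> X" "L y = - b" "norm (x - y) \<le> K * norm (L x - (- b))"
          using K(2)[OF x] by blast
        then have "y \<in> {x. G x = 0}" using L(2) by simp
        then have "infdist x {x. G x = 0} \<le> dist x y" by (rule infdist_le)
        then show ?thesis using y(3) L(2)[OF x] by (simp add: dist_norm)
      qed
      then show ?thesis using K(1) zero_less_one by blast
    next
      case False
      show ?thesis
      proof (cases "X = {}")
        case True
        then show ?thesis using zero_less_one by blast
      next
        case Xne: False
        define Q where "Q x = 2 *\<^sub>R adjoint L (L x)" for x
        have lQ: "linear Q" unfolding Q_def
          using linear_compose[OF L(1) adjoint_linear[OF L(1)]]
          by (intro linear_compose_scale_right) (simp add: o_def)
        have Qs: "x \<bullet> Q y = Q x \<bullet> y" for x y
          unfolding Q_def using adjoint_works[OF L(1), of x "L y"] adjoint_works[OF L(1), of y "L x"]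
          by (simp add: inner_commute)
        have q: "(norm (L x + b))\<^sup>2 = 1/2 * (x \<bullet> Q x) + (2 *\<^sub>R adjoint L b) \<bullet> x + b \<bullet> b" for x
          unfolding Q_def power2_norm_eq_inner
          using adjoint_works[OF L(1), of x "L x"] adjoint_works[OF L(1), of x b]
          by (simp add: inner_commute algebra_simps)
        have "\<exists>x\<in>X. \<forall>y\<in>X. (norm (L x + b))\<^sup>2 \<le> (norm (L y + b))\<^sup>2"
          by (rule frank_wolfe[OF C(3)[OF X] Xne lQ Qs q, of 0]) auto
        then obtain x where x: "x \<in> X" "\<And>y. y \<in> X \<Longrightarrow> norm (L x + b) \<le> norm (L y + b)"
          by (auto simp: power2_le_iff_abs_le)
        have "norm (L x + b) > 0" using False x(1) by (auto simp: add_eq_0_iff2)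
        moreover have "\<not> norm (G y) < norm (L x + b)" if "y \<in> X" for y
          using x(2)[OF that] L(2)[OF that] by simp
        ultimately show ?thesis using zero_less_one by blast
      qed
    qed
  qed
  then obtain e K where eK: "\<And>X. X \<in> \<C> \<Longrightarrow> e X > 0" "\<And>X. X \<in> \<C> \<Longrightarrow> K X > 0"
    "\<And>X x. X \<in> \<C> \<Longrightarrow> x \<in> X \<Longrightarrow> norm (G x) < e X \<Longrightarrow> infdist x {x. G x = 0} \<le> K X * norm (G x)"
    by metis
  have ne: "\<C> \<noteq> {}" using C(2) by auto
  show ?thesis
  proof (rule that)
    show "Min (e ` \<C>) > 0" using C(1) ne eK(1) by simp
    show "Max (K ` \<C>) > 0" using C(1) ne eK(2) by (auto simp: Max_gr_iff)
    fix x assume x: "norm (G x) < Min (e ` \<C>)"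
    obtain X where X: "X \<in> \<C>" "x \<in> X" using C(2) by blast
    then have "norm (G x) < e X" using x C(1) ne by simp
    then have "infdist x {x. G x = 0} \<le> K X * norm (G x)" by (rule eK(3)[OF X])
    also have "\<dots> \<le> Max (K ` \<C>) * norm (G x)"
      using X(1) C(1) by (intro mult_right_mono) auto
    finally show "infdist x {x. G x = 0} \<le> Max (K ` \<C>) * norm (G x)" .
  qed
qed

text \<open>Away from the range of validity of the zero bound the residual is bounded below, and this absorbs
  distances up to any prescribed radius; radius \<open>1\<close> is chosen.\<close>

corollary error_bound_affine_selection:
  fixes F :: "'a::euclidean_space \<Rightarrow> 'a"
  assumes "continuous_on UNIV F" "affine_selection F"
  shows "error_bound F"
proof -
  have "continuous_on UNIV (\<lambda>x. F x - x)" by (intro continuous_intros assms)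
  moreover have "affine_selection (\<lambda>x. F x - x)"
    using affine_selection_combination[OF assms(2) affine_selection_id, of 1 "-1"] by simp
  ultimately obtain e K where eK: "e > 0" "K > 0"
    "\<And>x. norm (F x - x) < e \<Longrightarrow> infdist x {x. F x - x = 0} \<le> K * norm (F x - x)"
    by (rule affine_selection_zero_bound) blast
  have fp: "fixed_points F = {x. F x - x = 0}" by (simp add: fixed_points_def)
  have "infdist x (fixed_points F) \<le> max K (1 / e) * norm (F x - x)" if "infdist x (fixed_points F) \<le> 1" for x
  proof (cases "norm (F x - x) < e")
    case True
    then have "infdist x (fixed_points F) \<le> K * norm (F x - x)" unfolding fp by (rule eK(3))
    also have "\<dots> \<le> max K (1 / e) * norm (F x - x)" by (intro mult_right_mono) auto
    finally show ?thesis .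
  next
    case False
    have "1 \<le> (1 / e) * norm (F x - x)" using False eK(1) by (simp add: field_simps)
    also have "\<dots> \<le> max K (1 / e) * norm (F x - x)" by (intro mult_right_mono) auto
    finally show ?thesis using that by simp
  qed
  moreover have "max K (1 / e) > 0" using eK by (simp add: less_max_iff_disj)
  ultimately show ?thesis unfolding error_bound_def using zero_less_one by blast
qed

section \<open>Fejer monotone iterations\<close>

text \<open>The factor \<open>2\<close> between the distance to the limit and the distance to the fixed points turns the
  contraction of the distance to the set into a contraction of the distance to the limit.\<close>

theorem fejer_converges_linearly:
  fixes F :: "'a::euclidean_space \<Rightarrow> 'a"
  assumes cont: "continuous_on UNIV F" and ne: "fixed_points F \<noteq> {}" and a: "a > 0"
    and fejer: "\<And>x y. y \<in> fixed_points F \<Longrightarrow>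
      (norm (F x - y))\<^sup>2 \<le> (norm (x - y))\<^sup>2 - a * (norm (F x - x))\<^sup>2"
    and eb: "error_bound F"
  shows "\<exists>xs\<in>fixed_points F. converges_linearly (\<lambda>k. (F ^^ k) x0) xs"
proof -
  let ?Z = "fixed_points F"
  obtain R K where RK: "R > 0" "K > 0"
    "\<And>x. infdist x ?Z \<le> R \<Longrightarrow> infdist x ?Z \<le> K * norm (F x - x)"
    using eb unfolding error_bound_def by blast
  define X where "X k = (F ^^ k) x0" for k
  have XS: "X (Suc k) = F (X k)" for k by (simp add: X_def)
  have mono1: "norm (X (Suc k) - y) \<le> norm (X k - y)" if "y \<in> ?Z" for k y
  proof -
    have "a * (norm (F (X k) - X k))\<^sup>2 \<ge> 0" using a by simp
    then have "(norm (X (Suc k) - y))\<^sup>2 \<le> (norm (X k - y))\<^sup>2"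
      using fejer[OF that, of "X k"] unfolding XS by linarith
    then show ?thesis by (rule power2_le_imp_le) simp
  qed
  have mono: "norm (X m - y) \<le> norm (X k - y)" if "y \<in> ?Z" "k \<le> m" for k m y
    by (rule lift_Suc_antimono_le[of "\<lambda>k. norm (X k - y)", OF mono1[OF that(1)] that(2)])
  obtain y0 where y0: "y0 \<in> ?Z" using ne by blast
  have bdd: "bounded (range X)"
    unfolding bounded_iff
  proof (intro exI ballI)
    fix x assume "x \<in> range X"
    then obtain k where "x = X k" by blast
    then show "norm x \<le> norm y0 + norm (X 0 - y0)"
      using mono[OF y0, of 0 k] norm_triangle_sub[of "X k" y0] by simp
  qed
  have clZ: "closed ?Z" unfolding fixed_points_def
    by (intro closed_Collect_eq cont continuous_intros)
  obtain l r where r: "strict_mono (r :: nat \<Rightarrow> nat)" "(X \<circ> r) \<longlonglongrightarrow> l"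
    using bounded_imp_convergent_subsequence[OF bdd] by blast
  have diff0: "(\<lambda>k. F (X k) - X k) \<longlonglongrightarrow> 0"
  proof -
    have "decseq (\<lambda>k. (norm (X k - y0))\<^sup>2)"
      using mono[OF y0] by (auto simp: decseq_def power2_eq_square intro: mult_mono)
    then have "convergent (\<lambda>k. (norm (X k - y0))\<^sup>2)"
      by (metis decseq_convergent convergent_def zero_le_power2)
    then obtain L where L: "(\<lambda>k. (norm (X k - y0))\<^sup>2) \<longlonglongrightarrow> L" by (auto simp: convergent_def)
    have "(\<lambda>k. (norm (X k - y0))\<^sup>2 - (norm (X (Suc k) - y0))\<^sup>2) \<longlonglongrightarrow> L - L"
      by (intro tendsto_diff L LIMSEQ_Suc)
    then have 1: "(\<lambda>k. ((norm (X k - y0))\<^sup>2 - (norm (X (Suc k) - y0))\<^sup>2) / a) \<longlonglongrightarrow> (L - L) / a"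
      using a by (intro tendsto_divide tendsto_const) auto
    have "(\<lambda>k. (norm (F (X k) - X k))\<^sup>2) \<longlonglongrightarrow> 0"
    proof (rule Lim_null_comparison[OF always_eventually])
      show "\<forall>k. norm ((norm (F (X k) - X k))\<^sup>2) \<le> ((norm (X k - y0))\<^sup>2 - (norm (X (Suc k) - y0))\<^sup>2) / a"
        using fejer[OF y0] a by (auto simp: XS field_simps)
    qed (use 1 in simp)
    then have "(\<lambda>k. norm (F (X k) - X k)) \<longlonglongrightarrow> 0"
      using tendsto_real_sqrt by fastforce
    then show ?thesis by (rule tendsto_norm_zero_cancel)
  qed
  have lZ: "l \<in> ?Z"
  proof -
    have "isCont F l" using cont by (simp add: continuous_on_eq_continuous_at)
    then have "(\<lambda>k. F ((X \<circ> r) k) - (X \<circ> r) k) \<longlonglongrightarrow> F l - l"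
      by (intro tendsto_diff isCont_tendsto_compose[OF _ r(2)] r(2))
    moreover have "(\<lambda>k. F ((X \<circ> r) k) - (X \<circ> r) k) \<longlonglongrightarrow> 0"
      using LIMSEQ_subseq_LIMSEQ[OF diff0 r(1)] by (simp add: o_def)
    ultimately have "F l - l = 0" by (rule LIMSEQ_unique)
    then show ?thesis by (simp add: fixed_points_def)
  qed
  have Xl: "X \<longlonglongrightarrow> l"
  proof (rule metric_LIMSEQ_I)
    fix e :: real assume "e > 0"
    then obtain N where "dist ((X \<circ> r) N) l < e"
      using metric_LIMSEQ_D[OF r(2)] by blast
    then have "dist (X m) l < e" if "m \<ge> r N" for m
      using mono[OF lZ that] by (simp add: dist_norm)
    then show "\<exists>no. \<forall>m\<ge>no. dist (X m) l < e" by blast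
  qed
  \<comment> \<open>Every later iterate stays in the ball around the projection of the current one.\<close>
  have two: "norm (X k - l) \<le> 2 * infdist (X k) ?Z" for k
  proof -
    obtain y where y: "y \<in> ?Z" "infdist (X k) ?Z = dist (X k) y"
      using infdist_attains_inf[OF clZ ne] by blast
    have "(\<lambda>m. norm (X m - y)) \<longlonglongrightarrow> norm (l - y)"
      by (intro tendsto_norm tendsto_diff Xl tendsto_const)
    then have "norm (l - y) \<le> norm (X k - y)"
      by (rule LIMSEQ_le_const2) (use mono[OF y(1)] in blast)
    then show ?thesis using y(2) norm_triangle_ineq[of "X k - y" "y - l"]
      by (simp add: dist_norm norm_minus_commute)
  qed
  obtain k0 where k0: "\<And>k. k \<ge> k0 \<Longrightarrow> dist (X k) l < R"
    using metric_LIMSEQ_D[OF Xl RK(1)] by blast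
  \<comment> \<open>The maximum guards against a negative factor when \<open>a\<close> is large compared to \<open>K\<close>.\<close>
  define c where "c = max 0 (1 - a / (2 * K)\<^sup>2)"
  have c: "0 \<le> c" "c < 1" using a RK(2) by (auto simp: c_def)
  have "norm (X (Suc k) - l) \<le> sqrt c * norm (X k - l)" if "k \<ge> k0" for k
  proof -
    have "infdist (X k) ?Z \<le> dist (X k) l" by (rule infdist_le[OF lZ])
    then have "infdist (X k) ?Z \<le> R" using k0[OF that] by simp
    then have "norm (X k - l) \<le> (2 * K) * norm (F (X k) - X k)"
      using RK(3)[of "X k"] two[of k] by simp
    then have "(norm (X k - l))\<^sup>2 \<le> ((2 * K) * norm (F (X k) - X k))\<^sup>2"
      by (rule power_mono) simp
    then have "a / (2 * K)\<^sup>2 * (norm (X k - l))\<^sup>2 \<le> a * (norm (F (X k) - X k))\<^sup>2"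
      using a RK(2) by (simp add: power_mult_distrib field_simps)
    then have "(norm (X (Suc k) - l))\<^sup>2 \<le> (1 - a / (2 * K)\<^sup>2) * (norm (X k - l))\<^sup>2"
      using fejer[OF lZ, of "X k"] by (simp add: XS algebra_simps)
    also have "\<dots> \<le> c * (norm (X k - l))\<^sup>2"
      unfolding c_def by (intro mult_right_mono) auto
    also have "\<dots> = (sqrt c * norm (X k - l))\<^sup>2" using c by (simp add: power_mult_distrib)
    finally show ?thesis by (rule power2_le_imp_le) (use c in simp)
  qed
  moreover have "sqrt c \<in> {0..<1}" using c by simp
  ultimately have "converges_linearly X l"
    unfolding converges_linearly_def using Xl by blast
  then show ?thesis using lZ unfolding X_def by blast
qed

section \<open>Proximal points of convex piecewise linear-quadratic functions\<close>

text \<open>First-order conditions are extracted from inequalities along short segments in this form; a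
  quadratic bound along the segment takes the place of a limit.\<close>

lemma nonneg_of_small_steps:
  fixes p r e :: real
  assumes e: "e > 0" and step: "\<And>t. 0 < t \<Longrightarrow> t \<le> e \<Longrightarrow> 0 \<le> t * p + t\<^sup>2 * r"
  shows "0 \<le> p"
proof (rule ccontr)
  assume "\<not> 0 \<le> p"
  then have p: "p < 0" by simp
  define t where "t = min e (- p / (2 * (\<bar>r\<bar> + 1)))"
  have "- p / (2 * (\<bar>r\<bar> + 1)) > 0" by (rule divide_pos_pos) (use p in auto)
  then have t: "0 < t" "t \<le> e" using e by (auto simp: t_def)
  have "t * r \<le> t * (\<bar>r\<bar> + 1)" using t by (intro mult_left_mono) auto
  also have "\<dots> \<le> - p / (2 * (\<bar>r\<bar> + 1)) * (\<bar>r\<bar> + 1)"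
    unfolding t_def by (intro mult_right_mono) auto
  also have "\<dots> = - p / 2" by (simp add: field_simps)
  finally have "p + t * r < 0" using p by simp
  then have "t * (p + t * r) < 0" using t by (simp add: mult_less_0_iff)
  then show False using step[OF t] by (simp add: power2_eq_square algebra_simps)
qed

text \<open>The linear part comes from a linear left inverse of the first projection on the direction space of
  the relation. The domain of the relation may be a proper affine subspace.\<close>

lemma single_valued_affine_relation:
  fixes R :: "('a::euclidean_space \<times> 'b::euclidean_space) set"
  assumes R: "affine R" and sv: "\<And>x w w'. (x, w) \<in> R \<Longrightarrow> (x, w') \<in> R \<Longrightarrow> w = w'"
  shows "\<exists>T. affine_map T \<and> (\<forall>(x, w)\<in>R. w = T x)"
proof (cases "R = {}")
  case True
  have "affine_map (\<lambda>x::'a. 0::'b)" unfolding affine_map_def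
    by (rule exI[of _ "\<lambda>x. 0"]) (auto simp: linear_zero)
  then show ?thesis using True by blast
next
  case False
  then obtain x0 w0 where p: "(x0, w0) \<in> R" by auto
  define S where "S = (\<lambda>p. - (x0, w0) + p) ` R"
  have S: "subspace S"
    unfolding S_def using affine_diffs_subspace[OF R p] by (simp add: image_def Setcompr_eq_image)
  have inj: "inj_on fst S"
  proof (rule inj_onI)
    fix p q assume pq: "p \<in> S" "q \<in> S" "fst p = fst q"
    have "p = (fst p, snd p)" "q = (fst p, snd q)" using pq(3) by (auto simp: prod_eq_iff)
    then have "(x0 + fst p, w0 + snd p) \<in> R" "(x0 + fst p, w0 + snd q) \<in> R"
      using pq by (auto simp: S_def)
    then have "w0 + snd p = w0 + snd q" by (rule sv)
    then show "p = q" using pq(3) by (simp add: prod_eq_iff)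
  qed
  obtain g where g: "linear g" "\<forall>v\<in>S. g (fst v) = v"
    using linear_exists_left_inverse_on[OF linear_fst S inj] by blast
  define T where "T x = snd (g x) + (w0 - snd (g x0))" for x
  have "affine_map T"
    unfolding affine_map_def T_def using linear_compose[OF g(1) linear_snd] by (auto simp: o_def)
  moreover have "w = T x" if "(x, w) \<in> R" for x w
  proof -
    have "(x - x0, w - w0) \<in> S" using that by (force simp: S_def)
    then have "g (x - x0) = (x - x0, w - w0)" using g(2) by fastforce
    then have "snd (g x) - snd (g x0) = w - w0" by (simp add: linear_diff[OF g(1)] prod_eq_iff)
    then show ?thesis by (simp add: T_def algebra_simps)
  qed
  ultimately show ?thesis by blast
qed

text \<open>The variational inequality saying that \<open>z\<close> minimizes \<open>\<gamma> \<phi> + \<parallel>u - x\<parallel>\<^sup>2 / 2\<close> over \<open>D\<close>. Then \<open>u z\<close> is the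
  proximal point at \<open>x\<close> of the function \<open>w \<mapsto> inf {\<phi> z | u z = w}\<close>; the choice \<open>u = id\<close> gives the
  ordinary proximal point.\<close>

definition prox_point ::
    "'a set \<Rightarrow> ('a \<Rightarrow> real) \<Rightarrow> ('a \<Rightarrow> 'b::real_inner) \<Rightarrow> real \<Rightarrow> 'b \<Rightarrow> 'a \<Rightarrow> bool" where
  "prox_point D \<phi> u \<gamma> x z \<longleftrightarrow>
     z \<in> D \<and> (\<forall>z'\<in>D. \<gamma> * \<phi> z + (x - u z) \<bullet> (u z' - u z) \<le> \<gamma> * \<phi> z')"

lemma prox_point_firmly_nonexpansive:
  assumes "prox_point D \<phi> u \<gamma> x z" "prox_point D \<phi> u \<gamma> y w"
  shows "(norm (u z - u w))\<^sup>2 \<le> (x - y) \<bullet> (u z - u w)"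
proof -
  have "\<gamma> * \<phi> z + (x - u z) \<bullet> (u w - u z) \<le> \<gamma> * \<phi> w" "\<gamma> * \<phi> w + (y - u w) \<bullet> (u z - u w) \<le> \<gamma> * \<phi> z"
    using assms by (auto simp: prox_point_def)
  then have "(x - u z) \<bullet> (u w - u z) + (y - u w) \<bullet> (u z - u w) \<le> 0" by simp
  then show ?thesis by (simp add: power2_norm_eq_inner algebra_simps inner_commute)
qed

lemma prox_point_unique:
  assumes "prox_point D \<phi> u \<gamma> x z" "prox_point D \<phi> u \<gamma> x w"
  shows "u z = u w"
  using prox_point_firmly_nonexpansive[OF assms] by simp

text \<open>A real-valued description of a proper convex piecewise linear-quadratic function by its effective
  domain \<open>D\<close> and its finite values \<open>\<phi>\<close>, with the pieces given by explicit inequalities. The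
  individual quadratic forms may be indefinite off the span of their piece.\<close>

locale convex_plq =
  fixes D :: "'a::euclidean_space set" and \<phi> :: "'a \<Rightarrow> real"
    and I :: "nat set" and H :: "nat \<Rightarrow> ('a \<times> real) set"
    and Q :: "nat \<Rightarrow> 'a \<Rightarrow> 'a" and l :: "nat \<Rightarrow> 'a" and b :: "nat \<Rightarrow> real"
  assumes finite_I: "finite I"
    and finite_H: "i \<in> I \<Longrightarrow> finite (H i)"
    and linear_Q: "i \<in> I \<Longrightarrow> linear (Q i)"
    and sym_Q: "i \<in> I \<Longrightarrow> x \<bullet> Q i y = Q i x \<bullet> y"
    and dom: "D = (\<Union>i\<in>I. halfspaces (H i))"
    and val: "i \<in> I \<Longrightarrow> x \<in> halfspaces (H i) \<Longrightarrow> \<phi> x = 1/2 * (x \<bullet> Q i x) + l i \<bullet> x + b i"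
    and convex: "convex_on D \<phi>"
    and nonempty: "D \<noteq> {}"
begin

lemma segment:
  assumes "x \<in> D" "y \<in> D" "0 \<le> t" "t \<le> 1"
  shows "x + t *\<^sub>R (y - x) \<in> D" "\<phi> (x + t *\<^sub>R (y - x)) \<le> \<phi> x + t * (\<phi> y - \<phi> x)"
proof -
  have eq: "x + t *\<^sub>R (y - x) = (1 - t) *\<^sub>R x + t *\<^sub>R y" by (simp add: algebra_simps)
  show "x + t *\<^sub>R (y - x) \<in> D"
    unfolding eq using convex assms by (auto simp: convex_on_def convex_def)
  have "\<phi> ((1 - t) *\<^sub>R x + t *\<^sub>R y) \<le> (1 - t) * \<phi> x + t * \<phi> y"
    using convex assms unfolding convex_on_def by auto
  then show "\<phi> (x + t *\<^sub>R (y - x)) \<le> \<phi> x + t * (\<phi> y - \<phi> x)"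
    unfolding eq by (simp add: algebra_simps)
qed

lemma val_along_line:
  assumes "i \<in> I" "x \<in> halfspaces (H i)" "x + t *\<^sub>R d \<in> halfspaces (H i)"
  shows "\<phi> (x + t *\<^sub>R d) = \<phi> x + t * ((Q i x + l i) \<bullet> d) + t\<^sup>2 * (d \<bullet> Q i d / 2)"
  using val[OF assms(1,3)] val[OF assms(1,2)]
    quadratic_along_line[OF linear_Q sym_Q, OF assms(1) assms(1), of x t d "l i" "b i"] by simp

text \<open>On each piece the objective is a quadratic function bounded below: the affine minorant in \<open>u z\<close> is
  dominated by the squared distance of \<open>u z\<close> from \<open>x\<close>. So \<open>frank_wolfe\<close> yields a minimizer per
  piece, and the best of them satisfies the variational inequality by convexity.\<close>

lemma prox_point_exists:
  fixes u :: "'a \<Rightarrow> 'b::euclidean_space"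
  assumes u: "linear L" "u = (\<lambda>z. L z + c)" and \<gamma>: "\<gamma> > 0"
    and minorant: "\<And>z. z \<in> D \<Longrightarrow> \<beta> + v \<bullet> u z \<le> \<phi> z"
  shows "\<exists>z. prox_point D \<phi> u \<gamma> x z"
proof -
  define h where "h z = \<gamma> * \<phi> z + 1/2 * (norm (u z - x))\<^sup>2" for z
  define I' where "I' = {i\<in>I. halfspaces (H i) \<noteq> {}}"
  have "\<exists>z\<in>halfspaces (H i). \<forall>y\<in>halfspaces (H i). h z \<le> h y" if "i \<in> I'" for i
  proof -
    have i: "i \<in> I" "halfspaces (H i) \<noteq> {}" using that by (auto simp: I'_def)
    define Q' where "Q' z = \<gamma> *\<^sub>R Q i z + adjoint L (L z)" for z
    define l' where "l' = \<gamma> *\<^sub>R l i + adjoint L (c - x)"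
    define b' where "b' = \<gamma> * b i + 1/2 * (norm (c - x))\<^sup>2"
    define q where "q z = 1/2 * (z \<bullet> Q' z) + l' \<bullet> z + b'" for z
    have lQ: "linear Q'" unfolding Q'_def
      using linear_compose[OF u(1) adjoint_linear[OF u(1)]] linear_Q[OF i(1)]
      by (intro linear_compose_add linear_compose_scale_right) (simp_all add: o_def)
    have sQ: "y \<bullet> Q' z = Q' y \<bullet> z" for y z
      unfolding Q'_def using adjoint_works[OF u(1), of y "L z"] adjoint_works[OF u(1), of z "L y"] sym_Q[OF i(1), of y z]
      by (simp add: inner_commute algebra_simps)
    have hq: "h z = q z" if "z \<in> halfspaces (H i)" for z
      unfolding h_def q_def Q'_def l'_def b'_def val[OF i(1) that] power2_norm_eq_inner u(2)
      using adjoint_works[OF u(1), of z "L z"] adjoint_works[OF u(1), of z "c - x"]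
      by (simp add: inner_commute algebra_simps)
    have low: "\<gamma> * \<beta> + \<gamma> * (v \<bullet> x) - 1/2 * (norm (\<gamma> *\<^sub>R v))\<^sup>2 \<le> q z" if "z \<in> halfspaces (H i)" for z
    proof -
      have "z \<in> D" using that i(1) dom by blast
      then have "\<gamma> * (\<beta> + v \<bullet> u z) \<le> \<gamma> * \<phi> z" using minorant \<gamma> by (intro mult_left_mono) auto
      moreover have "0 \<le> 1/2 * (norm ((u z - x) + \<gamma> *\<^sub>R v))\<^sup>2" by simp
      ultimately show ?thesis
        unfolding hq[OF that, symmetric] h_def power2_norm_eq_inner
        by (simp add: inner_commute algebra_simps power2_eq_square)
    qed
    have "\<exists>z\<in>halfspaces (H i). \<forall>y\<in>halfspaces (H i). q z \<le> q y"
      by (rule frank_wolfe[OF polyhedron_halfspaces[OF finite_H[OF i(1)]] i(2) lQ sQ q_def low])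
    then show ?thesis using hq by metis
  qed
  then obtain w where w: "\<And>i. i \<in> I' \<Longrightarrow> w i \<in> halfspaces (H i)"
      "\<And>i y. i \<in> I' \<Longrightarrow> y \<in> halfspaces (H i) \<Longrightarrow> h (w i) \<le> h y"
    by metis
  have I': "finite I'" "I' \<noteq> {}" using finite_I nonempty dom by (auto simp: I'_def)
  obtain k where k: "k \<in> I'" "\<And>i. i \<in> I' \<Longrightarrow> h (w k) \<le> h (w i)"
    using ex_is_arg_min_if_finite[OF I', of "h \<circ> w"] by (auto simp: is_arg_min_linorder)
  define z where "z = w k"
  have zD: "z \<in> D" using w(1)[OF k(1)] k(1) dom by (auto simp: z_def I'_def)
  have zmin: "h z \<le> h y" if y: "y \<in> D" for y
  proof -
    obtain i where "i \<in> I" "y \<in> halfspaces (H i)" using y dom by blast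
    then have "i \<in> I'" by (auto simp: I'_def)
    then show ?thesis using k(2)[of i] w(2)[of i y] \<open>y \<in> halfspaces (H i)\<close> by (simp add: z_def)
  qed
  have "\<gamma> * \<phi> z + (x - u z) \<bullet> (u z' - u z) \<le> \<gamma> * \<phi> z'" if z': "z' \<in> D" for z'
  proof -
    have "0 \<le> \<gamma> * (\<phi> z' - \<phi> z) + (u z - x) \<bullet> (u z' - u z)"
    proof (rule nonneg_of_small_steps[OF zero_less_one])
      fix t :: real assume t: "0 < t" "t \<le> 1"
      have ut: "u (z + t *\<^sub>R (z' - z)) - x = (u z - x) + t *\<^sub>R (u z' - u z)"
        unfolding u(2) linear_add[OF u(1)] linear_scale[OF u(1)] linear_diff[OF u(1)] by simp
      have "h z \<le> h (z + t *\<^sub>R (z' - z))" by (rule zmin[OF segment(1)]) (use zD z' t in auto)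
      also have "\<dots> \<le> \<gamma> * (\<phi> z + t * (\<phi> z' - \<phi> z)) + 1/2 * (norm ((u z - x) + t *\<^sub>R (u z' - u z)))\<^sup>2"
        unfolding h_def ut using segment(2)[OF zD z', of t] t \<gamma> by simp
      also have "(norm ((u z - x) + t *\<^sub>R (u z' - u z)))\<^sup>2 =
          (norm (u z - x))\<^sup>2 + 2 * t * ((u z - x) \<bullet> (u z' - u z)) + t\<^sup>2 * (norm (u z' - u z))\<^sup>2"
        unfolding power2_norm_eq_inner
        by (simp add: inner_add_left inner_add_right inner_commute power2_eq_square)
      finally show "0 \<le> t * (\<gamma> * (\<phi> z' - \<phi> z) + (u z - x) \<bullet> (u z' - u z)) + t\<^sup>2 * (1/2 * (norm (u z' - u z))\<^sup>2)"
        unfolding h_def by (simp add: algebra_simps)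
    qed
    then show ?thesis by (simp add: inner_diff_left algebra_simps)
  qed
  then show ?thesis using zD unfolding prox_point_def by blast
qed

text \<open>For a piece \<open>i\<close> and a set \<open>J\<close> of its constraints, \<open>R i J\<close> collects the pairs of an argument \<open>x\<close> and
  a value \<open>u z\<close> for which \<open>z\<close> satisfies \<open>J\<close> with equality and is stationary along the directions \<open>V J\<close>
  that keep \<open>J\<close> tight. If the quadratic form is positive semidefinite on \<open>V J\<close>, then \<open>R i J\<close> is
  single-valued, hence given by an affine map; the point \<open>z\<close> itself need not be unique. At an actual
  proximal point \<open>z\<close> with active constraints \<open>J\<close>, convexity near \<open>z\<close> provides semidefiniteness.\<close>

lemma prox_point_affine_selection:
  fixes u :: "'a \<Rightarrow> 'b::euclidean_space"
  assumes u: "linear L" "u = (\<lambda>z. L z + c)" and \<gamma>: "\<gamma> > 0"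
    and p: "\<And>x. \<exists>z. prox_point D \<phi> u \<gamma> x z \<and> p x = u z"
  shows "affine_selection p"
proof -
  define V where "V J = {d. \<forall>(a, \<beta>)\<in>J. a \<bullet> d = 0}" for J :: "('a \<times> real) set"
  define R where "R i J = {(x, w). \<exists>z. (\<forall>(a, \<beta>)\<in>J. a \<bullet> z = \<beta>) \<and> w = u z \<and>
      (\<forall>d\<in>V J. \<gamma> * ((Q i z + l i) \<bullet> d) + (w - x) \<bullet> L d = 0)}" for i J
  define psd where "psd i J \<longleftrightarrow> (\<forall>d\<in>V J. 0 \<le> d \<bullet> Q i d)" for i J
  have affR: "affine (R i J)" if i: "i \<in> I" for i J
  proof -
    have "s *\<^sub>R p1 + t *\<^sub>R p2 \<in> R i J" if "p1 \<in> R i J" "p2 \<in> R i J" and st: "s + t = 1" for p1 p2 s t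
    proof -
      obtain x1 w1 z1 where 1: "p1 = (x1, w1)" "\<forall>(a, \<beta>)\<in>J. a \<bullet> z1 = \<beta>" "w1 = u z1"
        "\<forall>d\<in>V J. \<gamma> * ((Q i z1 + l i) \<bullet> d) + (w1 - x1) \<bullet> L d = 0"
        using \<open>p1 \<in> R i J\<close> unfolding R_def by blast
      obtain x2 w2 z2 where 2: "p2 = (x2, w2)" "\<forall>(a, \<beta>)\<in>J. a \<bullet> z2 = \<beta>" "w2 = u z2"
        "\<forall>d\<in>V J. \<gamma> * ((Q i z2 + l i) \<bullet> d) + (w2 - x2) \<bullet> L d = 0"
        using \<open>p2 \<in> R i J\<close> unfolding R_def by blast
      define z where "z = s *\<^sub>R z1 + t *\<^sub>R z2"
      have t: "t = 1 - s" using st by simp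
      have "\<forall>(a, \<beta>)\<in>J. a \<bullet> z = \<beta>"
      proof clarify
        fix a \<beta> assume "(a, \<beta>) \<in> J"
        then have "a \<bullet> z1 = \<beta>" "a \<bullet> z2 = \<beta>" using 1(2) 2(2) by auto
        then show "a \<bullet> z = \<beta>" by (simp add: z_def t inner_add_right algebra_simps)
      qed
      moreover have "s *\<^sub>R w1 + t *\<^sub>R w2 = u z"
        unfolding z_def 1(3) 2(3) u(2) linear_add[OF u(1)] linear_scale[OF u(1)] t by (simp add: algebra_simps)
      moreover have "\<gamma> * ((Q i z + l i) \<bullet> d) + ((s *\<^sub>R w1 + t *\<^sub>R w2) - (s *\<^sub>R x1 + t *\<^sub>R x2)) \<bullet> L d = 0"
        if d: "d \<in> V J" for d
      proof -
        have "s * (\<gamma> * ((Q i z1 + l i) \<bullet> d) + (w1 - x1) \<bullet> L d) + t * (\<gamma> * ((Q i z2 + l i) \<bullet> d) + (w2 - x2) \<bullet> L d) = 0"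
          using 1(4) 2(4) d by simp
        then show ?thesis
          unfolding z_def linear_add[OF linear_Q[OF i]] linear_scale[OF linear_Q[OF i]] t
          by (simp add: inner_add_left inner_diff_left algebra_simps)
      qed
      ultimately show ?thesis unfolding R_def 1(1) 2(1) by auto
    qed
    then show ?thesis unfolding affine_def by blast
  qed
  have svR: "w = w'" if as: "i \<in> I" "psd i J" "(x, w) \<in> R i J" "(x, w') \<in> R i J" for i J x w w'
  proof -
    obtain z where 1: "\<forall>(a, \<beta>)\<in>J. a \<bullet> z = \<beta>" "w = u z"
      "\<forall>d\<in>V J. \<gamma> * ((Q i z + l i) \<bullet> d) + (w - x) \<bullet> L d = 0"
      using as(3) unfolding R_def by blast
    obtain z' where 2: "\<forall>(a, \<beta>)\<in>J. a \<bullet> z' = \<beta>" "w' = u z'"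
      "\<forall>d\<in>V J. \<gamma> * ((Q i z' + l i) \<bullet> d) + (w' - x) \<bullet> L d = 0"
      using as(4) unfolding R_def by blast
    define d where "d = z - z'"
    have d: "d \<in> V J" using 1(1) 2(1) by (auto simp: V_def d_def inner_diff_right)
    have ww: "w - w' = L d" by (simp add: 1(2) 2(2) u(2) d_def linear_diff[OF u(1)])
    have "\<gamma> * ((Q i z + l i) \<bullet> d) + (w - x) \<bullet> L d - (\<gamma> * ((Q i z' + l i) \<bullet> d) + (w' - x) \<bullet> L d) = 0"
      using 1(3) 2(3) d by simp
    then have "\<gamma> * (Q i d \<bullet> d) + (w - w') \<bullet> L d = 0"
      unfolding d_def linear_diff[OF linear_Q[OF as(1)]] by (simp add: inner_add_left inner_diff_left algebra_simps)
    moreover have "\<gamma> * (Q i d \<bullet> d) \<ge> 0"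
      using as(2) d \<gamma> by (auto simp: psd_def inner_commute)
    ultimately have "(w - w') \<bullet> (w - w') \<le> 0" using ww by simp
    then have "(w - w') \<bullet> (w - w') = 0" using inner_ge_zero[of "w - w'"] by linarith
    then show ?thesis by simp
  qed
  have ex: "\<exists>T. affine_map T \<and> (psd i J \<longrightarrow> (\<forall>(x, w)\<in>R i J. w = T x))" if "i \<in> I" for i J
  proof (cases "psd i J")
    case True
    have "w = w'" if "(x, w) \<in> R i J" "(x, w') \<in> R i J" for x w w'
      using svR[OF \<open>i \<in> I\<close> True that] .
    with single_valued_affine_relation[OF affR[OF that]] show ?thesis by blast
  next
    case False
    have "affine_map (\<lambda>x::'b. x)" unfolding affine_map_def
      by (rule exI[of _ "\<lambda>x. x"]) (auto intro!: exI[of _ 0] linear_id[unfolded id_def])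
    then show ?thesis using False by blast
  qed
  \<comment> \<open>Sets \<open>J\<close> without semidefiniteness never arise from a proximal point and get an arbitrary map.\<close>
  define T where "T i J = (SOME S. affine_map S \<and> (psd i J \<longrightarrow> (\<forall>(x, w)\<in>R i J. w = S x)))" for i J
  have T0: "affine_map (T i J) \<and> (psd i J \<longrightarrow> (\<forall>(x, w)\<in>R i J. w = T i J x))" if "i \<in> I" for i J
    unfolding T_def by (rule someI_ex[OF ex[OF that]])
  have T: "affine_map (T i J)" "psd i J \<Longrightarrow> (x, w) \<in> R i J \<Longrightarrow> w = T i J x" if "i \<in> I" for i J x w
    using T0[OF that, of J] by auto
  have "\<exists>S\<in>(\<lambda>(i, J). T i J) ` (SIGMA i:I. Pow (H i)). p x = S x" for x
  proof -
    obtain z where z: "prox_point D \<phi> u \<gamma> x z" "p x = u z" using p by blast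
    then have zD: "z \<in> D" by (simp add: prox_point_def)
    then obtain i where i: "i \<in> I" "z \<in> halfspaces (H i)" using dom by blast
    define J where "J = {(a, \<beta>). (a, \<beta>) \<in> H i \<and> a \<bullet> z = \<beta>}"
    \<comment> \<open>Along directions that keep the active constraints tight, small steps both ways stay in the piece.\<close>
    have step: "\<exists>e>0. \<forall>t. 0 < t \<and> t \<le> e \<longrightarrow> z + t *\<^sub>R d \<in> halfspaces (H i)" if "d \<in> V J" for d
    proof -
      have "a \<bullet> d \<le> 0" if "(a, \<beta>) \<in> H i" "a \<bullet> z = \<beta>" for a \<beta>
        using \<open>d \<in> V J\<close> that by (auto simp: V_def J_def)
      then show ?thesis
        using halfspaces_step[OF finite_H[OF i(1)] i(2), of d] by (metis less_imp_le)
    qed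
    have neg: "- d \<in> V J" if "d \<in> V J" for d using that by (auto simp: V_def)
    have "psd i J" unfolding psd_def
    proof
      fix d assume d: "d \<in> V J"
      obtain e1 e2 where e: "e1 > 0" "\<And>t. 0 < t \<Longrightarrow> t \<le> e1 \<Longrightarrow> z + t *\<^sub>R d \<in> halfspaces (H i)"
        "e2 > 0" "\<And>t. 0 < t \<Longrightarrow> t \<le> e2 \<Longrightarrow> z + t *\<^sub>R (- d) \<in> halfspaces (H i)"
        using step[OF d] step[OF neg[OF d]] by metis
      define t where "t = min e1 e2"
      have t: "t > 0" "t \<le> e1" "t \<le> e2" using e by (auto simp: t_def)
      have in1: "z + t *\<^sub>R d \<in> halfspaces (H i)" and in2: "z + t *\<^sub>R (- d) \<in> halfspaces (H i)"
        using e t by auto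
      have "\<phi> ((1/2) *\<^sub>R (z + t *\<^sub>R d) + (1/2) *\<^sub>R (z + t *\<^sub>R (- d))) \<le>
          1/2 * \<phi> (z + t *\<^sub>R d) + 1/2 * \<phi> (z + t *\<^sub>R (- d))"
      proof -
        have cv: "\<forall>x\<in>D. \<forall>y\<in>D. \<forall>u\<ge>0. \<forall>v\<ge>0. u + v = 1 \<longrightarrow> \<phi> (u *\<^sub>R x + v *\<^sub>R y) \<le> u * \<phi> x + v * \<phi> y"
          using convex unfolding convex_on_def by (rule conjunct2)
        have mem: "z + t *\<^sub>R d \<in> D" "z + t *\<^sub>R (- d) \<in> D" using in1 in2 i(1) dom by blast+
        show ?thesis using cv[rule_format, OF mem, of "1/2" "1/2"] by simp
      qed
      moreover have "(1/2) *\<^sub>R (z + t *\<^sub>R d) + (1/2) *\<^sub>R (z + t *\<^sub>R (- d)) = z"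
        by (simp add: scaleR_add_right[symmetric] scaleR_2[symmetric])
      ultimately have "0 \<le> t\<^sup>2 * (d \<bullet> Q i d)"
        unfolding val_along_line[OF i in1] val_along_line[OF i in2]
        by (simp add: linear_neg[OF linear_Q[OF i(1)]] add_divide_distrib diff_divide_distrib mult.commute)
      then show "0 \<le> d \<bullet> Q i d" using t(1) by (simp add: zero_le_mult_iff)
    qed
    moreover have "(x, p x) \<in> R i J"
    proof -
      have ge: "0 \<le> \<gamma> * ((Q i z + l i) \<bullet> d) + (u z - x) \<bullet> L d" if d: "d \<in> V J" for d
      proof -
        obtain e where e: "e > 0" "\<And>t. 0 < t \<Longrightarrow> t \<le> e \<Longrightarrow> z + t *\<^sub>R d \<in> halfspaces (H i)"
          using step[OF d] by metis
        show ?thesis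
        proof (rule nonneg_of_small_steps[OF e(1)])
          fix t assume t: "0 < t" "t \<le> e"
          have mem: "z + t *\<^sub>R d \<in> halfspaces (H i)" by (rule e(2)[OF t])
          then have "z + t *\<^sub>R d \<in> D" using i(1) dom by blast
          then have "\<gamma> * \<phi> z + (x - u z) \<bullet> (u (z + t *\<^sub>R d) - u z) \<le> \<gamma> * \<phi> (z + t *\<^sub>R d)"
            using z(1) by (simp add: prox_point_def)
          moreover have "u (z + t *\<^sub>R d) - u z = t *\<^sub>R L d"
            by (simp add: u(2) linear_add[OF u(1)] linear_scale[OF u(1)])
          ultimately show "0 \<le> t * (\<gamma> * ((Q i z + l i) \<bullet> d) + (u z - x) \<bullet> L d) + t\<^sup>2 * (\<gamma> * (d \<bullet> Q i d / 2))"
            unfolding val_along_line[OF i mem] by (simp add: inner_diff_left algebra_simps)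
        qed
      qed
      have "\<gamma> * ((Q i z + l i) \<bullet> d) + (u z - x) \<bullet> L d = 0" if d: "d \<in> V J" for d
        using ge[OF d] ge[OF neg[OF d]] by (simp add: linear_neg[OF u(1)])
      then show ?thesis unfolding R_def J_def z(2) by auto
    qed
    ultimately have "p x = T i J x" using T(2) i(1) by blast
    moreover have "(i, J) \<in> (SIGMA i:I. Pow (H i))" using i(1) by (auto simp: J_def)
    ultimately show ?thesis by force
  qed
  moreover have "finite ((\<lambda>(i, J). T i J) ` (SIGMA i:I. Pow (H i)))"
    using finite_I finite_H by (intro finite_imageI finite_SigmaI) auto
  moreover have "\<forall>S\<in>(\<lambda>(i, J). T i J) ` (SIGMA i:I. Pow (H i)). affine_map S"
    using T(1) by auto
  ultimately show ?thesis unfolding affine_selection_def by blast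
qed

end

section \<open>Lagrange multipliers from exact penalties\<close>

lemma divide_succ_le_one: "0 \<le> x \<Longrightarrow> x / (x + 1) \<le> (1::real)"
  by (subst divide_le_eq_1_pos) auto

text \<open>Near \<open>zs\<close>, Hoffman's estimate moves a point of a piece through \<open>zs\<close> to a feasible one at a cost
  proportional to the constraint violation, and \<open>h\<close> changes by a multiple of that distance. Both
  sides scale along the segment from \<open>zs\<close>, so convexity makes the local inequality global.\<close>

lemma exact_penalty:
  fixes h :: "'a::euclidean_space \<Rightarrow> real" and M :: "'a \<Rightarrow> 'b::euclidean_space"
  assumes I: "finite I" and P: "\<And>i. i \<in> I \<Longrightarrow> polyhedron (P i)" and D: "D = (\<Union>i\<in>I. P i)"
    and conv: "convex_on D h"
    and lip: "\<And>i r. i \<in> I \<Longrightarrow> \<exists>L. L-lipschitz_on (P i \<inter> cball 0 r) h"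
    and M: "linear M" and zs: "zs \<in> D" "M zs = c"
    and min: "\<And>z. z \<in> D \<Longrightarrow> M z = c \<Longrightarrow> h zs \<le> h z"
  obtains N where "N \<ge> 0" "\<And>z. z \<in> D \<Longrightarrow> h zs \<le> h z + N * norm (M z - c)"
proof -
  obtain B where B: "B > 0" "\<And>x. norm (M x) \<le> B * norm x"
    using linear_bounded_pos[OF M] by blast
  have "\<exists>N\<ge>0. \<forall>z\<in>P i \<inter> ball zs 1. h zs \<le> h z + N * norm (M z - c)" if i: "i \<in> I" "zs \<in> P i" for i
  proof -
    obtain K where K: "K > 0" "\<And>x. x \<in> P i \<Longrightarrow> \<exists>y\<in>P i. M y = c \<and> norm (x - y) \<le> K * norm (M x - c)"
      using hoffman[OF P[OF i(1)] M i(2) zs(2)] by blast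
    \<comment> \<open>The radius bounds both \<open>z\<close> and the feasible point that the Hoffman estimate assigns to it.\<close>
    define r where "r = norm zs + 1 + K * B"
    obtain L where L: "L-lipschitz_on (P i \<inter> cball 0 r) h" using lip[OF i(1)] by blast
    have L0: "L \<ge> 0" using L by (rule lipschitz_on_nonneg)
    have "h zs \<le> h z + L * K * norm (M z - c)" if z: "z \<in> P i" "dist zs z < 1" for z
    proof -
      obtain s where s: "s \<in> P i" "M s = c" "norm (z - s) \<le> K * norm (M z - c)"
        using K(2)[OF z(1)] by blast
      have zz: "norm (z - zs) \<le> 1" using z(2) by (simp add: dist_norm norm_minus_commute)
      have "norm (M z - c) = norm (M (z - zs))" using zs(2) by (simp add: linear_diff[OF M])
      also have "\<dots> \<le> B * norm (z - zs)" by (rule B(2))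
      also have "\<dots> \<le> B * 1" using zz B(1) by (intro mult_left_mono) auto
      finally have "K * norm (M z - c) \<le> K * B" using K(1) by simp
      then have zs': "norm (z - s) \<le> K * B" using s(3) by linarith
      have nz: "norm z \<le> norm zs + 1" using zz norm_triangle_sub[of z zs] by simp
      have ns: "norm s \<le> r" using zs' nz norm_triangle_sub[of s z] by (simp add: r_def norm_minus_commute)
      have "norm z \<le> r" using nz K(1) B(1) by (simp add: r_def add_increasing2)
      then have "dist (h s) (h z) \<le> L * dist s z"
        using ns s(1) z(1) by (intro lipschitz_onD[OF L]) auto
      also have "\<dots> \<le> L * (K * norm (M z - c))"
        using s(3) L0 by (intro mult_left_mono) (simp_all add: dist_norm norm_minus_commute)
      finally have "h s \<le> h z + L * K * norm (M z - c)" by (simp add: dist_real_def abs_le_iff)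
      moreover have "h zs \<le> h s" by (rule min) (use s i(1) D in auto)
      ultimately show ?thesis by simp
    qed
    moreover have "L * K \<ge> 0" using L0 K(1) by simp
    ultimately show ?thesis by (intro exI[of _ "L * K"]) auto
  qed
  then have "\<exists>N. \<forall>i\<in>I. N i \<ge> 0 \<and> (zs \<in> P i \<longrightarrow> (\<forall>z\<in>P i \<inter> ball zs 1. h zs \<le> h z + N i * norm (M z - c)))"
    by (intro bchoice) (metis order_refl)
  then obtain N where N: "\<And>i. i \<in> I \<Longrightarrow> N i \<ge> 0"
    "\<And>i z. i \<in> I \<Longrightarrow> zs \<in> P i \<Longrightarrow> z \<in> P i \<inter> ball zs 1 \<Longrightarrow> h zs \<le> h z + N i * norm (M z - c)"
    by blast
  \<comment> \<open>Pieces that do not contain \<open>zs\<close> are closed and hence stay away from it.\<close>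
  define U where "U = (\<Union>i\<in>{i\<in>I. zs \<notin> P i}. P i)"
  have "closed U" unfolding U_def
    using I P polyhedron_imp_closed by (intro closed_UN) auto
  then have "open (- U)" by (rule open_Compl)
  moreover have "zs \<in> - U" by (simp add: U_def)
  ultimately obtain d where d: "d > 0" "ball zs d \<subseteq> - U" by (meson open_contains_ball)
  define e where "e = min 1 d"
  have e: "e > 0" "e \<le> 1" "e \<le> d" using d by (auto simp: e_def)
  have sumN: "sum N I \<ge> 0" using N(1) by (rule sum_nonneg)
  have loc: "h zs \<le> h z + sum N I * norm (M z - c)" if z: "z \<in> D" "dist zs z < e" for z
  proof -
    obtain i where i: "i \<in> I" "z \<in> P i" using z(1) D by blast
    have "z \<in> ball zs d" using z(2) e(3) by simp
    then have "z \<notin> U" using d(2) by blast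
    then have "zs \<in> P i" using i by (auto simp: U_def)
    then have "h zs \<le> h z + N i * norm (M z - c)" using N(2) i z(2) e by auto
    also have "\<dots> \<le> h z + sum N I * norm (M z - c)"
      using member_le_sum[OF i(1) _ I, of N] N(1) by (intro add_left_mono mult_right_mono) auto
    finally show ?thesis .
  qed
  show ?thesis
  proof (rule that[OF sumN])
    fix z assume z: "z \<in> D"
    \<comment> \<open>Short enough to bring the point on the segment within distance \<open>e\<close> of \<open>zs\<close>.\<close>
    define t where "t = min 1 (e / (2 * (norm (z - zs) + 1)))"
    have t: "0 < t" "t \<le> 1" using e by (auto simp: t_def intro!: divide_pos_pos add_nonneg_pos)
    define w where "w = (1 - t) *\<^sub>R zs + t *\<^sub>R z"
    have w: "w = zs + t *\<^sub>R (z - zs)" by (simp add: w_def algebra_simps)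
    have wD: "w \<in> D" "h w \<le> (1 - t) * h zs + t * h z"
      using conv z zs(1) t unfolding convex_on_def convex_def w_def by auto
    have "dist zs w = t * norm (z - zs)" using t by (simp add: w dist_norm)
    also have "\<dots> \<le> e / (2 * (norm (z - zs) + 1)) * norm (z - zs)"
      unfolding t_def by (intro mult_right_mono) auto
    also have "\<dots> = e / 2 * (norm (z - zs) / (norm (z - zs) + 1))" by simp
    also have "\<dots> \<le> e / 2 * 1" using e(1) by (intro mult_left_mono) (auto intro: divide_succ_le_one)
    also have "\<dots> < e" using e(1) by simp
    finally have "h zs \<le> h w + sum N I * norm (M w - c)" by (intro loc wD(1))
    moreover have "M w - c = t *\<^sub>R (M z - c)"
      unfolding w using zs(2) by (simp add: linear_add[OF M] linear_scale[OF M] linear_diff[OF M])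
    ultimately have "h zs \<le> (1 - t) * h zs + t * h z + sum N I * (t * norm (M z - c))"
      using wD(2) t by simp
    then have "t * h zs \<le> t * (h z + sum N I * norm (M z - c))" by (simp add: algebra_simps)
    then show "h zs \<le> h z + sum N I * norm (M z - c)" using t by simp
  qed
qed

text \<open>The set of attainable pairs of violation and cost is convex and, by the penalty inequality,
  disjoint from a downward cone. A separating hyperplane cannot be vertical because the cone contains
  a pair \<open>(w, r)\<close> for every violation \<open>w\<close>; its slope is the multiplier.\<close>

lemma multiplier_from_penalty:
  fixes h :: "'a::euclidean_space \<Rightarrow> real" and M :: "'a \<Rightarrow> 'b::euclidean_space"
  assumes conv: "convex_on D h" and M: "linear M" and zs: "zs \<in> D" "M zs = c"
    and N: "N \<ge> 0" "\<And>z. z \<in> D \<Longrightarrow> h zs \<le> h z + N * norm (M z - c)"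
  obtains v where "\<And>z. z \<in> D \<Longrightarrow> h zs \<le> h z + v \<bullet> (M z - c)"
proof -
  define K where "K = {(w, r). \<exists>z\<in>D. w = M z - c \<and> h z - h zs \<le> r}"
  define C where "C = {(w :: 'b, r). r < - (N * norm w)}"
  have "convex K" unfolding convex_def
  proof (intro ballI allI impI)
    fix p q and s t :: real assume "p \<in> K" "q \<in> K" and st: "0 \<le> s" "0 \<le> t" "s + t = 1"
    then obtain z1 r1 z2 r2 where 1: "p = (M z1 - c, r1)" "z1 \<in> D" "h z1 - h zs \<le> r1"
      and 2: "q = (M z2 - c, r2)" "z2 \<in> D" "h z2 - h zs \<le> r2"
      unfolding K_def by blast
    have "h (s *\<^sub>R z1 + t *\<^sub>R z2) \<le> s * h z1 + t * h z2" and zD: "s *\<^sub>R z1 + t *\<^sub>R z2 \<in> D"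
      using conv 1(2) 2(2) st unfolding convex_on_def convex_def by auto
    moreover have "s * (h z1 - h zs) + t * (h z2 - h zs) \<le> s * r1 + t * r2"
      using 1(3) 2(3) st by (intro add_mono mult_left_mono) auto
    moreover have "s * (h z1 - h zs) + t * (h z2 - h zs) = s * h z1 + t * h z2 - (s + t) * h zs"
      by (simp add: algebra_simps)
    ultimately have "h (s *\<^sub>R z1 + t *\<^sub>R z2) - h zs \<le> s * r1 + t * r2" using st(3) by simp
    moreover have "s *\<^sub>R (M z1 - c) + t *\<^sub>R (M z2 - c) = M (s *\<^sub>R z1 + t *\<^sub>R z2) - c"
    proof -
      have "s *\<^sub>R (M z1 - c) + t *\<^sub>R (M z2 - c) = M (s *\<^sub>R z1 + t *\<^sub>R z2) - (s + t) *\<^sub>R c"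
        unfolding linear_add[OF M] linear_scale[OF M] by (simp add: algebra_simps)
      then show ?thesis using st(3) by simp
    qed
    ultimately show "s *\<^sub>R p + t *\<^sub>R q \<in> K" unfolding K_def 1(1) 2(1) using zD by auto
  qed
  moreover have "convex C" unfolding convex_def
  proof (intro ballI allI impI)
    fix p q and s t :: real assume "p \<in> C" "q \<in> C" and st: "0 \<le> s" "0 \<le> t" "s + t = 1"
    then obtain w1 r1 w2 r2 where 1: "p = (w1, r1)" "r1 < - (N * norm w1)" and 2: "q = (w2, r2)" "r2 < - (N * norm w2)"
      unfolding C_def by blast
    have "N * norm (s *\<^sub>R w1 + t *\<^sub>R w2) \<le> N * (s * norm w1 + t * norm w2)"
      using N(1) st norm_triangle_ineq[of "s *\<^sub>R w1" "t *\<^sub>R w2"] by (intro mult_left_mono) auto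
    moreover have "s * r1 + t * r2 < s * (- (N * norm w1)) + t * (- (N * norm w2))"
    proof (cases "s = 0")
      case True
      then show ?thesis using st 2(2) by simp
    next
      case False
      then have "s * r1 < s * (- (N * norm w1))" using st 1(2) by (intro mult_strict_left_mono) auto
      moreover have "t * r2 \<le> t * (- (N * norm w2))" using st 2(2) by (intro mult_left_mono) auto
      ultimately show ?thesis by linarith
    qed
    ultimately show "s *\<^sub>R p + t *\<^sub>R q \<in> C" unfolding C_def 1(1) 2(1) by (simp add: algebra_simps)
  qed
  moreover have "(0, 0) \<in> K" using zs by (auto simp: K_def)
  moreover have "(0, - 1) \<in> C" by (simp add: C_def)
  moreover have "C \<inter> K = {}" using N(2) by (force simp: C_def K_def)
  ultimately obtain a \<beta> where a: "a \<noteq> 0" "\<And>p. p \<in> C \<Longrightarrow> a \<bullet> p \<le> \<beta>" "\<And>p. p \<in> K \<Longrightarrow> \<beta> \<le> a \<bullet> p"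
    using separating_hyperplane_sets[of C K] by blast
  obtain w \<tau> where aw: "a = (w, \<tau>)" by (cases a)
  have \<beta>0: "\<beta> \<le> 0" using a(3)[OF \<open>(0, 0) \<in> K\<close>] by (simp add: aw)
  have \<tau>0: "\<tau> \<ge> 0" using a(2)[OF \<open>(0, - 1) \<in> C\<close>] \<beta>0 by (simp add: aw)
  have \<tau>: "\<tau> > 0"
  proof (rule ccontr)
    assume "\<not> \<tau> > 0"
    then have "\<tau> = 0" using \<tau>0 by simp
    moreover have "(w, - (N * norm w) - 1) \<in> C" by (simp add: C_def)
    ultimately have "w \<bullet> w \<le> 0" using a(2) \<beta>0 unfolding aw by fastforce
    then have "w = 0" using inner_ge_zero[of w] by (metis antisym inner_eq_zero_iff)
    then show False using \<open>\<tau> = 0\<close> a(1) by (simp add: aw zero_prod_def)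
  qed
  have \<beta>: "\<beta> \<ge> 0"
  proof (rule ccontr)
    assume "\<not> \<beta> \<ge> 0"
    then have "(0, \<beta> / (2 * \<tau>)) \<in> C" using \<tau> by (simp add: C_def divide_neg_pos)
    from a(2)[OF this] have "\<beta> / 2 \<le> \<beta>" using \<tau> by (simp add: aw)
    then show False using \<open>\<not> \<beta> \<ge> 0\<close> by simp
  qed
  show ?thesis
  proof (rule that[of "w /\<^sub>R \<tau>"])
    fix z assume "z \<in> D"
    then have "(M z - c, h z - h zs) \<in> K" by (auto simp: K_def)
    from a(3)[OF this] \<beta> have "0 \<le> w \<bullet> (M z - c) + \<tau> * (h z - h zs)" by (simp add: aw)
    then have "0 \<le> (w \<bullet> (M z - c) + \<tau> * (h z - h zs)) / \<tau>" using \<tau> by simp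
    also have "\<dots> = (w /\<^sub>R \<tau>) \<bullet> (M z - c) + (h z - h zs)" using \<tau> by (simp add: field_simps)
    finally show "h zs \<le> h z + (w /\<^sub>R \<tau>) \<bullet> (M z - c)" by simp
  qed
qed

context convex_plq
begin

lemma lipschitz_on_piece:
  assumes i: "i \<in> I"
  shows "\<exists>L. L-lipschitz_on (halfspaces (H i) \<inter> cball 0 r) \<phi>"
proof -
  obtain B where B: "B > 0" "\<And>x. norm (Q i x) \<le> B * norm x"
    using linear_bounded_pos[OF linear_Q[OF i]] by blast
  have "(B * \<bar>r\<bar> + norm (l i))-lipschitz_on (halfspaces (H i) \<inter> cball 0 r) \<phi>"
  proof (rule lipschitz_onI)
    fix x y assume xy: "x \<in> halfspaces (H i) \<inter> cball 0 r" "y \<in> halfspaces (H i) \<inter> cball 0 r"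
    have QQ: "x \<bullet> Q i y = y \<bullet> Q i x" using sym_Q[OF i, of x y] by (simp add: inner_commute)
    have "\<phi> x - \<phi> y = ((1/2) *\<^sub>R Q i (x + y) + l i) \<bullet> (x - y)" 
      using val[OF i, of x] val[OF i, of y] xy QQ
      by (simp add: linear_add[OF linear_Q[OF i]] inner_commute algebra_simps)
    then have "dist (\<phi> x) (\<phi> y) \<le> norm ((1/2) *\<^sub>R Q i (x + y) + l i) * norm (x - y)"
      by (simp add: dist_real_def Cauchy_Schwarz_ineq2)
    also have "\<dots> \<le> (B * \<bar>r\<bar> + norm (l i)) * norm (x - y)"
    proof (intro mult_right_mono)
      have "norm (Q i (x + y)) \<le> B * norm (x + y)" by (rule B(2))
      also have "\<dots> \<le> B * (2 * \<bar>r\<bar>)"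
        using xy B(1) norm_triangle_ineq[of x y] by (intro mult_left_mono) auto
      finally have "norm ((1/2) *\<^sub>R Q i (x + y)) \<le> B * \<bar>r\<bar>" by simp
      then show "norm ((1/2) *\<^sub>R Q i (x + y) + l i) \<le> B * \<bar>r\<bar> + norm (l i)"
        using norm_triangle_ineq[of "(1/2) *\<^sub>R Q i (x + y)" "l i"] by linarith
    qed simp
    finally show "dist (\<phi> x) (\<phi> y) \<le> (B * \<bar>r\<bar> + norm (l i)) * dist x y" by (simp add: dist_norm)
  qed (use B(1) in simp)
  then show ?thesis by blast
qed

end

text \<open>Used for the objective \<open>\<phi> x + \<psi> y\<close> of the coupled problem on the product space.\<close>

lemma lipschitz_on_sum_of_coordinates:
  fixes f :: "'a::metric_space \<Rightarrow> real" and g :: "'b::metric_space \<Rightarrow> real"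
  assumes "L-lipschitz_on X f" "M-lipschitz_on Y g"
  shows "(L + M)-lipschitz_on (X \<times> Y) (\<lambda>(x, y). f x + g y)"
proof (rule lipschitz_onI)
  fix p q assume pq: "p \<in> X \<times> Y" "q \<in> X \<times> Y"
  have "dist (f (fst p)) (f (fst q)) \<le> L * dist (fst p) (fst q)"
    "dist (g (snd p)) (g (snd q)) \<le> M * dist (snd p) (snd q)"
    using pq by (auto intro: lipschitz_onD[OF assms(1)] lipschitz_onD[OF assms(2)])
  moreover have "L * dist (fst p) (fst q) \<le> L * dist p q" "M * dist (snd p) (snd q) \<le> M * dist p q"
    using dist_fst_le[of p q] dist_snd_le[of p q] lipschitz_on_nonneg[OF assms(1)] lipschitz_on_nonneg[OF assms(2)]
    by (auto intro!: mult_left_mono)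
  ultimately show "dist (case p of (x, y) \<Rightarrow> f x + g y) (case q of (x, y) \<Rightarrow> f x + g y) \<le> (L + M) * dist p q"
    by (auto simp: dist_real_def case_prod_unfold algebra_simps abs_le_iff)
qed (use lipschitz_on_nonneg[OF assms(1)] lipschitz_on_nonneg[OF assms(2)] in simp)

lemma polyhedron_Times:
  fixes S :: "'a::euclidean_space set" and T :: "'b::euclidean_space set"
  assumes "polyhedron S" "polyhedron T"
  shows "polyhedron (S \<times> T)"
proof -
  obtain G where G: "finite G" "S = halfspaces G" using polyhedron_imp_halfspaces[OF assms(1)] .
  obtain H where H: "finite H" "T = halfspaces H" using polyhedron_imp_halfspaces[OF assms(2)] .
  have "S \<times> T = halfspaces ((\<lambda>(a, b). ((a, 0), b)) ` G \<union> (\<lambda>(a, b). ((0, a), b)) ` H)"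
  proof (rule set_eqI)
    fix p :: "'a \<times> 'b"
    obtain x y where p: "p = (x, y)" by (cases p)
    show "p \<in> S \<times> T \<longleftrightarrow> p \<in> halfspaces ((\<lambda>(a, b). ((a, 0), b)) ` G \<union> (\<lambda>(a, b). ((0, a), b)) ` H)"
      unfolding G(2) H(2) p by (simp add: halfspaces_def ball_Un case_prod_unfold)
  qed
  then show ?thesis using polyhedron_halfspaces G(1) H(1) by (metis finite_UnI finite_imageI)
qed

text \<open>The coupled minimization of \<open>\<phi> x + \<psi> y\<close> subject to \<open>A x + B y = c\<close> has a multiplier, and one vector
  \<open>v\<close> serves both blocks: the inequality on the product space is restricted to \<open>y = ys\<close> and to
  \<open>x = xs\<close>.\<close>

lemma plq_multiplier:
  fixes A :: "'a::euclidean_space \<Rightarrow> 'c::euclidean_space" and B :: "'b::euclidean_space \<Rightarrow> 'c"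
  assumes f: "convex_plq Df \<phi> Jf Hf Qf lf bf" and g: "convex_plq Dg \<psi> Jg Hg Qg lg bg"
    and A: "linear A" and B: "linear B"
    and feas: "xs \<in> Df" "ys \<in> Dg" "A xs + B ys = c"
    and min: "\<And>x y. x \<in> Df \<Longrightarrow> y \<in> Dg \<Longrightarrow> A x + B y = c \<Longrightarrow> \<phi> xs + \<psi> ys \<le> \<phi> x + \<psi> y"
  obtains v where "\<And>x. x \<in> Df \<Longrightarrow> \<phi> xs \<le> \<phi> x + v \<bullet> (A x - A xs)"
    "\<And>y. y \<in> Dg \<Longrightarrow> \<psi> ys \<le> \<psi> y + v \<bullet> (B y - B ys)"
proof -
  interpret f: convex_plq Df \<phi> Jf Hf Qf lf bf by (rule f)
  interpret g: convex_plq Dg \<psi> Jg Hg Qg lg bg by (rule g)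
  define h where "h = (\<lambda>(x, y). \<phi> x + \<psi> y)"
  define M where "M = (\<lambda>(x, y). A x + B y)"
  define P where "P = (\<lambda>(i, j). halfspaces (Hf i) \<times> halfspaces (Hg j))"
  have linM: "linear M" unfolding M_def case_prod_unfold
    using linear_compose[OF linear_fst A] linear_compose[OF linear_snd B]
    by (intro linear_compose_add) (simp_all add: o_def)
  have conv: "convex_on (Df \<times> Dg) h"
    unfolding convex_on_def
  proof (intro conjI ballI allI impI)
    show "convex (Df \<times> Dg)" using f.convex g.convex by (auto simp: convex_on_def intro: convex_Times)
    fix p q and s t :: real assume pq: "p \<in> Df \<times> Dg" "q \<in> Df \<times> Dg" and st: "0 \<le> s" "0 \<le> t" "s + t = 1"
    have "\<phi> (s *\<^sub>R fst p + t *\<^sub>R fst q) \<le> s * \<phi> (fst p) + t * \<phi> (fst q)"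
      "\<psi> (s *\<^sub>R snd p + t *\<^sub>R snd q) \<le> s * \<psi> (snd p) + t * \<psi> (snd q)"
      using f.convex g.convex pq st unfolding convex_on_def by (auto simp: mem_Times_iff)
    then show "h (s *\<^sub>R p + t *\<^sub>R q) \<le> s * h p + t * h q"
      by (simp add: h_def case_prod_unfold algebra_simps)
  qed
  have fin: "finite (Jf \<times> Jg)" using f.finite_I g.finite_I by simp
  have poly: "polyhedron (P i)" if "i \<in> Jf \<times> Jg" for i
    using that f.finite_H g.finite_H unfolding P_def
    by (auto intro!: polyhedron_Times polyhedron_halfspaces)
  have dom: "Df \<times> Dg = (\<Union>i\<in>Jf \<times> Jg. P i)"
    unfolding f.dom g.dom P_def by auto
  have lip: "\<exists>L. L-lipschitz_on (P i \<inter> cball 0 r) h" if ij: "i \<in> Jf \<times> Jg" for i r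
  proof -
    obtain L1 where "L1-lipschitz_on (halfspaces (Hf (fst i)) \<inter> cball 0 r) \<phi>"
      using f.lipschitz_on_piece[of "fst i" r] ij by (auto simp: mem_Times_iff)
    moreover obtain L2 where "L2-lipschitz_on (halfspaces (Hg (snd i)) \<inter> cball 0 r) \<psi>"
      using g.lipschitz_on_piece[of "snd i" r] ij by (auto simp: mem_Times_iff)
    ultimately have *: "(L1 + L2)-lipschitz_on ((halfspaces (Hf (fst i)) \<inter> cball 0 r) \<times> (halfspaces (Hg (snd i)) \<inter> cball 0 r)) h"
      unfolding h_def by (rule lipschitz_on_sum_of_coordinates)
    have "P i \<inter> cball 0 r \<subseteq> (halfspaces (Hf (fst i)) \<inter> cball 0 r) \<times> (halfspaces (Hg (snd i)) \<inter> cball 0 r)"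
      by (auto simp: P_def case_prod_unfold intro: order_trans[OF norm_fst_le] order_trans[OF norm_snd_le])
    from lipschitz_on_subset[OF * this] show ?thesis by blast
  qed
  have zs: "(xs, ys) \<in> Df \<times> Dg" "M (xs, ys) = c" using feas by (auto simp: M_def)
  have hmin: "h (xs, ys) \<le> h z" if "z \<in> Df \<times> Dg" "M z = c" for z
    using min that by (auto simp: h_def M_def)
  obtain N where "N \<ge> 0" "\<And>z. z \<in> Df \<times> Dg \<Longrightarrow> h (xs, ys) \<le> h z + N * norm (M z - c)"
    using exact_penalty[OF fin poly dom conv lip linM zs hmin] by blast
  then obtain v where v: "\<And>z. z \<in> Df \<times> Dg \<Longrightarrow> h (xs, ys) \<le> h z + v \<bullet> (M z - c)"
    using multiplier_from_penalty[OF conv linM zs] by blast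
  show ?thesis
  proof (rule that)
    show "\<phi> xs \<le> \<phi> x + v \<bullet> (A x - A xs)" if "x \<in> Df" for x
      using v[of "(x, ys)"] that feas by (auto simp: h_def M_def)
    show "\<psi> ys \<le> \<psi> y + v \<bullet> (B y - B ys)" if "y \<in> Dg" for y
      using v[of "(xs, y)"] that feas by (auto simp: h_def M_def)
  qed
qed

section \<open>Gradients of differentiable convex piecewise linear-quadratic functions\<close>

lemma gderiv_directional:
  assumes "GDERIV \<phi> x :> G"
  shows "((\<lambda>t. (\<phi> (x + t *\<^sub>R d) - \<phi> x) / t) \<longlongrightarrow> d \<bullet> G) (at_right 0)"
proof -
  have "((\<lambda>t. x + t *\<^sub>R d) has_derivative (\<lambda>t. t *\<^sub>R d)) (at (0::real))"
    by (auto intro!: derivative_eq_intros)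
  moreover have "(\<phi> has_derivative (\<lambda>h. h \<bullet> G)) (at (x + 0 *\<^sub>R d))"
    using assms by (simp add: gderiv_def)
  ultimately have "((\<lambda>t. \<phi> (x + t *\<^sub>R d)) has_derivative (\<lambda>t. (t *\<^sub>R d) \<bullet> G)) (at 0)"
    by (rule has_derivative_compose)
  moreover have "(\<lambda>t. (t *\<^sub>R d) \<bullet> G) = (*) (d \<bullet> G)" by (simp add: fun_eq_iff)
  ultimately have "((\<lambda>t. \<phi> (x + t *\<^sub>R d)) has_field_derivative (d \<bullet> G)) (at 0)"
    by (simp add: has_field_derivative_def)
  then have "((\<lambda>t. (\<phi> (x + t *\<^sub>R d) - \<phi> x) / t) \<longlongrightarrow> d \<bullet> G) (at 0)"
    by (simp add: has_field_derivative_iff)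
  then show ?thesis by (rule filterlim_mono) (auto simp: at_le)
qed

lemma gderiv_unique:
  assumes "GDERIV \<phi> x :> G" "GDERIV \<phi> x :> G'"
  shows "G = G'"
proof -
  have "(G - G') \<bullet> G = (G - G') \<bullet> G'"
    by (rule tendsto_unique[OF _ gderiv_directional[OF assms(1)] gderiv_directional[OF assms(2)]]) simp
  then have "(G - G') \<bullet> (G - G') = 0" by (simp add: inner_diff_right)
  then show ?thesis by simp
qed

context convex_plq
begin

text \<open>Convexity bounds the difference quotients along the segment towards \<open>y\<close>.\<close>

lemma gradient_inequality:
  assumes G: "GDERIV \<phi> x :> G" and "x \<in> D" "y \<in> D"
  shows "\<phi> x + G \<bullet> (y - x) \<le> \<phi> y"
proof -
  have "(y - x) \<bullet> G \<le> \<phi> y - \<phi> x"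
  proof (rule tendsto_upperbound[OF gderiv_directional[OF G]])
    have "(\<phi> (x + t *\<^sub>R (y - x)) - \<phi> x) / t \<le> \<phi> y - \<phi> x" if "0 < t" "t < 1" for t
      using segment(2)[OF assms(2,3), of t] that by (simp add: field_simps)
    then show "\<forall>\<^sub>F t in at_right 0. (\<phi> (x + t *\<^sub>R (y - x)) - \<phi> x) / t \<le> \<phi> y - \<phi> x"
      unfolding eventually_at_right_field using zero_less_one by blast
  qed simp
  then show ?thesis by (simp add: inner_commute)
qed

text \<open>The points outside all full-dimensional pieces form an open set covered by finitely many convex
  sets without interior, hence an open null set.\<close>

lemma full_dimensional_pieces_cover:
  assumes "D = UNIV"
  shows "(\<Union>i\<in>{i\<in>I. interior (halfspaces (H i)) \<noteq> {}}. halfspaces (H i)) = UNIV" (is "?U = UNIV")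
proof -
  have cl: "closed (halfspaces (H i))" if "i \<in> I" for i
    using polyhedron_imp_closed[OF polyhedron_halfspaces[OF finite_H[OF that]]] .
  have "open (- ?U)"
    using finite_I cl by (intro open_Compl closed_UN) auto
  moreover have "negligible (- ?U)"
  proof (rule negligible_subset)
    have "negligible (halfspaces (H i))" if "i \<in> I" "interior (halfspaces (H i)) = {}" for i
      using negligible_convex_interior polyhedron_imp_convex[OF polyhedron_halfspaces[OF finite_H[OF that(1)]]] that(2)
      by blast
    then show "negligible (\<Union>i\<in>{i\<in>I. interior (halfspaces (H i)) = {}}. halfspaces (H i))"
      using finite_I by (intro negligible_Union) auto
    show "- ?U \<subseteq> (\<Union>i\<in>{i\<in>I. interior (halfspaces (H i)) = {}}. halfspaces (H i))"
    proof
      fix x assume "x \<in> - ?U"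
      moreover obtain i where "i \<in> I" "x \<in> halfspaces (H i)" using assms dom by blast
      ultimately show "x \<in> (\<Union>i\<in>{i\<in>I. interior (halfspaces (H i)) = {}}. halfspaces (H i))" by blast
    qed
  qed
  ultimately have "- ?U = {}" using open_not_negligible by blast
  then show ?thesis by blast
qed

text \<open>Differences \<open>y - x\<close> with \<open>y\<close> in a piece with interior points span the space, so the directional
  derivatives within the piece determine the gradient even if \<open>x\<close> lies on its boundary.\<close>

lemma gradient_on_piece:
  assumes G: "GDERIV \<phi> x :> G" and i: "i \<in> I" "x \<in> halfspaces (H i)"
    and int: "interior (halfspaces (H i)) \<noteq> {}"
  shows "G = Q i x + l i"
proof -
  let ?P = "halfspaces (H i)"
  have conv: "convex ?P"
    using polyhedron_imp_convex[OF polyhedron_halfspaces[OF finite_H[OF i(1)]]] .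
  have *: "(y - x) \<bullet> (G - (Q i x + l i)) = 0" if y: "y \<in> ?P" for y
  proof -
    define r where "r = (y - x) \<bullet> Q i (y - x) / 2"
    have "(\<phi> (x + t *\<^sub>R (y - x)) - \<phi> x) / t = (Q i x + l i) \<bullet> (y - x) + t * r" if t: "0 < t" "t < 1" for t
    proof -
      have "x + t *\<^sub>R (y - x) = (1 - t) *\<^sub>R x + t *\<^sub>R y" by (simp add: algebra_simps)
      then have "x + t *\<^sub>R (y - x) \<in> ?P" using conv i(2) y t by (auto simp: convex_def)
      then show ?thesis
        using val_along_line[OF i, of t "y - x"] t by (simp add: r_def power2_eq_square field_simps)
    qed
    then have ev: "\<forall>\<^sub>F t in at_right 0. (\<phi> (x + t *\<^sub>R (y - x)) - \<phi> x) / t = (Q i x + l i) \<bullet> (y - x) + t * r"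
      unfolding eventually_at_right_field using zero_less_one by blast
    have "((\<lambda>t. (Q i x + l i) \<bullet> (y - x) + t * r) \<longlongrightarrow> (Q i x + l i) \<bullet> (y - x) + 0 * r) (at_right 0)"
      by (intro tendsto_intros)
    then have "((\<lambda>t. (\<phi> (x + t *\<^sub>R (y - x)) - \<phi> x) / t) \<longlongrightarrow> (Q i x + l i) \<bullet> (y - x) + 0 * r) (at_right 0)"
      using tendsto_cong[OF ev] by simp
    from tendsto_unique[OF _ gderiv_directional[OF G] this]
    show ?thesis by (simp add: inner_diff_right inner_commute)
  qed
  obtain y e where ye: "e > 0" "ball y e \<subseteq> ?P"
    using int by (meson ex_in_conv mem_interior)
  define w where "w = G - (Q i x + l i)"
  define s where "s = e / (2 * (norm w + 1))"
  have s: "s > 0" using ye(1) by (auto simp: s_def intro!: divide_pos_pos add_nonneg_pos)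
  have "s * norm w < e"
  proof -
    have "s * norm w = e / 2 * (norm w / (norm w + 1))" by (simp add: s_def)
    also have "\<dots> \<le> e / 2 * 1" using ye(1) by (intro mult_left_mono) (auto intro: divide_succ_le_one)
    finally show ?thesis using ye(1) by simp
  qed
  then have "y + s *\<^sub>R w \<in> ?P" using ye s by (auto simp: dist_norm subset_iff)
  moreover have "y \<in> ?P" using ye by auto
  ultimately have "(y + s *\<^sub>R w - x) \<bullet> w = 0" "(y - x) \<bullet> w = 0" unfolding w_def by (auto intro: *)
  then have "s * (w \<bullet> w) = 0" by (simp add: inner_add_left inner_diff_left)
  then show ?thesis using s by (simp add: w_def)
qed

text \<open>Along a segment the gradient is Lipschitz on the preimage of each full-dimensional piece, and
  finitely many closed sets with a common Lipschitz constant combine on an interval.\<close>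

lemma gradient_properties:
  assumes D: "D = UNIV" and G: "\<And>x. GDERIV \<phi> x :> G x"
  shows "affine_selection G" and "\<exists>K>0. K-lipschitz_on UNIV G"
proof -
  define I0 where "I0 = {i\<in>I. interior (halfspaces (H i)) \<noteq> {}}"
  have cover: "(\<Union>i\<in>I0. halfspaces (H i)) = UNIV"
    unfolding I0_def by (rule full_dimensional_pieces_cover[OF D])
  have I0: "finite I0" "I0 \<subseteq> I" using finite_I by (auto simp: I0_def)
  have Gi: "G x = Q i x + l i" if "i \<in> I0" "x \<in> halfspaces (H i)" for i x
    using gradient_on_piece[OF G] that by (auto simp: I0_def)
  have "\<forall>x. \<exists>T\<in>(\<lambda>i x. Q i x + l i) ` I0. G x = T x"
  proof
    fix x
    obtain i where "i \<in> I0" "x \<in> halfspaces (H i)" using cover by blast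
    then show "\<exists>T\<in>(\<lambda>i x. Q i x + l i) ` I0. G x = T x" using Gi by auto
  qed
  moreover have "\<forall>T\<in>(\<lambda>i x. Q i x + l i) ` I0. affine_map T"
    using linear_Q I0(2) unfolding affine_map_def by blast
  ultimately show "affine_selection G"
    unfolding affine_selection_def using I0(1) by blast
  have "\<exists>B. \<forall>i\<in>I0. B i > 0 \<and> (\<forall>x. norm (Q i x) \<le> B i * norm x)"
    by (intro bchoice ballI) (meson I0(2) linear_Q linear_bounded_pos subsetD)
  then obtain B where B: "\<And>i. i \<in> I0 \<Longrightarrow> B i > 0" "\<And>i x. i \<in> I0 \<Longrightarrow> norm (Q i x) \<le> B i * norm x"
    by blast
  define K where "K = sum B I0 + 1"
  have K0: "sum B I0 \<ge> 0" using B(1) by (intro sum_nonneg) (auto intro: less_imp_le)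
  have BK: "B i \<le> K" if "i \<in> I0" for i
    using member_le_sum[OF that _ I0(1), of B] B(1) by (force simp: K_def)
  have "K-lipschitz_on UNIV G"
  proof (rule lipschitz_onI)
    fix x y :: 'a
    define g where "g t = G (x + t *\<^sub>R (y - x))" for t :: real
    define U where "U i = {t. x + t *\<^sub>R (y - x) \<in> halfspaces (H i)}" for i
    have "(K * norm (y - x))-lipschitz_on {0..1} g"
    proof (rule lipschitz_on_closed_Union[where I = I0 and U = U])
      fix i assume i: "i \<in> I0"
      show "(K * norm (y - x))-lipschitz_on (U i) g"
      proof (rule lipschitz_onI)
        fix s t assume st: "s \<in> U i" "t \<in> U i"
        have "g s - g t = Q i ((s - t) *\<^sub>R (y - x))"
          using Gi[OF i] st I0(2) i linear_Q[of i]
          by (auto simp: g_def U_def linear_diff[symmetric] scaleR_diff_left)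
        then have "dist (g s) (g t) \<le> B i * norm ((s - t) *\<^sub>R (y - x))"
          using B(2)[OF i] by (simp only: dist_norm)
        also have "\<dots> \<le> K * norm ((s - t) *\<^sub>R (y - x))"
          by (intro mult_right_mono BK[OF i]) simp
        finally show "dist (g s) (g t) \<le> K * norm (y - x) * dist s t"
          by (simp add: dist_real_def mult_ac)
      qed (use K0 in \<open>simp add: K_def\<close>)
      have "closed (halfspaces (H i))"
        using polyhedron_imp_closed[OF polyhedron_halfspaces[OF finite_H]] i I0(2) by blast
      then have "closed ((\<lambda>t. x + t *\<^sub>R (y - x)) -` halfspaces (H i))"
        by (intro continuous_closed_vimage) (auto intro!: continuous_intros)
      then show "closed (U i)" by (simp add: U_def vimage_def)
    qed (use I0(1) K0 cover in \<open>auto simp: K_def U_def\<close>)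
    from lipschitz_onD[OF this, of 0 1] show "dist (G x) (G y) \<le> K * dist x y"
      by (simp add: g_def dist_norm norm_minus_commute)
  qed (use K0 in \<open>simp add: K_def\<close>)
  then show "\<exists>K>0. K-lipschitz_on UNIV G" using K0 by (intro exI[of _ K]) (simp add: K_def)
qed

end

section \<open>The two splitting schemes\<close>

definition firmly_nonexpansive :: "('a::real_inner \<Rightarrow> 'a) \<Rightarrow> bool" where
  "firmly_nonexpansive p \<longleftrightarrow> (\<forall>x y. (norm (p x - p y))\<^sup>2 \<le> (x - y) \<bullet> (p x - p y))"

text \<open>The defining inequality says exactly that the reflection does not increase distances.\<close>

lemma firmly_nonexpansive_reflection:
  assumes "firmly_nonexpansive p"
  shows "norm ((2 *\<^sub>R p x - x) - (2 *\<^sub>R p y - y)) \<le> norm (x - y)"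
proof -
  have "(norm ((2 *\<^sub>R p x - x) - (2 *\<^sub>R p y - y)))\<^sup>2 =
      (norm (x - y))\<^sup>2 + 4 * ((norm (p x - p y))\<^sup>2 - (x - y) \<bullet> (p x - p y))"
    unfolding power2_norm_eq_inner by (simp add: inner_commute algebra_simps)
  also have "\<dots> \<le> (norm (x - y))\<^sup>2"
    using assms by (simp add: firmly_nonexpansive_def)
  finally show ?thesis by (rule power2_le_imp_le) simp
qed

lemma firmly_nonexpansive_continuous:
  assumes "firmly_nonexpansive p"
  shows "continuous_on X p"
proof -
  have "1-lipschitz_on X (\<lambda>x. 2 *\<^sub>R p x - x)"
    using firmly_nonexpansive_reflection[OF assms] by (intro lipschitz_onI) (simp_all add: dist_norm)
  then have "continuous_on X (\<lambda>x. (1/2) *\<^sub>R ((2 *\<^sub>R p x - x) + x))"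
    by (intro continuous_intros lipschitz_on_continuous_on)
  then show ?thesis by simp
qed

text \<open>The identity for the squared norm of a convex combination.\<close>

lemma averaged_fejer:
  fixes T :: "'a::real_inner \<Rightarrow> 'a"
  assumes T: "norm (T x - y) \<le> norm (x - y)" and \<alpha>: "0 < \<alpha>"
    and F: "Fx = (1 - \<alpha>) *\<^sub>R x + \<alpha> *\<^sub>R T x"
  shows "(norm (Fx - y))\<^sup>2 \<le> (norm (x - y))\<^sup>2 - (1 - \<alpha>) / \<alpha> * (norm (Fx - x))\<^sup>2"
proof -
  define a b where "a = x - y" and "b = T x - y"
  have Fa: "Fx - y = (1 - \<alpha>) *\<^sub>R a + \<alpha> *\<^sub>R b" "Fx - x = \<alpha> *\<^sub>R (b - a)"
    by (auto simp: F a_def b_def algebra_simps)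
  have "(norm (Fx - y))\<^sup>2 = (1 - \<alpha>) * (norm a)\<^sup>2 + \<alpha> * (norm b)\<^sup>2 - \<alpha> * (1 - \<alpha>) * (norm (b - a))\<^sup>2"
    unfolding Fa power2_norm_eq_inner by (simp add: inner_commute algebra_simps)
  moreover have "(1 - \<alpha>) / \<alpha> * (norm (Fx - x))\<^sup>2 = \<alpha> * (1 - \<alpha>) * (norm (b - a))\<^sup>2"
    using \<alpha> unfolding Fa by (simp add: power_mult_distrib power2_eq_square)
  moreover have "\<alpha> * (norm b)\<^sup>2 \<le> \<alpha> * (norm a)\<^sup>2"
    using T \<alpha> by (intro mult_left_mono power_mono) (auto simp: a_def b_def)
  ultimately show ?thesis by (simp add: a_def left_diff_distrib)
qed

text \<open>\<open>F\<close> averages the identity with the composition \<open>T\<close> of two nonexpansive reflections, and both have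
  the same fixed points.\<close>

theorem douglas_rachford_linear:
  fixes p1 p2 :: "'a::euclidean_space \<Rightarrow> 'a"
  assumes p1: "firmly_nonexpansive p1" "affine_selection p1"
    and p2: "firmly_nonexpansive p2" "affine_selection p2"
    and \<alpha>: "0 < \<alpha>" "\<alpha> < 1"
    and T: "\<And>x. T x = 2 *\<^sub>R p2 (2 *\<^sub>R p1 x - x) - (2 *\<^sub>R p1 x - x)"
    and F: "\<And>x. F x = (1 - \<alpha>) *\<^sub>R x + \<alpha> *\<^sub>R T x"
    and Tx1: "T x1 = x1"
  shows "error_bound F" and "\<exists>xs. T xs = xs \<and> xs \<in> fixed_points F \<and> converges_linearly (\<lambda>k. (F ^^ k) x0) xs"
proof -
  have fp: "x \<in> fixed_points F \<longleftrightarrow> T x = x" for x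
  proof -
    have "F x - x = \<alpha> *\<^sub>R (T x - x)" by (simp add: F algebra_simps)
    then show ?thesis using \<alpha>(1) by (auto simp: fixed_points_def)
  qed
  have T1: "norm (T x - T y) \<le> norm (x - y)" for x y
    unfolding T using firmly_nonexpansive_reflection[OF p2(1)] firmly_nonexpansive_reflection[OF p1(1)]
    by (meson order_trans)
  have "1-lipschitz_on UNIV T" using T1 by (intro lipschitz_onI) (simp_all add: dist_norm)
  then have Tc: "continuous_on UNIV T" by (rule lipschitz_on_continuous_on)
  have Feq: "F = (\<lambda>x. (1 - \<alpha>) *\<^sub>R x + \<alpha> *\<^sub>R T x)" using F by blast
  have cont: "continuous_on UNIV F" unfolding Feq by (intro continuous_intros Tc)
  have r1: "affine_selection (\<lambda>x. 2 *\<^sub>R p1 x - x)" and r2: "affine_selection (\<lambda>x. 2 *\<^sub>R p2 x - x)"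
    using affine_selection_combination[OF p1(2) affine_selection_id, of 2 "-1"]
      affine_selection_combination[OF p2(2) affine_selection_id, of 2 "-1"] by simp_all
  have Teq: "T = (\<lambda>x. 2 *\<^sub>R p2 (2 *\<^sub>R p1 x - x) - (2 *\<^sub>R p1 x - x))" using T by blast
  have "affine_selection T"
    unfolding Teq by (rule affine_selection_comp[OF r2 r1])
  then have "affine_selection F" unfolding Feq
    using affine_selection_combination[OF affine_selection_id] by blast
  with cont show eb: "error_bound F" by (rule error_bound_affine_selection)
  have "\<exists>xs\<in>fixed_points F. converges_linearly (\<lambda>k. (F ^^ k) x0) xs"
  proof (rule fejer_converges_linearly[OF cont _ _ _ eb])
    show "fixed_points F \<noteq> {}" using fp Tx1 by blast
    show "(1 - \<alpha>) / \<alpha> > 0" using \<alpha> by simp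
    show "(norm (F x - y))\<^sup>2 \<le> (norm (x - y))\<^sup>2 - (1 - \<alpha>) / \<alpha> * (norm (F x - x))\<^sup>2"
      if "y \<in> fixed_points F" for x y
      using T1[of x y] that by (intro averaged_fejer[of T, OF _ \<alpha>(1) F]) (simp add: fp)
  qed
  then show "\<exists>xs. T xs = xs \<and> xs \<in> fixed_points F \<and> converges_linearly (\<lambda>k. (F ^^ k) x0) xs"
    using fp by blast
qed

context convex_plq
begin

lemma prox_operator:
  fixes u :: "'a \<Rightarrow> 'b::euclidean_space"
  assumes u: "linear L" "u = (\<lambda>z. L z + c)" and \<gamma>: "\<gamma> > 0"
    and p: "\<And>x. \<exists>z. prox_point D \<phi> u \<gamma> x z \<and> p x = u z"
  shows "firmly_nonexpansive p" "affine_selection p"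
proof -
  show "firmly_nonexpansive p" unfolding firmly_nonexpansive_def
  proof (intro allI)
    fix x y
    obtain z w where "prox_point D \<phi> u \<gamma> x z" "p x = u z" "prox_point D \<phi> u \<gamma> y w" "p y = u w"
      using p by meson
    then show "(norm (p x - p y))\<^sup>2 \<le> (x - y) \<bullet> (p x - p y)"
      using prox_point_firmly_nonexpansive by metis
  qed
  show "affine_selection p" by (rule prox_point_affine_selection[OF u \<gamma> p])
qed

end

text \<open>A multiplier \<open>v\<close> at a solution gives affine minorants in \<open>u x\<close> and \<open>w y\<close>, hence the existence of
  all proximal points, and the solution itself appears as a pair of proximal points: that of
  \<open>u xs - \<gamma> v\<close> for the first function and that of the reflected point \<open>u xs + \<gamma> v\<close> for the second. So
  \<open>u xs - \<gamma> v\<close> is a fixed point of the composed reflections.\<close>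

lemma splitting_prox_points:
  fixes u :: "'a::euclidean_space \<Rightarrow> 'c::euclidean_space" and w :: "'b::euclidean_space \<Rightarrow> 'c"
  assumes f: "convex_plq Df \<phi> Jf Hf Qf lf bf" and g: "convex_plq Dg \<psi> Jg Hg Qg lg bg"
    and u: "linear A" "u = (\<lambda>z. A z + c)" and w: "linear B" "w = (\<lambda>z. B z + d)"
    and sol: "xs \<in> Df" "ys \<in> Dg" "u xs = w ys"
    and min: "\<And>x y. x \<in> Df \<Longrightarrow> y \<in> Dg \<Longrightarrow> u x = w y \<Longrightarrow> \<phi> xs + \<psi> ys \<le> \<phi> x + \<psi> y"
    and \<gamma>: "\<gamma> > 0"
  shows "\<exists>z. prox_point Df \<phi> u \<gamma> x z" and "\<exists>z. prox_point Dg \<psi> w \<gamma> x z"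
    and "\<exists>x1. prox_point Df \<phi> u \<gamma> x1 xs \<and> prox_point Dg \<psi> w \<gamma> (2 *\<^sub>R u xs - x1) ys"
proof -
  have nB: "linear (\<lambda>y. - B y)" using w(1) by (rule linear_compose_neg)
  have feas: "A xs + - B ys = d - c" using sol(3) by (simp add: u w algebra_simps)
  have min': "\<phi> xs + \<psi> ys \<le> \<phi> x + \<psi> y" if "x \<in> Df" "y \<in> Dg" "A x + - B y = d - c" for x y
    using min[OF that(1,2)] that(3) by (simp add: u w algebra_simps)
  obtain v where v: "\<And>x. x \<in> Df \<Longrightarrow> \<phi> xs \<le> \<phi> x + v \<bullet> (A x - A xs)"
    "\<And>y. y \<in> Dg \<Longrightarrow> \<psi> ys \<le> \<psi> y + v \<bullet> (- B y - - B ys)"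
    using plq_multiplier[OF f g u(1) nB sol(1,2) feas min'] by blast
  have vf: "\<phi> xs \<le> \<phi> x + v \<bullet> (u x - u xs)" if "x \<in> Df" for x using v(1)[OF that] by (simp add: u)
  have vg: "\<psi> ys \<le> \<psi> y - v \<bullet> (w y - w ys)" if "y \<in> Dg" for y
    using v(2)[OF that] by (simp add: w inner_diff_right)
  show "\<exists>z. prox_point Df \<phi> u \<gamma> x z"
    by (rule convex_plq.prox_point_exists[OF f u \<gamma>, where v = "- v" and \<beta> = "\<phi> xs + v \<bullet> u xs"])
       (use vf in \<open>force simp: inner_diff_right\<close>)
  show "\<exists>z. prox_point Dg \<psi> w \<gamma> x z"
    by (rule convex_plq.prox_point_exists[OF g w \<gamma>, where v = v and \<beta> = "\<psi> ys - v \<bullet> w ys"])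
       (use vg in \<open>force simp: inner_diff_right\<close>)
  \<comment> \<open>The point \<open>u xs\<close> shifted by the scaled multiplier has proximal point \<open>u xs\<close>.\<close>
  have "prox_point Df \<phi> u \<gamma> (u xs - \<gamma> *\<^sub>R v) xs"
    unfolding prox_point_def
  proof (intro conjI ballI sol(1))
    fix z assume "z \<in> Df"
    then have "\<gamma> * \<phi> xs \<le> \<gamma> * (\<phi> z + v \<bullet> (u z - u xs))" using vf \<gamma> by (intro mult_left_mono) auto
    then show "\<gamma> * \<phi> xs + (u xs - \<gamma> *\<^sub>R v - u xs) \<bullet> (u z - u xs) \<le> \<gamma> * \<phi> z"
      by (simp add: algebra_simps)
  qed
  moreover have "prox_point Dg \<psi> w \<gamma> (2 *\<^sub>R u xs - (u xs - \<gamma> *\<^sub>R v)) ys"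
    unfolding prox_point_def
  proof (intro conjI ballI sol(2))
    fix z assume "z \<in> Dg"
    then have "\<gamma> * \<psi> ys \<le> \<gamma> * (\<psi> z - v \<bullet> (w z - w ys))" using vg \<gamma> by (intro mult_left_mono) auto
    then show "\<gamma> * \<psi> ys + (2 *\<^sub>R u xs - (u xs - \<gamma> *\<^sub>R v) - w ys) \<bullet> (w z - w ys) \<le> \<gamma> * \<psi> z"
      unfolding sol(3) by (simp add: scaleR_2 algebra_simps)
  qed
  ultimately show "\<exists>x1. prox_point Df \<phi> u \<gamma> x1 xs \<and> prox_point Dg \<psi> w \<gamma> (2 *\<^sub>R u xs - x1) ys"
    by blast
qed

text \<open>At a fixed point the two subgradients are opposite, so adding the variational inequalities
  cancels the linear terms on feasible pairs.\<close>

lemma prox_points_imp_minimal: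
  assumes \<gamma>: "\<gamma> > 0"
    and z: "prox_point Df \<phi> u \<gamma> x z" and y: "prox_point Dg \<psi> w \<gamma> (2 *\<^sub>R u z - x) y"
    and eq: "w y = u z"
    and feas: "z' \<in> Df" "y' \<in> Dg" "u z' = w y'"
  shows "\<phi> z + \<psi> y \<le> \<phi> z' + \<psi> y'"
proof -
  have "\<gamma> * \<phi> z + (x - u z) \<bullet> (u z' - u z) \<le> \<gamma> * \<phi> z'"
    using z feas(1) unfolding prox_point_def by blast
  moreover have "\<gamma> * \<psi> y + (2 *\<^sub>R u z - x - w y) \<bullet> (w y' - w y) \<le> \<gamma> * \<psi> y'"
    using y feas(2) unfolding prox_point_def by blast
  moreover have "2 *\<^sub>R u z - x - w y = - (x - u z)" by (simp add: eq scaleR_2)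
  ultimately have "\<gamma> * (\<phi> z + \<psi> y) \<le> \<gamma> * (\<phi> z' + \<psi> y')"
    by (simp add: eq feas(3) algebra_simps)
  then show ?thesis using \<gamma> by simp
qed

text \<open>The negative gradient of the smooth part is a subgradient of the other part at a minimizer. In
  particular the nonsmooth part has an affine minorant.\<close>

lemma composite_minimizer_first_order:
  assumes g: "convex_plq D \<psi> J H Q l b" and G: "GDERIV \<phi> z :> G"
    and z: "z \<in> D" "\<And>y. y \<in> D \<Longrightarrow> \<phi> z + \<psi> z \<le> \<phi> y + \<psi> y" and y: "y \<in> D"
  shows "\<psi> z - G \<bullet> (y - z) \<le> \<psi> y"
proof -
  interpret g: convex_plq D \<psi> J H Q l b by (rule g)
  have "\<psi> z - \<psi> y \<le> (y - z) \<bullet> G"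
  proof (rule tendsto_lowerbound[OF gderiv_directional[OF G]])
    have "\<psi> z - \<psi> y \<le> (\<phi> (z + t *\<^sub>R (y - z)) - \<phi> z) / t" if t: "0 < t" "t < 1" for t
    proof -
      have "\<phi> z + \<psi> z \<le> \<phi> (z + t *\<^sub>R (y - z)) + \<psi> (z + t *\<^sub>R (y - z))"
        by (rule z(2)[OF g.segment(1)[OF z(1) y]]) (use t in auto)
      also have "\<psi> (z + t *\<^sub>R (y - z)) \<le> \<psi> z + t * (\<psi> y - \<psi> z)"
        by (rule g.segment(2)[OF z(1) y]) (use t in auto)
      finally show ?thesis using t by (simp add: field_simps)
    qed
    then show "\<forall>\<^sub>F t in at_right 0. \<psi> z - \<psi> y \<le> (\<phi> (z + t *\<^sub>R (y - z)) - \<phi> z) / t"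
      unfolding eventually_at_right_field using zero_less_one by blast
  qed simp
  then show ?thesis by (simp add: inner_commute)
qed

text \<open>The Fejer inequality results from adding three inequalities at \<open>z = F x\<close>: the gradient inequality
  from \<open>x\<close> to the minimizer \<open>y\<close>, the one from \<open>z\<close> back to \<open>x\<close>, and the variational inequality of the
  proximal step. The second replaces the descent lemma, at the price of \<open>K\<close> in place of \<open>K / 2\<close> in the
  step-size condition.\<close>

theorem forward_backward_linear:
  fixes G p :: "'a::euclidean_space \<Rightarrow> 'a"
  assumes f: "convex_plq UNIV \<phi> Jf Hf Qf lf bf" and g: "convex_plq D \<psi> Jg Hg Qg lg bg"
    and G: "\<And>x. GDERIV \<phi> x :> G x" and K: "K-lipschitz_on UNIV G"
    and sol: "xs \<in> D" "\<And>y. y \<in> D \<Longrightarrow> \<phi> xs + \<psi> xs \<le> \<phi> y + \<psi> y"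
    and s: "s > 0" "2 * s * K < 1"
    and p: "\<And>x. prox_point D \<psi> (\<lambda>z. z) s x (p x)"
    and F: "\<And>x. F x = p (x - s *\<^sub>R G x)"
  shows "error_bound F"
    and "linear_convergence F (\<lambda>z. z \<in> D \<and> (\<forall>y\<in>D. \<phi> z + \<psi> z \<le> \<phi> y + \<psi> y))"
proof -
  interpret f: convex_plq UNIV \<phi> Jf Hf Qf lf bf by (rule f)
  interpret g: convex_plq D \<psi> Jg Hg Qg lg bg by (rule g)
  have Feq: "F = (\<lambda>x. p (1 *\<^sub>R x + (- s) *\<^sub>R G x))" by (simp add: F fun_eq_iff)
  have lin: "linear (\<lambda>z::'a. z)" by (rule linear_id[unfolded id_def])
  have pp: "firmly_nonexpansive p" "affine_selection p"
    by (rule g.prox_operator[OF lin _ s(1), where u = "\<lambda>z. z" and c = 0]; use p in auto)+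
  have "continuous_on UNIV (\<lambda>x. 1 *\<^sub>R x + (- s) *\<^sub>R G x)"
    by (intro continuous_intros lipschitz_on_continuous_on[OF K])
  then have cont: "continuous_on UNIV F"
    unfolding Feq by (rule continuous_on_compose2[OF firmly_nonexpansive_continuous[OF pp(1), of UNIV]]) auto
  have "affine_selection F"
    unfolding Feq using f.gradient_properties(1)[OF refl G]
    by (intro affine_selection_comp[OF pp(2)] affine_selection_combination affine_selection_id)
  with cont show eb: "error_bound F" by (rule error_bound_affine_selection)
  have opt: "z \<in> fixed_points F \<longleftrightarrow> z \<in> D \<and> (\<forall>y\<in>D. \<phi> z + \<psi> z \<le> \<phi> y + \<psi> y)" for z
  proof
    assume "z \<in> fixed_points F"
    then have "p (z - s *\<^sub>R G z) = z" by (simp add: fixed_points_def F)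
    then have z: "prox_point D \<psi> (\<lambda>z. z) s (z - s *\<^sub>R G z) z" using p by metis
    then have "z \<in> D" by (simp add: prox_point_def)
    moreover have "\<phi> z + \<psi> z \<le> \<phi> y + \<psi> y" if "y \<in> D" for y
    proof -
      have "s * \<psi> z + (z - s *\<^sub>R G z - z) \<bullet> (y - z) \<le> s * \<psi> y"
        using z that by (simp add: prox_point_def)
      then have "s * (\<psi> z - G z \<bullet> (y - z)) \<le> s * \<psi> y" by (simp add: algebra_simps)
      then have "\<psi> z - G z \<bullet> (y - z) \<le> \<psi> y" using s(1) by simp
      then show ?thesis using f.gradient_inequality[OF G, of z y] by simp
    qed
    ultimately show "z \<in> D \<and> (\<forall>y\<in>D. \<phi> z + \<psi> z \<le> \<phi> y + \<psi> y)" by blast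
  next
    assume z: "z \<in> D \<and> (\<forall>y\<in>D. \<phi> z + \<psi> z \<le> \<phi> y + \<psi> y)"
    have "prox_point D \<psi> (\<lambda>z. z) s (z - s *\<^sub>R G z) z"
      unfolding prox_point_def
    proof (intro conjI ballI)
      fix y assume "y \<in> D"
      then have "\<psi> z - G z \<bullet> (y - z) \<le> \<psi> y"
        using composite_minimizer_first_order[OF g G, of z y] z by blast
      then have "s * (\<psi> z - G z \<bullet> (y - z)) \<le> s * \<psi> y" using s(1) by (intro mult_left_mono) auto
      then show "s * \<psi> z + (z - s *\<^sub>R G z - z) \<bullet> (y - z) \<le> s * \<psi> y" by (simp add: algebra_simps)
    qed (use z in blast)
    from prox_point_unique[OF this p] show "z \<in> fixed_points F" by (simp add: fixed_points_def F)
  qed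
  have "\<exists>xs\<in>fixed_points F. converges_linearly (\<lambda>k. (F ^^ k) x0) xs" for x0
  proof (rule fejer_converges_linearly[OF cont _ _ _ eb])
    show "fixed_points F \<noteq> {}" using opt sol by blast
    show "1 - 2 * s * K > 0" using s(2) by simp
    fix x y assume "y \<in> fixed_points F"
    then have y: "y \<in> D" "\<And>z. z \<in> D \<Longrightarrow> \<phi> y + \<psi> y \<le> \<phi> z + \<psi> z" using opt by auto
    define z where "z = F x"
    have z: "z \<in> D" "s * \<psi> z + (x - s *\<^sub>R G x - z) \<bullet> (y - z) \<le> s * \<psi> y"
      using p[of "x - s *\<^sub>R G x"] y(1) by (auto simp: z_def F prox_point_def)
    have 1: "\<phi> x + G x \<bullet> (y - x) \<le> \<phi> y" and 2: "\<phi> z + G z \<bullet> (x - z) \<le> \<phi> x"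
      using f.gradient_inequality[OF G] by auto
    have "(G z - G x) \<bullet> (z - x) \<le> norm (G z - G x) * norm (z - x)" by (rule norm_cauchy_schwarz)
    also have "\<dots> \<le> (K * norm (z - x)) * norm (z - x)"
      using lipschitz_onD[OF K, of z x] by (intro mult_right_mono) (simp_all add: dist_norm)
    finally have 3: "(G z - G x) \<bullet> (z - x) \<le> K * (norm (z - x))\<^sup>2" by (simp add: power2_eq_square)
    \<comment> \<open>The two gradient inequalities combined; \<open>G z\<close> enters only through the Lipschitz estimate.\<close>
    have "\<phi> y - \<phi> z \<ge> G x \<bullet> (y - z) - (G z - G x) \<bullet> (z - x)"
      using 1 2 by (simp add: algebra_simps)
    then have "\<phi> y - \<phi> z \<ge> G x \<bullet> (y - z) - K * (norm (z - x))\<^sup>2" using 3 by linarith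
    then have "\<psi> z - \<psi> y \<ge> G x \<bullet> (y - z) - K * (norm (z - x))\<^sup>2" using y(2)[OF z(1)] by linarith
    then have "s * (\<psi> z - \<psi> y) \<ge> s * (G x \<bullet> (y - z) - K * (norm (z - x))\<^sup>2)"
      using s(1) by (intro mult_left_mono) auto
    then have "(x - z) \<bullet> (y - z) \<le> s * K * (norm (z - x))\<^sup>2"
      using z(2) by (simp add: algebra_simps)
    moreover have "2 * ((x - z) \<bullet> (y - z)) = (norm (z - x))\<^sup>2 + (norm (z - y))\<^sup>2 - (norm (x - y))\<^sup>2"
      unfolding power2_norm_eq_inner by (simp add: inner_commute algebra_simps)
    ultimately show "(norm (F x - y))\<^sup>2 \<le> (norm (x - y))\<^sup>2 - (1 - 2 * s * K) * (norm (F x - x))\<^sup>2"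
      unfolding z_def[symmetric] by (simp add: left_diff_distrib)
  qed
  then show "linear_convergence F (\<lambda>z. z \<in> D \<and> (\<forall>y\<in>D. \<phi> z + \<psi> z \<le> \<phi> y + \<psi> y))"
    unfolding linear_convergence_def using opt by blast
qed

section \<open>Extended-real-valued functions\<close>

lemma proper_fun_eff_dom:
  assumes "proper_fun f" "x \<in> eff_dom f"
  shows "f x = ereal (real_of_ereal (f x))"
  using assms by (cases "f x") (auto simp: proper_fun_def eff_dom_def)

lemma not_eff_dom: "x \<notin> eff_dom f \<Longrightarrow> f x = \<infinity>"
  by (simp add: eff_dom_def)

lemma differentiable_fun_eff_dom:
  assumes "differentiable_fun f"
  shows "eff_dom f = UNIV"
proof -
  have "f x < \<infinity>" for x
  proof -
    have "\<bar>f x\<bar> \<noteq> \<infinity>" using assms by (simp add: differentiable_fun_def)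
    then show ?thesis by (cases "f x") auto
  qed
  then show ?thesis by (auto simp: eff_dom_def)
qed

text \<open>Convexity of the epigraph becomes convexity of the finite values on the effective domain.\<close>

lemma PLQ_imp_convex_plq:
  fixes f :: "real^'n \<Rightarrow> ereal"
  assumes pr: "proper_fun f" and conv: "convex_fun f" and plq: "PLQ f"
  shows "\<exists>I H Q l b. convex_plq (eff_dom f) (\<lambda>x. real_of_ereal (f x)) I H Q l b"
proof -
  obtain k P Q q b where raw: "(\<forall>i\<in>{1..k::nat}. polyhedron (P i) \<and> transpose (Q i) = Q i) \<and>
    eff_dom f = (\<Union>i\<in>{1..k}. P i) \<and>
    (\<forall>i\<in>{1..k}. \<forall>x\<in>P i. f x = ereal (1/2 * (x \<bullet> (Q i *v x)) + q i \<bullet> x + b i))"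
    using plq unfolding PLQ_def by (elim exE) (rule that)
  note * = raw[THEN conjunct1] raw[THEN conjunct2, THEN conjunct1] raw[THEN conjunct2, THEN conjunct2]
  have "\<forall>i\<in>{1..k}. \<exists>H. finite H \<and> P i = halfspaces H"
    using *(1) polyhedron_imp_halfspaces by metis
  then obtain H where H: "\<And>i. i \<in> {1..k} \<Longrightarrow> finite (H i) \<and> P i = halfspaces (H i)" by metis
  have "convex_plq (eff_dom f) (\<lambda>x. real_of_ereal (f x)) {1..k} H (\<lambda>i x. Q i *v x) q b"
  proof (rule convex_plq.intro)
    show "x \<bullet> (Q i *v y) = (Q i *v x) \<bullet> y" if "i \<in> {1..k}" for i x y
    proof -
      have "x \<bullet> (Q i *v y) = (x v* Q i) \<bullet> y" by (rule dot_lmul_matrix[symmetric])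
      also have "x v* Q i = transpose (Q i) *v x" by (rule transpose_matrix_vector[symmetric])
      also have "transpose (Q i) = Q i" using *(1) that by blast
      finally show ?thesis .
    qed
    show "linear ((*v) (Q i))" if "i \<in> {1..k}" for i by (rule matrix_vector_mul_linear)
    show "eff_dom f = (\<Union>i\<in>{1..k}. halfspaces (H i))" unfolding *(2) using H by auto
    show "real_of_ereal (f x) = 1/2 * (x \<bullet> (Q i *v x)) + q i \<bullet> x + b i"
      if "i \<in> {1..k}" "x \<in> halfspaces (H i)" for i x
      using *(3) that H[OF that(1)] by (metis real_of_ereal.simps(1))
    show "eff_dom f \<noteq> {}" using pr by (auto simp: proper_fun_def eff_dom_def)
    show "convex_on (eff_dom f) (\<lambda>x. real_of_ereal (f x))"
    proof -
      have key: "f (s *\<^sub>R x + t *\<^sub>R y) \<le> ereal (s * real_of_ereal (f x) + t * real_of_ereal (f y))"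
        if xy: "x \<in> eff_dom f" "y \<in> eff_dom f" and st: "0 \<le> s" "0 \<le> t" "s + t = 1" for x y s t
      proof -
        have "(x, real_of_ereal (f x)) \<in> epi f" "(y, real_of_ereal (f y)) \<in> epi f"
          using proper_fun_eff_dom[OF pr] xy by (simp_all add: epi_def)
        then have "s *\<^sub>R (x, real_of_ereal (f x)) + t *\<^sub>R (y, real_of_ereal (f y)) \<in> epi f"
          using conv st unfolding convex_fun_def convex_def by blast
        then show ?thesis by (simp add: epi_def)
      qed
      have dom: "s *\<^sub>R x + t *\<^sub>R y \<in> eff_dom f"
        if xy: "x \<in> eff_dom f" "y \<in> eff_dom f" and st: "0 \<le> s" "0 \<le> t" "s + t = 1" for x y s t
      proof -
        note key[OF that]
        also have "ereal (s * real_of_ereal (f x) + t * real_of_ereal (f y)) < \<infinity>" by simp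
        finally show ?thesis by (simp add: eff_dom_def)
      qed
      show ?thesis unfolding convex_on_def convex_def
      proof (intro conjI ballI allI impI)
        fix x y and s t :: real
        assume a: "x \<in> eff_dom f" "y \<in> eff_dom f" "0 \<le> s" "0 \<le> t" "s + t = 1"
        show "s *\<^sub>R x + t *\<^sub>R y \<in> eff_dom f" by (rule dom[OF a])
        have "ereal (real_of_ereal (f (s *\<^sub>R x + t *\<^sub>R y))) \<le> ereal (s * real_of_ereal (f x) + t * real_of_ereal (f y))"
          using key[OF a] proper_fun_eff_dom[OF pr dom[OF a]] by simp
        then show "real_of_ereal (f (s *\<^sub>R x + t *\<^sub>R y)) \<le> s * real_of_ereal (f x) + t * real_of_ereal (f y)"
          by simp
      qed
    qed
  qed (use H in auto)
  then show ?thesis by blast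
qed

lemma convex_plq_indicator:
  assumes "polyhedron S" "S \<noteq> {}"
  shows "\<exists>I H Q l b. convex_plq S (\<lambda>x. 0) I H Q l b"
proof -
  obtain H where H: "finite H" "S = halfspaces H" using polyhedron_imp_halfspaces[OF assms(1)] .
  have "convex_plq S (\<lambda>x. 0) {0} (\<lambda>i. H) (\<lambda>i x. 0) (\<lambda>i. 0) (\<lambda>i. 0)"
    by standard (use H assms polyhedron_imp_convex[OF assms(1)] in \<open>auto simp: linear_zero convex_on_def\<close>)
  then show ?thesis by blast
qed

text \<open>The variational inequality gives the growth \<open>\<parallel>w - u z\<parallel>\<^sup>2 / 2\<close> of the proximal objective of the partial
  minimum above its value at \<open>u z\<close>. This holds for the infimum even at points \<open>w\<close> where it is not
  attained, and it makes the minimizer unique. Attainment at \<open>w = u z\<close> is part of the conclusion.\<close>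

lemma prox_of_image_function:
  fixes f :: "'a \<Rightarrow> ereal" and u :: "'a \<Rightarrow> 'b::real_inner"
  assumes pr: "proper_fun f" and \<gamma>: "\<gamma> > 0"
    and z: "prox_point (eff_dom f) (\<lambda>x. real_of_ereal (f x)) u \<gamma> x z"
  shows "prox \<gamma> (\<lambda>w. INF z\<in>{z. u z = w}. f z) x = u z"
    and "z \<in> argmin_on f {z'. u z' = u z}"
proof -
  define \<phi> where "\<phi> x = real_of_ereal (f x)" for x
  define h where "h w = (INF z\<in>{z. u z = w}. f z)" for w
  define obj where "obj w = ereal \<gamma> * h w + ereal (1/2 * (norm (w - x))\<^sup>2)" for w
  have zD: "z \<in> eff_dom f" and zp: "\<And>z'. z' \<in> eff_dom f \<Longrightarrow> \<gamma> * \<phi> z + (x - u z) \<bullet> (u z' - u z) \<le> \<gamma> * \<phi> z'"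
    using z by (auto simp: prox_point_def \<phi>_def)
  have fin: "f y = ereal (\<phi> y)" if "y \<in> eff_dom f" for y
    using proper_fun_eff_dom[OF pr that] by (simp add: \<phi>_def)
  define val where "val = \<gamma> * \<phi> z + 1/2 * (norm (u z - x))\<^sup>2"
  have lower: "obj w \<ge> ereal (val + 1/2 * (norm (w - u z))\<^sup>2)" for w
  proof -
    define m where "m = (\<gamma> * \<phi> z + (x - u z) \<bullet> (w - u z)) / \<gamma>"
    have "ereal m \<le> h w" unfolding h_def
    proof (rule INF_greatest)
      fix y assume "y \<in> {z. u z = w}"
      then have y: "u y = w" by simp
      show "ereal m \<le> f y"
      proof (cases "y \<in> eff_dom f")
        case True
        then have "m \<le> \<phi> y" using zp[OF True] \<gamma> by (simp add: m_def y field_simps)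
        then show ?thesis using fin[OF True] by simp
      qed (simp add: not_eff_dom)
    qed
    then have "ereal \<gamma> * ereal m \<le> ereal \<gamma> * h w" using \<gamma> by (intro ereal_mult_left_mono) auto
    then have "ereal \<gamma> * ereal m + ereal (1/2 * (norm (w - x))\<^sup>2) \<le> obj w"
      unfolding obj_def by (rule add_right_mono)
    moreover have gm: "\<gamma> * m = \<gamma> * \<phi> z + (x - u z) \<bullet> (w - u z)" using \<gamma> by (simp add: m_def)
    have "\<gamma> * m + 1/2 * (norm (w - x))\<^sup>2 = val + 1/2 * (norm (w - u z))\<^sup>2"
      unfolding gm val_def power2_norm_eq_inner
      by (simp add: inner_commute algebra_simps)
    ultimately show ?thesis by simp
  qed
  have upper: "obj (u z) \<le> ereal val"
  proof -
    have "h (u z) \<le> f z" unfolding h_def by (rule INF_lower) simp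
    then have "ereal \<gamma> * h (u z) \<le> ereal \<gamma> * ereal (\<phi> z)"
      using \<gamma> fin[OF zD] by (intro ereal_mult_left_mono) auto
    then have "obj (u z) \<le> ereal \<gamma> * ereal (\<phi> z) + ereal (1/2 * (norm (u z - x))\<^sup>2)"
      unfolding obj_def by (rule add_right_mono)
    then show ?thesis by (simp add: val_def)
  qed
  have "(THE w. w \<in> argmin_on obj UNIV) = u z"
  proof (rule the_equality)
    have "obj (u z) \<le> obj w" for w
    proof -
      note upper
      also have "ereal val \<le> ereal (val + 1/2 * (norm (w - u z))\<^sup>2)" by simp
      also note lower
      finally show ?thesis .
    qed
    moreover have "obj (u z) < \<infinity>" using upper by (rule le_less_trans) simp
    ultimately show "u z \<in> argmin_on obj UNIV" by (simp add: argmin_on_def)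
  next
    fix w assume "w \<in> argmin_on obj UNIV"
    then have "obj w \<le> obj (u z)" by (simp add: argmin_on_def)
    with lower[of w] upper have "ereal (val + 1/2 * (norm (w - u z))\<^sup>2) \<le> ereal val"
      by (meson order_trans)
    then show "w = u z" by simp
  qed
  then show "prox \<gamma> (\<lambda>w. INF z\<in>{z. u z = w}. f z) x = u z"
    unfolding prox_def obj_def h_def .
  show "z \<in> argmin_on f {z'. u z' = u z}"
  proof -
    have "f z \<le> f y" if "u y = u z" for y
    proof (cases "y \<in> eff_dom f")
      case True
      have "\<phi> z \<le> \<phi> y" using zp[OF True] that \<gamma> by simp
      then show ?thesis using fin[OF True] fin[OF zD] by simp
    qed (simp add: not_eff_dom)
    then show ?thesis using zD by (simp add: argmin_on_def eff_dom_def)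
  qed
qed

lemma argmin_on_sum:
  assumes f: "proper_fun f" and g: "proper_fun g"
  shows "(x, y) \<in> argmin_on (\<lambda>(x, y). f x + g y) C \<longleftrightarrow>
    (x, y) \<in> C \<and> x \<in> eff_dom f \<and> y \<in> eff_dom g \<and>
    (\<forall>x'\<in>eff_dom f. \<forall>y'\<in>eff_dom g. (x', y') \<in> C \<longrightarrow>
       real_of_ereal (f x) + real_of_ereal (g y) \<le> real_of_ereal (f x') + real_of_ereal (g y'))"
    (is "?l \<longleftrightarrow> ?r")
proof -
  have sum: "f x + g y = ereal (real_of_ereal (f x) + real_of_ereal (g y))"
    if "x \<in> eff_dom f" "y \<in> eff_dom g" for x y
    using proper_fun_eff_dom[OF f that(1)] proper_fun_eff_dom[OF g that(2)]
    by (metis plus_ereal.simps(1))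
  have inf: "f x + g y = \<infinity>" if "x \<notin> eff_dom f \<or> y \<notin> eff_dom g" for x y
    using that f g by (auto simp: not_eff_dom proper_fun_def)
  show ?thesis
  proof
    assume l: ?l
    then have xy: "(x, y) \<in> C" "f x + g y < \<infinity>"
      and min: "\<And>x' y'. (x', y') \<in> C \<Longrightarrow> f x + g y \<le> f x' + g y'"
      by (auto simp: argmin_on_def)
    have d: "x \<in> eff_dom f" "y \<in> eff_dom g" using xy(2) inf by fastforce+
    have "real_of_ereal (f x) + real_of_ereal (g y) \<le> real_of_ereal (f x') + real_of_ereal (g y')"
      if "x' \<in> eff_dom f" "y' \<in> eff_dom g" "(x', y') \<in> C" for x' y'
      using min[OF that(3)] sum[OF that(1,2)] sum[OF d] by simp
    with xy d show ?r by blast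
  next
    assume r: ?r
    have "f x + g y \<le> f x' + g y'" if "(x', y') \<in> C" for x' y'
    proof (cases "x' \<in> eff_dom f \<and> y' \<in> eff_dom g")
      case True
      then show ?thesis using r that sum by simp
    next
      case False
      then have eq: "f x' + g y' = \<infinity>" by (intro inf) blast
      show ?thesis unfolding eq by simp
    qed
    with r show ?l using sum by (auto simp: argmin_on_def)
  qed
qed

lemma argmin_on_diagonal: "x \<in> argmin_on (\<lambda>x. f x + g x) UNIV \<longleftrightarrow> (x, x) \<in> argmin_on (\<lambda>(x, y). f x + g y) {(x, y). x = y}"
  by (auto simp: argmin_on_def)

text \<open>The common form of the Douglas-Rachford and alternating direction methods: the problem is to
  minimize \<open>f x + g y\<close> subject to \<open>u x = w y\<close> for affine maps \<open>u\<close> and \<open>w\<close>, and the iteration uses the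
  partial minima of \<open>f\<close> and \<open>g\<close> over the fibres of these maps.\<close>

theorem splitting_linear_convergence:
  fixes f g :: "real^'n \<Rightarrow> ereal" and u w :: "real^'n \<Rightarrow> 'c::euclidean_space"
  assumes f: "proper_fun f" "convex_fun f" "PLQ f"
    and g: "proper_fun g" "convex_fun g" "PLQ g"
    and u: "linear A" "u = (\<lambda>z. A z + c)" and w: "linear B" "w = (\<lambda>z. B z + d)"
    and \<gamma>: "\<gamma> > 0" and \<alpha>: "0 < \<alpha>" "\<alpha> < 1"
    and sol: "argmin_on (\<lambda>(x, y). f x + g y) {(x, y). u x = w y} \<noteq> {}"
    and h1: "h1 = (\<lambda>v. INF z\<in>{z. u z = v}. f z)" and h2: "h2 = (\<lambda>v. INF z\<in>{z. w z = v}. g z)"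
    and F: "\<And>x. F x = (1 - \<alpha>) *\<^sub>R x + \<alpha> *\<^sub>R refl_prox \<gamma> h2 (refl_prox \<gamma> h1 x)"
  shows "error_bound F \<and> linear_convergence F
    (\<lambda>xs. \<exists>xh\<in>argmin_on f {x. u x = prox \<gamma> h1 xs}. \<exists>yh\<in>argmin_on g {y. w y = prox \<gamma> h1 xs}.
       (xh, yh) \<in> argmin_on (\<lambda>(x, y). f x + g y) {(x, y). u x = w y})"
proof -
  define \<phi> where "\<phi> = (\<lambda>x. real_of_ereal (f x))"
  define \<psi> where "\<psi> = (\<lambda>x. real_of_ereal (g x))"
  let ?Df = "eff_dom f" and ?Dg = "eff_dom g"
  obtain Jf Hf Qf lf bf where cf: "convex_plq ?Df \<phi> Jf Hf Qf lf bf"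
    using PLQ_imp_convex_plq[OF f] unfolding \<phi>_def by blast
  obtain Jg Hg Qg lg bg where cg: "convex_plq ?Dg \<psi> Jg Hg Qg lg bg"
    using PLQ_imp_convex_plq[OF g] unfolding \<psi>_def by blast
  obtain xs ys where "(xs, ys) \<in> argmin_on (\<lambda>(x, y). f x + g y) {(x, y). u x = w y}"
    using sol by auto
  then have s: "xs \<in> ?Df" "ys \<in> ?Dg" "u xs = w ys"
    and smin: "\<And>x y. x \<in> ?Df \<Longrightarrow> y \<in> ?Dg \<Longrightarrow> u x = w y \<Longrightarrow> \<phi> xs + \<psi> ys \<le> \<phi> x + \<psi> y"
    unfolding argmin_on_sum[OF f(1) g(1)] \<phi>_def \<psi>_def by auto
  note ex = splitting_prox_points[OF cf cg u w s smin \<gamma>]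
  define p1 where "p1 = prox \<gamma> h1"
  define p2 where "p2 = prox \<gamma> h2"
  have p1: "p1 x = u z" if "prox_point ?Df \<phi> u \<gamma> x z" for x z
    unfolding p1_def h1 by (rule prox_of_image_function(1)[OF f(1) \<gamma> that[unfolded \<phi>_def]])
  have p2: "p2 x = w z" if "prox_point ?Dg \<psi> w \<gamma> x z" for x z
    unfolding p2_def h2 by (rule prox_of_image_function(1)[OF g(1) \<gamma> that[unfolded \<psi>_def]])
  have e1: "\<exists>z. prox_point ?Df \<phi> u \<gamma> x z \<and> p1 x = u z" for x using ex(1) p1 by blast
  have e2: "\<exists>z. prox_point ?Dg \<psi> w \<gamma> x z \<and> p2 x = w z" for x using ex(2) p2 by blast
  define T where "T x = 2 *\<^sub>R p2 (2 *\<^sub>R p1 x - x) - (2 *\<^sub>R p1 x - x)" for x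
  have FT: "F x = (1 - \<alpha>) *\<^sub>R x + \<alpha> *\<^sub>R T x" for x
    by (simp add: F T_def p1_def p2_def refl_prox_def)
  obtain x1 where x1: "prox_point ?Df \<phi> u \<gamma> x1 xs" "prox_point ?Dg \<psi> w \<gamma> (2 *\<^sub>R u xs - x1) ys"
    using ex(3) by blast
  have Tx1: "T x1 = x1" using p1[OF x1(1)] p2[OF x1(2)] s(3) by (simp add: T_def)
  note op1 = convex_plq.prox_operator[OF cf u \<gamma> e1] and op2 = convex_plq.prox_operator[OF cg w \<gamma> e2]
  note dr = douglas_rachford_linear[OF op1 op2 \<alpha> T_def FT Tx1]
  have corr: "\<exists>xh\<in>argmin_on f {x. u x = p1 x0}. \<exists>yh\<in>argmin_on g {y. w y = p1 x0}.
       (xh, yh) \<in> argmin_on (\<lambda>(x, y). f x + g y) {(x, y). u x = w y}" if T: "T x0 = x0" for x0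
  proof -
    obtain xh where xh: "prox_point ?Df \<phi> u \<gamma> x0 xh" "p1 x0 = u xh" using e1 by blast
    obtain yh where yh: "prox_point ?Dg \<psi> w \<gamma> (2 *\<^sub>R u xh - x0) yh" "p2 (2 *\<^sub>R u xh - x0) = w yh" using e2 by blast
    have "2 *\<^sub>R w yh - (2 *\<^sub>R u xh - x0) = x0" using T by (simp add: T_def xh(2) yh(2))
    then have "2 *\<^sub>R w yh = 2 *\<^sub>R u xh" by (simp add: algebra_simps)
    then have eq: "w yh = u xh" by simp
    have "xh \<in> argmin_on f {x. u x = p1 x0}"
      using prox_of_image_function(2)[OF f(1) \<gamma> xh(1)[unfolded \<phi>_def]] xh(2) by simp
    moreover have "yh \<in> argmin_on g {y. w y = p1 x0}"
      using prox_of_image_function(2)[OF g(1) \<gamma> yh(1)[unfolded \<psi>_def]] xh(2) eq by simp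
    moreover have "(xh, yh) \<in> argmin_on (\<lambda>(x, y). f x + g y) {(x, y). u x = w y}"
    proof -
      have "xh \<in> ?Df" "yh \<in> ?Dg" using xh(1) yh(1) by (auto simp: prox_point_def)
      moreover have "\<phi> xh + \<psi> yh \<le> \<phi> x + \<psi> y" if "x \<in> ?Df" "y \<in> ?Dg" "u x = w y" for x y
        by (rule prox_points_imp_minimal[OF \<gamma> xh(1) yh(1) eq that])
      ultimately show ?thesis
        unfolding argmin_on_sum[OF f(1) g(1)] \<phi>_def \<psi>_def using eq by auto
    qed
    ultimately show ?thesis by blast
  qed
  show ?thesis
    unfolding linear_convergence_def p1_def[symmetric]
    using dr corr by meson
qed

text \<open>The derivative is represented by the value of its adjoint at \<open>1\<close>.\<close>

lemma gderiv_grad: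
  fixes f :: "'a::euclidean_space \<Rightarrow> ereal"
  assumes "differentiable_fun f"
  shows "GDERIV (\<lambda>x. real_of_ereal (f x)) x :> grad f x"
proof -
  obtain D where D: "((\<lambda>x. real_of_ereal (f x)) has_derivative D) (at x)"
    using assms by (auto simp: differentiable_fun_def differentiable_on_def differentiable_def)
  then have "linear D" by (rule has_derivative_linear)
  from adjoint_works[OF this, of _ 1] have "D = (\<lambda>h. h \<bullet> adjoint D 1)" by (simp add: fun_eq_iff)
  then have G: "GDERIV (\<lambda>x. real_of_ereal (f x)) x :> adjoint D 1"
    using D by (simp add: gderiv_def)
  then have "grad f x = adjoint D 1"
    unfolding grad_def by (intro the_equality) (auto intro: gderiv_unique)
  with G show ?thesis by simp
qed

text \<open>The operator \<open>p\<close> is only required to return the proximal point whenever there is one; existence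
  follows from optimality of \<open>xs\<close>. This lets one statement cover the proximal operator, the
  projection and the identity.\<close>

theorem forward_backward_step_sizes:
  fixes f :: "real^'n \<Rightarrow> ereal" and F :: "real \<Rightarrow> real^'n \<Rightarrow> real^'n"
  assumes f: "proper_fun f" "convex_fun f" "PLQ f" "differentiable_fun f"
    and g: "convex_plq D \<psi> J H Q l b"
    and sol: "xs \<in> D" "\<And>y. y \<in> D \<Longrightarrow> real_of_ereal (f xs) + \<psi> xs \<le> real_of_ereal (f y) + \<psi> y"
    and p: "\<And>s x z. s > 0 \<Longrightarrow> prox_point D \<psi> (\<lambda>z. z) s x z \<Longrightarrow> p s x = z"
    and F: "\<And>s x. F s x = p s (x - s *\<^sub>R grad f x)"
  shows "\<exists>s0>0. \<forall>s. 0 < s \<and> s < s0 \<longrightarrow> error_bound (F s) \<and>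
    linear_convergence (F s) (\<lambda>z. z \<in> D \<and> (\<forall>y\<in>D. real_of_ereal (f z) + \<psi> z \<le> real_of_ereal (f y) + \<psi> y))"
proof -
  note D = differentiable_fun_eff_dom[OF f(4)]
  obtain Jf Hf Qf lf bf where cf: "convex_plq UNIV (\<lambda>x. real_of_ereal (f x)) Jf Hf Qf lf bf"
    using PLQ_imp_convex_plq[OF f(1-3)] unfolding D by blast
  note G = gderiv_grad[OF f(4)]
  obtain K where K: "K > 0" "K-lipschitz_on UNIV (grad f)"
    using convex_plq.gradient_properties(2)[OF cf refl G] by blast
  have "error_bound (F s) \<and>
    linear_convergence (F s) (\<lambda>z. z \<in> D \<and> (\<forall>y\<in>D. real_of_ereal (f z) + \<psi> z \<le> real_of_ereal (f y) + \<psi> y))"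
    if s: "0 < s" "s < 1 / (2 * K)" for s
  proof -
    have sK: "2 * s * K < 1" using s K(1) by (simp add: field_simps)
    have lin: "linear (\<lambda>z::real^'n. z)" by (rule linear_id[unfolded id_def])
    have "\<exists>z. prox_point D \<psi> (\<lambda>z. z) s x z" for x
    proof (rule convex_plq.prox_point_exists[OF g lin _ s(1), where c = 0])
      fix z assume "z \<in> D"
      from composite_minimizer_first_order[OF g G sol this]
      show "\<psi> xs + grad f xs \<bullet> xs + (- grad f xs) \<bullet> z \<le> \<psi> z" by (simp add: inner_diff_right)
    qed simp
    then have pp: "prox_point D \<psi> (\<lambda>z. z) s x (p s x)" for x using p[OF s(1)] by metis
    show ?thesis
      using forward_backward_linear[OF cf g G K(2) sol s(1) sK pp F] by blast
  qed
  then show ?thesis using K(1) by (intro exI[of _ "1 / (2 * K)"]) auto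
qed

lemma prox_eq_prox_point:
  fixes f :: "'a::real_inner \<Rightarrow> ereal"
  assumes "proper_fun f" "\<gamma> > 0" "prox_point (eff_dom f) (\<lambda>x. real_of_ereal (f x)) (\<lambda>z. z) \<gamma> x z"
  shows "prox \<gamma> f x = z"
  using prox_of_image_function(1)[OF assms] by simp

lemma argmin_on_proper:
  assumes "proper_fun f"
  shows "x \<in> argmin_on f C \<longleftrightarrow>
    x \<in> C \<and> x \<in> eff_dom f \<and> (\<forall>y\<in>eff_dom f. y \<in> C \<longrightarrow> real_of_ereal (f x) \<le> real_of_ereal (f y))"
    (is "?l \<longleftrightarrow> ?r")
proof
  assume l: ?l
  then have x: "x \<in> C" "x \<in> eff_dom f" by (auto simp: argmin_on_def eff_dom_def)
  have "real_of_ereal (f x) \<le> real_of_ereal (f y)" if "y \<in> eff_dom f" "y \<in> C" for y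
  proof -
    have "f x \<le> f y" using l that by (simp add: argmin_on_def)
    then have "ereal (real_of_ereal (f x)) \<le> ereal (real_of_ereal (f y))"
      using proper_fun_eff_dom[OF assms] x(2) that(1) by simp
    then show ?thesis by simp
  qed
  with x show ?r by blast
next
  assume r: ?r
  have "f x \<le> f y" if "y \<in> C" for y
  proof (cases "y \<in> eff_dom f")
    case True
    then have "ereal (real_of_ereal (f x)) \<le> ereal (real_of_ereal (f y))" using r that by simp
    then show ?thesis using proper_fun_eff_dom[OF assms] r True by simp
  qed (simp add: not_eff_dom)
  with r show ?l by (simp add: argmin_on_def eff_dom_def)
qed

section \<open>The six methods\<close>

text \<open>The forward-backward iteration with smooth part \<open>0\<close>. Every number is a Lipschitz constant of its
  gradient, and \<open>1 / (4 \<gamma>)\<close> is small enough for the given step \<open>\<gamma>\<close>.\<close>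

corollary proximal_point_linear_convergence:
  fixes f :: "real^'n \<Rightarrow> ereal"
  assumes f: "proper_fun f" "convex_fun f" "PLQ f" and \<gamma>: "\<gamma> > 0"
    and sol: "argmin_on f UNIV \<noteq> {}"
  shows "error_bound (F_P \<gamma> f) \<and> linear_convergence (F_P \<gamma> f) (\<lambda>xs. xs \<in> argmin_on f UNIV)"
proof -
  let ?\<phi> = "\<lambda>x. real_of_ereal (f x)"
  obtain J H Q l b where cf: "convex_plq (eff_dom f) ?\<phi> J H Q l b"
    using PLQ_imp_convex_plq[OF f] by blast
  obtain J0 H0 Q0 l0 b0 where c0: "convex_plq (UNIV :: (real^'n) set) (\<lambda>x. 0) J0 H0 Q0 l0 b0"
    using convex_plq_indicator[OF polyhedron_UNIV UNIV_not_empty] by blast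
  have char: "(\<lambda>z. z \<in> argmin_on f UNIV) = (\<lambda>z. z \<in> eff_dom f \<and> (\<forall>y\<in>eff_dom f. 0 + ?\<phi> z \<le> 0 + ?\<phi> y))"
    by (simp add: argmin_on_proper[OF f(1)] fun_eq_iff)
  obtain xs where "xs \<in> argmin_on f UNIV" using sol by blast
  then have xs: "xs \<in> eff_dom f" "\<And>y. y \<in> eff_dom f \<Longrightarrow> 0 + ?\<phi> xs \<le> 0 + ?\<phi> y"
    by (auto simp: argmin_on_proper[OF f(1)])
  have lin: "linear (\<lambda>z::real^'n. z)" by (rule linear_id[unfolded id_def])
  have "\<exists>z. prox_point (eff_dom f) ?\<phi> (\<lambda>z. z) \<gamma> x z" for x
    by (rule convex_plq.prox_point_exists[OF cf lin _ \<gamma>, where c = 0 and v = 0 and \<beta> = "?\<phi> xs"])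
       (use xs in auto)
  then have p: "prox_point (eff_dom f) ?\<phi> (\<lambda>z. z) \<gamma> x (prox \<gamma> f x)" for x
    using prox_eq_prox_point[OF f(1) \<gamma>] by metis
  have K: "(1 / (4 * \<gamma>))-lipschitz_on UNIV (\<lambda>x::real^'n. 0::real^'n)"
    using \<gamma> by (intro lipschitz_onI) auto
  have \<gamma>K: "2 * \<gamma> * (1 / (4 * \<gamma>)) < 1" using \<gamma> by simp
  have F: "F_P \<gamma> f x = prox \<gamma> f (x - \<gamma> *\<^sub>R 0)" for x by (simp add: F_P_def)
  show ?thesis
    unfolding char
    using forward_backward_linear[OF c0 cf GDERIV_const K xs \<gamma> \<gamma>K p F] by blast
qed

corollary admm_linear_convergence:
  fixes f g :: "real^'n \<Rightarrow> ereal" and A B :: "real^'n^'m"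
  assumes f: "proper_fun f" "convex_fun f" "PLQ f" and g: "proper_fun g" "convex_fun g" "PLQ g"
    and \<gamma>: "\<gamma> > 0" and sol: "admm_solutions f g A B c \<noteq> {}"
  shows "error_bound (F_ADMM \<gamma> f g A B c) \<and> linear_convergence (F_ADMM \<gamma> f g A B c)
    (\<lambda>xs. \<exists>xh \<in> argmin_on f {x. c - A *v x = prox \<gamma> (admm_f f A c) xs}.
          \<exists>yh \<in> argmin_on g {y. B *v y = prox \<gamma> (admm_f f A c) xs}.
            (xh, yh) \<in> admm_solutions f g A B c)"
proof -
  have feas: "{(x, y). A *v x + B *v y = c} = {(x, y). c - A *v x = B *v y}"
    by (auto simp: algebra_simps)
  have A: "linear (\<lambda>z. - (A *v z))" by (intro linear_compose_neg matrix_vector_mul_linear)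
  have B: "linear (\<lambda>z. B *v z)" by (rule matrix_vector_mul_linear)
  show ?thesis
    unfolding admm_solutions_def feas
  proof (rule splitting_linear_convergence[OF f g A _ B _ \<gamma>, where c = c and d = 0 and \<alpha> = "1/2"])
    show "argmin_on (\<lambda>(x, y). f x + g y) {(x, y). c - A *v x = B *v y} \<noteq> {}"
      using sol unfolding admm_solutions_def feas .
    show "admm_f f A c = (\<lambda>v. INF z\<in>{z. c - A *v z = v}. f z)" by (rule ext) (rule admm_f_def)
    show "admm_g g B = (\<lambda>v. INF z\<in>{z. B *v z = v}. g z)" by (rule ext) (rule admm_g_def)
    show "F_ADMM \<gamma> f g A B c x = (1 - 1/2) *\<^sub>R x + (1/2) *\<^sub>R refl_prox \<gamma> (admm_g g B) (refl_prox \<gamma> (admm_f f A c) x)" for x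
      by (simp add: F_ADMM_def)
  qed auto
qed

corollary douglas_rachford_linear_convergence:
  fixes f g :: "real^'n \<Rightarrow> ereal"
  assumes f: "proper_fun f" "convex_fun f" "PLQ f" and g: "proper_fun g" "convex_fun g" "PLQ g"
    and \<gamma>: "\<gamma> > 0" and \<alpha>: "0 < \<alpha>" "\<alpha> < 1"
    and sol: "argmin_on (\<lambda>x. f x + g x) UNIV \<noteq> {}"
  shows "error_bound (F_DR \<alpha> \<gamma> f g) \<and> linear_convergence (F_DR \<alpha> \<gamma> f g)
    (\<lambda>xs. prox \<gamma> f xs \<in> argmin_on (\<lambda>x. f x + g x) UNIV)"
proof -
  have lin: "linear (\<lambda>z::real^'n. z)" by (rule linear_id[unfolded id_def])
  have "error_bound (F_DR \<alpha> \<gamma> f g) \<and> linear_convergence (F_DR \<alpha> \<gamma> f g)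
    (\<lambda>xs. \<exists>xh\<in>argmin_on f {x. x = prox \<gamma> f xs}. \<exists>yh\<in>argmin_on g {y. y = prox \<gamma> f xs}.
       (xh, yh) \<in> argmin_on (\<lambda>(x, y). f x + g y) {(x, y). x = y})"
  proof -
    have u: "(\<lambda>z::real^'n. z) = (\<lambda>z. z + 0)" by simp
    have s': "argmin_on (\<lambda>(x, y). f x + g y) {(x, y). x = y} \<noteq> {}"
    proof -
      obtain x where "x \<in> argmin_on (\<lambda>x. f x + g x) UNIV" using sol by (meson ex_in_conv)
      then have "(x, x) \<in> argmin_on (\<lambda>(x, y). f x + g y) {(x, y). x = y}" by (rule argmin_on_diagonal[THEN iffD1])
      then show ?thesis unfolding ex_in_conv[symmetric] by (rule exI)
    qed
    have h: "h = (\<lambda>v. INF z\<in>{z. z = v}. h z)" for h :: "real^'n \<Rightarrow> ereal" by simp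
    show ?thesis
      by (rule splitting_linear_convergence[OF f g lin u lin u \<gamma> \<alpha> s' h h F_DR_def])
  qed
  moreover have "prox \<gamma> f xs \<in> argmin_on (\<lambda>x. f x + g x) UNIV"
    if "\<exists>xh\<in>argmin_on f {x. x = prox \<gamma> f xs}. \<exists>yh\<in>argmin_on g {y. y = prox \<gamma> f xs}.
       (xh, yh) \<in> argmin_on (\<lambda>(x, y). f x + g y) {(x, y). x = y}" for xs
    using that by (auto simp: argmin_on_diagonal argmin_on_def)
  ultimately show ?thesis unfolding linear_convergence_def by meson
qed

text \<open>The forward-backward iteration with the indicator of \<open>S\<close>, represented by the value \<open>0\<close> on \<open>S\<close>.\<close>

corollary gradient_projection_linear_convergence:
  fixes f :: "real^'n \<Rightarrow> ereal"
  assumes f: "proper_fun f" "convex_fun f" "PLQ f" "differentiable_fun f"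
    and S: "polyhedron S" and sol: "argmin_on f S \<noteq> {}"
  shows "\<exists>s0>0. \<forall>s. 0 < s \<and> s < s0 \<longrightarrow>
    error_bound (F_GP s f S) \<and> linear_convergence (F_GP s f S) (\<lambda>xs. xs \<in> argmin_on f S)"
proof -
  obtain xs where "xs \<in> argmin_on f S" using sol by blast
  then have xs: "xs \<in> S" "\<And>y. y \<in> S \<Longrightarrow> real_of_ereal (f xs) + 0 \<le> real_of_ereal (f y) + 0"
    by (auto simp: argmin_on_proper[OF f(1)] differentiable_fun_eff_dom[OF f(4)])
  then have ne: "S \<noteq> {}" by blast
  obtain J H Q l b where c0: "convex_plq S (\<lambda>x. 0) J H Q l b"
    using convex_plq_indicator[OF S ne] by blast
  have char: "(\<lambda>z. z \<in> argmin_on f S) =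
      (\<lambda>z. z \<in> S \<and> (\<forall>y\<in>S. real_of_ereal (f z) + 0 \<le> real_of_ereal (f y) + 0))"
    by (auto simp: argmin_on_proper[OF f(1)] differentiable_fun_eff_dom[OF f(4)] fun_eq_iff)
  have cp: "closest_point S x = z" if "s > 0" "prox_point S (\<lambda>x. 0) (\<lambda>z. z) s x z" for s x z
  proof -
    have "prox_point S (\<lambda>x. 0) (\<lambda>z. z) s x (closest_point S x)"
      unfolding prox_point_def
      using closest_point_dot[OF polyhedron_imp_convex[OF S] polyhedron_imp_closed[OF S]]
        closest_point_in_set[OF polyhedron_imp_closed[OF S] ne] by auto
    from prox_point_unique[OF this that(2)] show ?thesis .
  qed
  have F: "F_GP s f S x = closest_point S (x - s *\<^sub>R grad f x)" for s x by (simp add: F_GP_def)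
  show ?thesis unfolding char
    by (rule forward_backward_step_sizes[OF f c0 xs(1), where p = "\<lambda>s. closest_point S"])
       (fact xs(2) cp F)+
qed

corollary gradient_descent_linear_convergence:
  fixes f :: "real^'n \<Rightarrow> ereal"
  assumes f: "proper_fun f" "convex_fun f" "PLQ f" "differentiable_fun f"
    and sol: "argmin_on f UNIV \<noteq> {}"
  shows "\<exists>s0>0. \<forall>s. 0 < s \<and> s < s0 \<longrightarrow>
    error_bound (F_GD s f) \<and> linear_convergence (F_GD s f) (\<lambda>xs. xs \<in> argmin_on f UNIV)"
proof -
  have "F_GD s f = F_GP s f UNIV" for s
    by (simp add: F_GD_def F_GP_def closest_point_self fun_eq_iff)
  then show ?thesis using gradient_projection_linear_convergence[OF f polyhedron_UNIV sol] by simp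
qed

corollary proximal_gradient_linear_convergence:
  fixes f g :: "real^'n \<Rightarrow> ereal"
  assumes f: "proper_fun f" "convex_fun f" "PLQ f" "differentiable_fun f"
    and g: "proper_fun g" "convex_fun g" "PLQ g"
    and sol: "argmin_on (\<lambda>x. f x + g x) UNIV \<noteq> {}"
  shows "\<exists>s0>0. \<forall>s. 0 < s \<and> s < s0 \<longrightarrow> error_bound (F_PG s f g) \<and>
    linear_convergence (F_PG s f g) (\<lambda>xs. xs \<in> argmin_on (\<lambda>x. f x + g x) UNIV)"
proof -
  let ?\<psi> = "\<lambda>x. real_of_ereal (g x)"
  obtain J H Q l b where cg: "convex_plq (eff_dom g) ?\<psi> J H Q l b"
    using PLQ_imp_convex_plq[OF g] by blast
  have char: "(\<lambda>z. z \<in> argmin_on (\<lambda>x. f x + g x) UNIV) =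
      (\<lambda>z. z \<in> eff_dom g \<and> (\<forall>y\<in>eff_dom g. real_of_ereal (f z) + ?\<psi> z \<le> real_of_ereal (f y) + ?\<psi> y))"
    unfolding argmin_on_diagonal argmin_on_sum[OF f(1) g(1)] differentiable_fun_eff_dom[OF f(4)]
    by (auto simp: fun_eq_iff)
  obtain xs where "xs \<in> argmin_on (\<lambda>x. f x + g x) UNIV" using sol by blast
  then have xs: "xs \<in> eff_dom g"
    "\<And>y. y \<in> eff_dom g \<Longrightarrow> real_of_ereal (f xs) + ?\<psi> xs \<le> real_of_ereal (f y) + ?\<psi> y"
    using fun_cong[OF char, of xs] by auto
  have F: "F_PG s f g x = prox s g (x - s *\<^sub>R grad f x)" for s x by (simp add: F_PG_def)
  show ?thesis unfolding char
    by (rule forward_backward_step_sizes[OF f cg xs(1), where p = "\<lambda>s. prox s g"])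
       (fact xs(2) prox_eq_prox_point[OF g(1)] F)+
qed

theorem proposition5:
  fixes f g :: "real^'n \<Rightarrow> ereal"
    and \<gamma> \<alpha> :: real
    and A B :: "real^'n^'m"
    and c :: "real^'m"
  assumes "proper_fun f" "closed_fun f" "convex_fun f" "PLQ f"
    and "proper_fun g" "closed_fun g" "convex_fun g" "PLQ g"
    and "\<gamma> > 0" "0 < \<alpha>" "\<alpha> < 1"
  shows
    "(argmin_on f UNIV \<noteq> {} \<longrightarrow>
        error_bound (F_P \<gamma> f) \<and>
        linear_convergence (F_P \<gamma> f) (\<lambda>xs. xs \<in> argmin_on f UNIV))
     \<and>
     (argmin_on (\<lambda>x. f x + g x) UNIV \<noteq> {} \<longrightarrow>
        error_bound (F_DR \<alpha> \<gamma> f g) \<and>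
        linear_convergence (F_DR \<alpha> \<gamma> f g)
          (\<lambda>xs. prox \<gamma> f xs \<in> argmin_on (\<lambda>x. f x + g x) UNIV))
     \<and>
     (admm_solutions f g A B c \<noteq> {} \<longrightarrow>
        error_bound (F_ADMM \<gamma> f g A B c) \<and>
        linear_convergence (F_ADMM \<gamma> f g A B c)
          (\<lambda>xs. \<exists>xh \<in> argmin_on f {x. c - A *v x = prox \<gamma> (admm_f f A c) xs}.
                \<exists>yh \<in> argmin_on g {y. B *v y = prox \<gamma> (admm_f f A c) xs}.
                  (xh, yh) \<in> admm_solutions f g A B c))
     \<and>
     (\<forall>S :: (real^'n) set.
        differentiable_fun f \<and>
        ((\<exists>\<mu>>0. strongly_convex \<mu> f) \<or> (\<exists>L>0. L_smooth L f)) \<and>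
        polyhedron S \<longrightarrow>
          (argmin_on f UNIV \<noteq> {} \<longrightarrow>
             (\<exists>s0>0. \<forall>s. 0 < s \<and> s < s0 \<longrightarrow>
                error_bound (F_GD s f) \<and>
                linear_convergence (F_GD s f) (\<lambda>xs. xs \<in> argmin_on f UNIV)))
          \<and>
          (argmin_on f S \<noteq> {} \<longrightarrow>
             (\<exists>s0>0. \<forall>s. 0 < s \<and> s < s0 \<longrightarrow>
                error_bound (F_GP s f S) \<and>
                linear_convergence (F_GP s f S) (\<lambda>xs. xs \<in> argmin_on f S)))
          \<and>
          (argmin_on (\<lambda>x. f x + g x) UNIV \<noteq> {} \<longrightarrow>
             (\<exists>s0>0. \<forall>s. 0 < s \<and> s < s0 \<longrightarrow>
                error_bound (F_PG s f g) \<and>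
                linear_convergence (F_PG s f g)
                  (\<lambda>xs. xs \<in> argmin_on (\<lambda>x. f x + g x) UNIV))))"
  apply (intro conjI allI)
  subgoal by (intro impI, rule proximal_point_linear_convergence[OF assms(1,3,4,9)])
  subgoal by (intro impI, rule douglas_rachford_linear_convergence[OF assms(1,3,4,5,7,8,9,10,11)])
  subgoal by (intro impI, rule admm_linear_convergence[OF assms(1,3,4,5,7,8,9)])
  subgoal for S
    apply (intro impI conjI; elim conjE)
    subgoal by (rule gradient_descent_linear_convergence[OF assms(1,3,4)])
    subgoal by (rule gradient_projection_linear_convergence[OF assms(1,3,4)])
    subgoal by (rule proximal_gradient_linear_convergence[OF assms(1,3,4) _ assms(5,7,8)])
    done
  done

end
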